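(* Let $q>0$, $q\notin\{2,4,6,\dots\}$. Then ${\rm Pos}(C_q)$ consists exactly of those functions $h\in C_e^\infty(S^{n-1})$ such that the Fourier transform of the distribution $\frac{1}{\Gamma(-q/2)}\,h\cdot r^q$ is positive on $\mathbb{R}^n\setminus\{0\}$.
   Context: $C_e^\infty(S^{n-1})$ is the space of even real-valued infinitely differentiable functions on $S^{n-1}$, ordered pointwise. For a linear operator $T:C_e^\infty(S^{n-1})\to C_e^\infty(S^{n-1})$, ${\rm Pos}(T)$ is the set of $h\in C_e^\infty(S^{n-1})$ such that $\int_{S^{n-1}}f(x)h(x)\,dx\ge 0$ for every $f\in C_e^\infty(S^{n-1})$ satisfying $Tf(x)\ge0$ for all $x\in S^{n-1}$. The $q$-cosine transform is $C_qf(\xi)=\int_{S^{n-1}}|(x,\xi)|^qf(x)\,dx$. For $h$ on $S^{n-1}$, $h\cdot r^s(x)=|x|_2^s h(x/|x|_2)$ on $\mathbb{R}^n\setminus\{0\}$, viewed as a Schwartz distribution. Fourier transform: $\hat\phi(x)=\int_{\mathbb{R}^n}\phi(\xi)e^{-i(x,\xi)}d\xi$, extended to distributions by $\langle\hat h,\phi\rangle=\langle h,\hat\phi\rangle$. A distribution is positive on $\mathbb{R}^n\setminus\{0\}$ if it is nonnegative on every nonnegative test function supported in $\mathbb{R}^n\setminus\{0\}$. *)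

theory Defs
  imports "HOL-Analysis.Analysis"
begin

coinductive smooth_on :: "'a::euclidean_space set \<Rightarrow> ('a \<Rightarrow> real) \<Rightarrow> bool" where
  "(\<forall>x\<in>S. f differentiable (at x)) \<Longrightarrow>
   (\<forall>b\<in>Basis. smooth_on S (\<lambda>x. frechet_derivative f (at x) b)) \<Longrightarrow> smooth_on S f"

text \<open>Integral over the unit sphere with respect to (unnormalised) surface measure,
 via the cone-measure description sigma(A) = n * lambda({t x : x in A, 0 < t <= 1}).\<close>
definition sphere_integral :: "('a::euclidean_space \<Rightarrow> real) \<Rightarrow> real" where
  "sphere_integral g =
     real DIM('a) * (\<integral>x. indicator (ball 0 1 - {0}) x * g (x /\<^sub>R norm x) \<partial>lborel)"

text \<open>Even C-infinity functions on the sphere: h is smooth on the sphere iff its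
 0-homogeneous extension is smooth on R^n minus the origin.\<close>
definition Ce_inf :: "('a::euclidean_space \<Rightarrow> real) set" where
  "Ce_inf = {h. smooth_on (- {0}) (\<lambda>x. h (x /\<^sub>R norm x)) \<and>
                (\<forall>x\<in>sphere 0 1. h (- x) = h x)}"

definition Pos :: "(('a::euclidean_space \<Rightarrow> real) \<Rightarrow> ('a \<Rightarrow> real)) \<Rightarrow> ('a \<Rightarrow> real) set" where
  "Pos T = {h \<in> Ce_inf. \<forall>f\<in>Ce_inf. (\<forall>x\<in>sphere 0 1. T f x \<ge> 0) \<longrightarrow>
                                    sphere_integral (\<lambda>x. f x * h x) \<ge> 0}"

definition cosine_transform :: "real \<Rightarrow> ('a::euclidean_space \<Rightarrow> real) \<Rightarrow> ('a \<Rightarrow> real)" where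
  "cosine_transform q f = (\<lambda>\<xi>. sphere_integral (\<lambda>x. \<bar>x \<bullet> \<xi>\<bar> powr q * f x))"

definition fourier :: "('a::euclidean_space \<Rightarrow> real) \<Rightarrow> 'a \<Rightarrow> complex" where
  "fourier \<phi> x = (\<integral>\<xi>. complex_of_real (\<phi> \<xi>) * cis (- (x \<bullet> \<xi>)) \<partial>lborel)"

definition tsupport :: "('a::euclidean_space \<Rightarrow> real) \<Rightarrow> 'a set" where
  "tsupport \<phi> = closure {x. \<phi> x \<noteq> 0}"

definition test_function :: "('a::euclidean_space \<Rightarrow> real) \<Rightarrow> bool" where
  "test_function \<phi> \<longleftrightarrow> smooth_on UNIV \<phi> \<and> compact (tsupport \<phi>)"

definition fourier_dist :: "('a::euclidean_space \<Rightarrow> complex) \<Rightarrow> ('a \<Rightarrow> real) \<Rightarrow> complex" where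
  "fourier_dist u \<phi> = (\<integral>x. u x * fourier \<phi> x \<partial>lborel)"

definition positive_off_origin :: "(('a::euclidean_space \<Rightarrow> real) \<Rightarrow> complex) \<Rightarrow> bool" where
  "positive_off_origin D \<longleftrightarrow>
     (\<forall>\<phi>. test_function \<phi> \<and> (\<forall>x. 0 \<le> \<phi> x) \<and> 0 \<notin> tsupport \<phi> \<longrightarrow>
          Im (D \<phi>) = 0 \<and> 0 \<le> Re (D \<phi>))"

text \<open>h \<cdot> r^s as a function on R^n (value at 0 irrelevant, measure zero).\<close>
definition hom_ext :: "('a::euclidean_space \<Rightarrow> real) \<Rightarrow> real \<Rightarrow> 'a \<Rightarrow> real" where
  "hom_ext h s x = norm x powr s * h (x /\<^sub>R norm x)"

end

theory Submission
  imports Defs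
begin

text \<open>For a test function \<open>\<phi>\<close> vanishing near the origin put
  \<open>F\<^sub>\<phi>(\<theta>) = \<Gamma>(-q/2)\<^sup>-\<^sup>1 \<integral> r\<^sup>q\<^sup>+\<^sup>n\<^sup>-\<^sup>1 \<Phi>(r\<theta>) dr\<close>, integrating over \<open>r > 0\<close>; here \<open>\<Phi>\<close> is the Fourier transform of \<open>\<phi>\<close>.
  Then \<open>F\<^sub>\<phi>\<close> is an even smooth function
  on the sphere. In polar coordinates, the Fourier transform of \<open>h r\<^sup>q / \<Gamma>(-q/2)\<close> tested against \<open>\<phi>\<close>
  is the integral of \<open>h F\<^sub>\<phi>\<close> over the sphere. Writing \<open>\<bar>t\<bar>\<^sup>q\<close> as a superposition of Taylor
  remainders of cosines and applying Fourier inversion on the line through \<open>\<xi>\<close> shows that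
  \<open>C\<^sub>q F\<^sub>\<phi>(\<xi>)\<close> is a positive multiple of the integral of \<open>s\<^sup>-\<^sup>q\<^sup>-\<^sup>1 (\<phi>(s\<xi>) + \<phi>(-s\<xi>))\<close> over \<open>s > 0\<close>: the
  moments of the Fourier transform vanish because \<open>\<phi>\<close> does near the origin, and the sign of the constant is
  that of \<open>\<Gamma>(-q/2)\<close>.

  So \<open>\<phi> \<ge> 0\<close> implies \<open>C\<^sub>q F\<^sub>\<phi> \<ge> 0\<close>, and members of \<open>Pos\<close> have positive Fourier transform.
  Conversely, every \<open>\<psi>\<close> is of the form \<open>C\<^sub>q F\<^sub>\<phi>\<close>, with \<open>\<phi> \<ge> 0\<close> if \<open>\<psi> \<ge> 0\<close>. If \<open>h = C\<^sub>q H\<close>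
  has positive Fourier transform, then by self-adjointness of \<open>C\<^sub>q\<close> the integral of \<open>H \<psi>\<close> is nonnegative for
  all \<open>\<psi> \<ge> 0\<close>, so \<open>H \<ge> 0\<close>, and the integral of \<open>f h\<close> equals that of \<open>H C\<^sub>q f\<close>, which is
  nonnegative whenever \<open>C\<^sub>q f\<close> is.\<close>

section \<open>Smooth functions\<close>

text \<open>The integral of s^(-q-1) cos(s t) over s > 0 diverges at s = 0, so |t|^q is not
  literally a superposition of cosines. Subtracting the Taylor polynomial of degree 2m with 2m < q <
  2m + 2 gives convergence at both ends, and the polynomial is harmless because it only meets
  vanishing moments. For q = 2m no choice of remainder converges at both ends, and Gamma(-q/2) has a
  pole. The remainder and Gamma(-q/2) both have sign (-1)^(m+1); dividing by Gamma(-q/2) cancels it.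
  The resulting constant depends only on q and the dimension n, not on \<phi> or \<xi>. Hence C_q
  F_\<phi> is a multiple of \<psi> when \<phi> is a fixed radial bump times \<psi>(x/|x|), which is
  how h = C_q H is solved. Functions on the sphere are extended homogeneously to the punctured
  space, and a direction is represented by a point of the unit ball, so that only Lebesgue measure
  occurs. The Fourier transform is treated as a real cosine integral with a phase; its sine part is
  odd and drops out against the even h r^q.\<close>

text \<open>Order 0 imposes nothing, not even continuity, so that order \<open>k\<close> means being
  \<open>k\<close> times differentiable.\<close>

fun Ck :: "nat \<Rightarrow> 'a::euclidean_space set \<Rightarrow> ('a \<Rightarrow> real) \<Rightarrow> bool" where
  "Ck 0 S f \<longleftrightarrow> True"
| "Ck (Suc k) S f \<longleftrightarrow> (\<forall>x\<in>S. f differentiable (at x)) \<and>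
     (\<forall>b\<in>Basis. Ck k S (\<lambda>x. frechet_derivative f (at x) b))"

text \<open>Exchanges the coinductive definition for a statement about every finite order, so that
  closure properties can be proved by induction on \<open>k\<close>.\<close>

lemma smooth_on_iff_Ck: "smooth_on S f \<longleftrightarrow> (\<forall>k. Ck k S f)"
proof
  assume "smooth_on S f"
  then have "Ck k S f" for k
  proof (induction k arbitrary: f)
    case (Suc k)
    from Suc.prems show ?case
      by cases (use Suc.IH in auto)
  qed simp
  then show "\<forall>k. Ck k S f" ..
next
  assume "\<forall>k. Ck k S f"
  then show "smooth_on S f"
  proof (coinduction arbitrary: f)
    case (smooth_on f)
    have a: "Ck (Suc k) S f" for k using smooth_on by blast
    from a[of 0] have "\<forall>x\<in>S. f differentiable (at x)" by simp
    moreover have "\<forall>b\<in>Basis. \<forall>k. Ck k S (\<lambda>x. frechet_derivative f (at x) b)"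
      using a by auto
    ultimately show ?case by blast
  qed
qed

lemma frechet_derivative_cong_open:
  assumes "open S" "x \<in> S" "\<And>y. y \<in> S \<Longrightarrow> f y = g y" "f differentiable (at x)"
  shows "g differentiable (at x)" "frechet_derivative g (at x) = frechet_derivative f (at x)"
proof -
  have "(f has_derivative frechet_derivative f (at x)) (at x)"
    using assms(4) frechet_derivative_works by blast
  then have *: "(g has_derivative frechet_derivative f (at x)) (at x)"
    using has_derivative_transform_within_open[OF _ assms(1,2)] assms(3) by blast
  show "g differentiable (at x)" using * differentiable_def by blast
  show "frechet_derivative g (at x) = frechet_derivative f (at x)"
    using frechet_derivative_at[OF *] by simp
qed

lemma Ck_cong_open:
  assumes "open S" "\<And>x. x \<in> S \<Longrightarrow> f x = g x" "Ck k S f"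
  shows "Ck k S g"
  using assms(2,3)
proof (induction k arbitrary: f g)
  case (Suc k)
  have d: "f differentiable (at x)" if "x \<in> S" for x using Suc.prems that by auto
  note fc = frechet_derivative_cong_open[OF assms(1) _ Suc.prems(1) d]
  have "Ck k S (\<lambda>x. frechet_derivative g (at x) b)" if "b \<in> Basis" for b
  proof (rule Suc.IH)
    show "Ck k S (\<lambda>x. frechet_derivative f (at x) b)" using Suc.prems(2) that by auto
    show "frechet_derivative f (at x) b = frechet_derivative g (at x) b" if "x \<in> S" for x
      using fc(2)[of x] that by simp
  qed
  then show ?case using fc(1) by auto
qed simp

text \<open>Allows an explicitly known derivative \<open>D\<close> in place of
  \<open>frechet_derivative\<close>: the two agree on S by uniqueness, and openness transfers this
  to all further derivatives.\<close>

lemma Ck_SucI: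
  assumes "open S" "\<And>x. x \<in> S \<Longrightarrow> (f has_derivative D x) (at x)"
    "\<And>b. b \<in> Basis \<Longrightarrow> Ck k S (\<lambda>x. D x b)"
  shows "Ck (Suc k) S f"
proof -
  have "Ck k S (\<lambda>x. frechet_derivative f (at x) b)" if "b \<in> Basis" for b
  proof (rule Ck_cong_open[OF assms(1) _ assms(3)[OF that]])
    show "D x b = frechet_derivative f (at x) b" if "x \<in> S" for x
      using frechet_derivative_at[OF assms(2)[OF that]] by simp
  qed
  then show ?thesis using assms(2) by (auto simp: differentiable_def)
qed

lemma Ck_SucD:
  assumes "Ck (Suc k) S f"
  shows "\<And>x. x \<in> S \<Longrightarrow> (f has_derivative frechet_derivative f (at x)) (at x)"
    "\<And>b. b \<in> Basis \<Longrightarrow> Ck k S (\<lambda>x. frechet_derivative f (at x) b)"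
  using assms frechet_derivative_works by auto

lemma Ck_Suc_imp: "Ck (Suc k) S f \<Longrightarrow> Ck k S f"
proof (induction k arbitrary: f)
  case (Suc k)
  then show ?case by (metis Ck.simps(2))
qed simp

lemma Ck_Un: "Ck k S f \<Longrightarrow> Ck k T f \<Longrightarrow> Ck k (S \<union> T) f"
  by (induction k arbitrary: f) auto

lemma Ck_const: "open S \<Longrightarrow> Ck k S (\<lambda>x. c)"
proof (induction k arbitrary: c)
  case (Suc k)
  show ?case
    by (rule Ck_SucI[where D="\<lambda>x b. 0"]) (use Suc in auto)
qed simp

lemma Ck_inner: "open S \<Longrightarrow> Ck k S (\<lambda>x. x \<bullet> b)"
proof (cases k)
  case (Suc l)
  assume "open S"
  then show ?thesis unfolding Suc
    by (intro Ck_SucI[where D="\<lambda>x h. h \<bullet> b"])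
      (auto intro!: derivative_eq_intros Ck_const)
qed simp

lemma Ck_add: "open S \<Longrightarrow> Ck k S f \<Longrightarrow> Ck k S g \<Longrightarrow> Ck k S (\<lambda>x. f x + g x)"
proof (induction k arbitrary: f g)
  case (Suc k)
  show ?case
    using Ck_SucD[OF Suc.prems(2)] Ck_SucD[OF Suc.prems(3)] Suc.prems(1)
    by (intro Ck_SucI[where D="\<lambda>x h. frechet_derivative f (at x) h + frechet_derivative g (at x) h"])
      (auto intro!: has_derivative_add Suc.IH)
qed simp

lemma Ck_mult: "open S \<Longrightarrow> Ck k S f \<Longrightarrow> Ck k S g \<Longrightarrow> Ck k S (\<lambda>x. f x * g x)"
proof (induction k arbitrary: f g)
  case (Suc k)
  show ?case
    using Ck_SucD[OF Suc.prems(2)] Ck_SucD[OF Suc.prems(3)] Suc.prems(1)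
      Ck_Suc_imp[OF Suc.prems(2)] Ck_Suc_imp[OF Suc.prems(3)]
    by (intro Ck_SucI[where D="\<lambda>x h. f x * frechet_derivative g (at x) h + frechet_derivative f (at x) h * g x"])
      (auto intro!: has_derivative_mult Suc.IH Ck_add)
qed simp

lemma Ck_sum:
  assumes "open S" "\<And>i. i \<in> I \<Longrightarrow> Ck k S (f i)"
  shows "Ck k S (\<lambda>x. \<Sum>i\<in>I. f i x)"
  using assms by (induction I rule: infinite_finite_induct) (auto intro: Ck_const Ck_add)

lemma Ck_inner_self: "open S \<Longrightarrow> Ck k S (\<lambda>x::'a::euclidean_space. x \<bullet> x)"
  by (subst euclidean_inner) (intro Ck_sum Ck_mult Ck_inner)

text \<open>The outer function has one real variable, so its derivative is multiplication by the
  number \<open>?g' t\<close>. The chain rule gives a product, and the induction hypothesis applies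
  with \<open>g\<close> replaced by \<open>?g'\<close>.\<close>

lemma Ck_compose:
  assumes "open S" "open T"
  shows "Ck k T g \<Longrightarrow> Ck k S f \<Longrightarrow> f ` S \<subseteq> T \<Longrightarrow> Ck k S (\<lambda>x. (g :: real \<Rightarrow> real) (f x))"
proof (induction k arbitrary: f g)
  case (Suc k)
  note f = Ck_SucD[OF Suc.prems(2)] and g = Ck_SucD[OF Suc.prems(1)]
  let ?g' = "\<lambda>t. frechet_derivative g (at t) 1"
  have gd: "(g has_derivative (\<lambda>h. ?g' t * h)) (at t)" if "t \<in> T" for t
  proof -
    have "linear (frechet_derivative g (at t))"
      using g(1)[OF that] has_derivative_linear by blast
    then have "frechet_derivative g (at t) h = ?g' t * h" for h
      using linear_scale[of "frechet_derivative g (at t)" h 1] by simp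
    then show ?thesis using g(1)[OF that] by (metis (no_types, lifting) ext)
  qed
  show ?case
  proof (rule Ck_SucI[where D="\<lambda>x h. ?g' (f x) * frechet_derivative f (at x) h", OF assms(1)])
    show "((\<lambda>x. g (f x)) has_derivative (\<lambda>h. ?g' (f x) * frechet_derivative f (at x) h)) (at x)"
      if "x \<in> S" for x
      using diff_chain_at[OF f(1)[OF that] gd] Suc.prems(3) that by (auto simp: o_def)
    show "Ck k S (\<lambda>x. ?g' (f x) * frechet_derivative f (at x) b)" if "b \<in> Basis" for b
    proof (rule Ck_mult[OF assms(1) _ f(2)[OF that]])
      have "Ck k T ?g'" by (rule g(2)) simp
      then show "Ck k S (\<lambda>x. ?g' (f x))"
        by (rule Suc.IH[OF _ Ck_Suc_imp[OF Suc.prems(2)] Suc.prems(3)])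
    qed
  qed
qed simp

lemma Ck_powr: "Ck k {0<..} (\<lambda>t::real. t powr a)"
proof (induction k arbitrary: a)
  case (Suc k)
  have "Ck k {0<..} (\<lambda>t. a * t powr (a - 1))"
    by (intro Ck_mult Ck_const Suc.IH) auto
  then show ?case
    by (intro Ck_SucI[where D="\<lambda>t h. a * t powr (a - 1) * h"])
      (auto intro!: has_real_derivative_powr simp flip: has_field_derivative_def)
qed simp

text \<open>The norm is replaced by a power of the polynomial \<open>x \<bullet> x\<close>, which is
  positive off the origin.\<close>

lemma Ck_norm_powr: "Ck k (-{0}) (\<lambda>x::'a::euclidean_space. norm x powr a)"
proof -
  have 1: "Ck k (-{0}) (\<lambda>x::'a. x \<bullet> x)"
    by (rule Ck_inner_self) auto
  have "Ck k (-{0}) (\<lambda>x::'a. (x \<bullet> x) powr (a/2))"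
    by (rule Ck_compose[OF _ _ Ck_powr 1]) auto
  then show ?thesis
  proof (rule Ck_cong_open[rotated 2])
    fix x :: 'a assume "x \<in> -{0}"
    then have "x \<bullet> x = norm x powr 2" by (simp add: power2_norm_eq_inner)
    then show "(x \<bullet> x) powr (a/2) = norm x powr a" by (simp only: powr_powr) simp
  qed auto
qed

text \<open>The factor \<open>inverse t ^ j\<close> is there because differentiating exp(-1/t)
  produces powers of 1/t. The linear span of the family over all \<open>j\<close> is closed under
  differentiation, so smoothness follows from a first-order computation.\<close>

definition flat :: "nat \<Rightarrow> real \<Rightarrow> real" where
  "flat j t = (if t > 0 then exp (- inverse t) * inverse t ^ j else 0)"

lemma flat_nonneg: "0 \<le> flat j t" by (simp add: flat_def)

lemma flat_pos_iff: "0 < flat j t \<longleftrightarrow> 0 < t" by (simp add: flat_def)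

lemma flat_tendsto_0: "(flat j \<longlongrightarrow> 0) (at_right 0)"
proof -
  have "((\<lambda>u::real. u ^ j / exp u) \<longlongrightarrow> 0) at_top" by (rule tendsto_power_div_exp_0)
  then have "((\<lambda>t::real. inverse t ^ j / exp (inverse t)) \<longlongrightarrow> 0) (at_right 0)"
    by (rule filterlim_compose[OF _ filterlim_inverse_at_top_right])
  then show ?thesis
    by (rule Lim_transform_eventually)
      (auto simp: eventually_at_filter flat_def exp_minus field_simps)
qed

lemma flat_has_derivative:
  "(flat j has_real_derivative (flat (j + 2) t - real j * flat (j + 1) t)) (at t)"
proof -
  consider "t > 0" | "t < 0" | "t = 0" by linarith
  then show ?thesis
  proof cases
    case 1
    have "((\<lambda>t. exp (- inverse t) * inverse t ^ j) has_real_derivative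
        (flat (j + 2) t - real j * flat (j + 1) t)) (at t)"
      using 1 by (auto intro!: derivative_eq_intros simp: flat_def field_simps power2_eq_square)
        (cases j; simp add: field_simps)
    then show ?thesis
      by (rule has_field_derivative_transform_within_open[where S="{0<..}"]) (use 1 in \<open>auto simp: flat_def\<close>)
  next
    case 2
    have "((\<lambda>t. 0) has_real_derivative (flat (j + 2) t - real j * flat (j + 1) t)) (at t)"
      using 2 by (simp add: flat_def)
    then show ?thesis
      by (rule has_field_derivative_transform_within_open[where S="{..<0}"]) (use 2 in \<open>auto simp: flat_def\<close>)
  next
    case 3
    have "((\<lambda>h. (flat j (0 + h) - flat j 0) / h) \<longlongrightarrow> 0) (at 0)"
    proof (rule filterlim_split_at)
      show "((\<lambda>h. (flat j (0 + h) - flat j 0) / h) \<longlongrightarrow> 0) (at_left 0)"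
        by (rule Lim_transform_eventually[OF tendsto_const])
          (auto simp: eventually_at_filter flat_def)
      \<comment> \<open>For h > 0 the difference quotient is \<open>flat (Suc j) h\<close>.\<close>
      show "((\<lambda>h. (flat j (0 + h) - flat j 0) / h) \<longlongrightarrow> 0) (at_right 0)"
        by (rule Lim_transform_eventually[OF flat_tendsto_0[of "Suc j"]])
          (auto simp: eventually_at_filter flat_def field_simps)
    qed
    then show ?thesis using 3 by (simp add: DERIV_def flat_def)
  qed
qed

lemma Ck_flat: "Ck k UNIV (flat j)"
proof (induction k arbitrary: j)
  case (Suc k)
  have "Ck k UNIV (\<lambda>t. flat (j + 2) t + (- real j) * flat (j + 1) t)"
    by (intro Ck_add Ck_mult Ck_const Suc.IH) auto
  then show ?case
    using flat_has_derivative[of j]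
    by (intro Ck_SucI[where D="\<lambda>t h. (flat (j + 2) t - real j * flat (j + 1) t) * h"])
      (auto simp: has_field_derivative_def)
qed simp

lemma smooth_on_imp_continuous_on: "smooth_on S f \<Longrightarrow> continuous_on S f"
  by (metis smooth_on_iff_Ck Ck_SucD(1) continuous_at_imp_continuous_on has_derivative_continuous)

lemma smooth_onD:
  assumes "smooth_on S f"
  shows "\<And>x. x \<in> S \<Longrightarrow> (f has_derivative frechet_derivative f (at x)) (at x)"
    "\<And>b. b \<in> Basis \<Longrightarrow> smooth_on S (\<lambda>x. frechet_derivative f (at x) b)"
  using assms Ck_SucD unfolding smooth_on_iff_Ck by blast+

lemma smooth_on_mult: "open S \<Longrightarrow> smooth_on S f \<Longrightarrow> smooth_on S g \<Longrightarrow> smooth_on S (\<lambda>x. f x * g x)"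
  by (simp add: smooth_on_iff_Ck Ck_mult)

section \<open>Polar coordinates\<close>

text \<open>A direction is represented by a point x of the punctured unit ball, and r is the radius.
  The factor \<open>DIM('a)\<close> is the one in \<open>sphere_integral\<close>, and
  \<open>r ^ (DIM('a) - 1)\<close> is the Jacobian of polar coordinates.\<close>

definition polar_weight :: "'a::euclidean_space \<Rightarrow> real \<Rightarrow> real" where
  "polar_weight x r = (if 0 < norm x \<and> norm x < 1 \<and> 0 < r then real DIM('a) * r ^ (DIM('a) - 1) else 0)"

lemma polar_weight_nonneg: "0 \<le> polar_weight x r"
  by (simp add: polar_weight_def)

lemma polar_weight_measurable [measurable]:
  "(\<lambda>p. polar_weight (fst p) (snd p)) \<in> borel_measurable (borel \<Otimes>\<^sub>M borel)"
  "polar_weight x \<in> borel_measurable borel"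
  unfolding polar_weight_def by (measurable, measurable)

lemma nn_integral_lborel_scale:
  fixes f :: "'a::euclidean_space \<Rightarrow> ennreal"
  assumes [measurable]: "f \<in> borel_measurable borel" and "t > 0"
  shows "(\<integral>\<^sup>+x. f x \<partial>lborel) = (\<integral>\<^sup>+x. ennreal (t ^ DIM('a)) * f (t *\<^sub>R x) \<partial>lborel)"
  by (subst lborel_affine[where c=t and t=0])
    (use assms in \<open>simp_all add: nn_integral_density nn_integral_distr\<close>)

text \<open>With \<open>a = norm y\<close> this is the total weight that a point y receives when its
  direction is averaged over the ball.\<close>

lemma nn_integral_powr_tail:
  fixes a :: real
  assumes "a > 0" "n > 0"
  shows "(\<integral>\<^sup>+t. ennreal (if a < t then real n * a ^ n / t ^ Suc n else 0) \<partial>lborel) = 1"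
proof -
  have "(\<integral>\<^sup>+t. ennreal (if a < t then real n * a ^ n / t ^ Suc n else 0) \<partial>lborel)
      = (\<integral>\<^sup>+t. ennreal (real n * a ^ n / t ^ Suc n) * indicator {a..} t \<partial>lborel)"
    using AE_lborel_singleton[of a]
    by (intro nn_integral_cong_AE) (auto simp: indicator_def elim!: eventually_mono)
  also have "\<dots> = ennreal (0 - (- (a ^ n / a ^ n)))"
  proof (rule nn_integral_FTC_atLeast[where F="\<lambda>t. - (a ^ n / t ^ n)"])
    show "((\<lambda>t. - (a ^ n / t ^ n)) has_real_derivative real n * a ^ n / t ^ Suc n) (at t)"
      if "a \<le> t" for t
      using that assms
      by (auto intro!: derivative_eq_intros simp: field_simps simp flip: power_Suc power_add)
    show "((\<lambda>t::real. - (a ^ n / t ^ n)) \<longlongrightarrow> 0) at_top"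
    proof -
      have "((\<lambda>t::real. a ^ n / t ^ n) \<longlongrightarrow> 0) at_top"
        by (rule tendsto_divide_0[OF tendsto_const filterlim_at_top_imp_at_infinity])
          (intro filterlim_pow_at_top filterlim_ident assms)
      from tendsto_minus[OF this] show ?thesis by simp
    qed
  qed (use assms in auto)
  finally show ?thesis using assms by simp
qed

text \<open>Only linear changes of variable and Tonelli enter: put r = |x| t, swap the order, then
  put y = t x for fixed t. The point y receives the weight \<open>w t y\<close>, whose integral over
  t is 1.\<close>

lemma polar_nn_integral:
  fixes f :: "'a::euclidean_space \<Rightarrow> ennreal"
  assumes [measurable]: "f \<in> borel_measurable borel"
  shows "(\<integral>\<^sup>+x. (\<integral>\<^sup>+r. ennreal (polar_weight x r) * f ((r / norm x) *\<^sub>R x) \<partial>lborel) \<partial>lborel)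
    = (\<integral>\<^sup>+x. f x \<partial>lborel)"
proof -
  let ?n = "DIM('a)"
  \<comment> \<open>With y = t x the weight n |x|^n t^(n-1), divided by the Jacobian t^n, is n |y|^n
    / t^(n+1); the condition |x| < 1 becomes |y| < t.\<close>
  define w where "w t y = (if norm y < t then real ?n * norm y ^ ?n / t ^ Suc ?n else 0)"
    for t :: real and y :: 'a
  have n: "norm x * norm x ^ (?n - 1) = norm x ^ ?n" for x :: 'a
    by (metis DIM_positive power_minus_mult mult.commute)
  have [measurable]: "case_prod w \<in> borel_measurable (borel \<Otimes>\<^sub>M borel)"
    unfolding w_def split_beta' by measurable
  have [measurable]: "w t \<in> borel_measurable borel" for t
    unfolding w_def by measurable
  have "(\<integral>\<^sup>+r. ennreal (polar_weight x r) * f ((r / norm x) *\<^sub>R x) \<partial>lborel)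
      = (\<integral>\<^sup>+t. ennreal (norm x * polar_weight x (norm x * t)) * f (t *\<^sub>R x) \<partial>lborel)" for x :: 'a
  proof (cases "x = 0")
    case False
    then show ?thesis
      by (subst nn_integral_real_affine[where c="norm x" and t=0])
        (auto simp: nn_integral_cmult[symmetric] ennreal_mult' mult.assoc)
  qed (simp add: polar_weight_def)
  then have "(\<integral>\<^sup>+x. (\<integral>\<^sup>+r. ennreal (polar_weight x r) * f ((r / norm x) *\<^sub>R x) \<partial>lborel) \<partial>lborel)
      = (\<integral>\<^sup>+x. (\<integral>\<^sup>+t. ennreal (norm x * polar_weight x (norm x * t)) * f (t *\<^sub>R x) \<partial>lborel) \<partial>lborel)"
    by simp
  also have "\<dots> = (\<integral>\<^sup>+t. (\<integral>\<^sup>+x. ennreal (norm x * polar_weight x (norm x * t)) * f (t *\<^sub>R x) \<partial>lborel) \<partial>lborel)"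
    by (rule lborel_pair.Fubini'[symmetric]) (simp add: polar_weight_def split_beta')
  also have "\<dots> = (\<integral>\<^sup>+t. (\<integral>\<^sup>+y. ennreal (w t y) * f y \<partial>lborel) \<partial>lborel)"
  proof (rule nn_integral_cong)
    fix t :: real
    show "(\<integral>\<^sup>+x. ennreal (norm x * polar_weight x (norm x * t)) * f (t *\<^sub>R x) \<partial>lborel)
        = (\<integral>\<^sup>+y. ennreal (w t y) * f y \<partial>lborel)"
    proof (cases "t > 0")
      case True
      have eq: "norm x * polar_weight x (norm x * t) = t ^ ?n * w t (t *\<^sub>R x)" for x :: 'a
      proof (cases "x = 0 \<or> norm x \<ge> 1")
        case True
        then show ?thesis using \<open>t > 0\<close> by (auto simp: w_def polar_weight_def mult_less_cancel_left1)
      next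
        case False
        have "t * t ^ (?n - 1) = t ^ ?n" by (metis DIM_positive power_minus_mult mult.commute)
        then show ?thesis using False \<open>t > 0\<close> n[of x]
          by (simp add: w_def polar_weight_def power_mult_distrib field_simps) (metis mult.assoc mult.left_commute)
      qed
      show ?thesis
        by (subst nn_integral_lborel_scale[OF _ True])
          (use True in \<open>auto simp: eq ennreal_mult' mult.assoc\<close>)
    next
      case False
      have "polar_weight x (norm x * t) = 0" for x :: 'a
        using False by (auto simp: polar_weight_def zero_less_mult_iff)
      moreover have "w t y = 0" for y using False le_less_trans[OF norm_ge_zero] by (auto simp: w_def)
      ultimately show ?thesis by simp
    qed
  qed
  also have "\<dots> = (\<integral>\<^sup>+y. (\<integral>\<^sup>+t. ennreal (w t y) * f y \<partial>lborel) \<partial>lborel)"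
    by (rule lborel_pair.Fubini') measurable
  also have "\<dots> = (\<integral>\<^sup>+y. f y \<partial>lborel)"
  proof (rule nn_integral_cong_AE)
    show "AE y in lborel. (\<integral>\<^sup>+t. ennreal (w t y) * f y \<partial>lborel) = f y"
      using AE_lborel_singleton[of 0]
    proof eventually_elim
      case (elim y)
      have "(\<integral>\<^sup>+t. ennreal (w t y) * f y \<partial>lborel) = (\<integral>\<^sup>+t. ennreal (w t y) \<partial>lborel) * f y"
        by (rule nn_integral_multc) (simp add: w_def)
      also have "\<dots> = f y"
        using nn_integral_powr_tail[of "norm y" ?n] elim by (simp add: w_def)
      finally show ?case .
    qed
  qed
  finally show ?thesis .
qed

text \<open>As an identity of measures, the polar formula transfers integrability as well as
  integrals of signed functions.\<close>

lemma polar_lborel: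
  "(lborel :: 'a::euclidean_space measure) =
     distr (density (lborel \<Otimes>\<^sub>M lborel) (\<lambda>p. ennreal (polar_weight (fst p) (snd p)))) borel
       (\<lambda>p. (snd p / norm (fst p)) *\<^sub>R fst p)" (is "_ = ?D")
proof (rule measure_eqI)
  fix A :: "'a set" assume "A \<in> sets lborel"
  then have [measurable]: "A \<in> sets borel" by simp
  have "emeasure ?D A = (\<integral>\<^sup>+x. indicator A x \<partial>?D)"
    by simp
  also have "\<dots> = (\<integral>\<^sup>+p. ennreal (polar_weight (fst p) (snd p)) * indicator A ((snd p / norm (fst p)) *\<^sub>R fst p)
      \<partial>(lborel \<Otimes>\<^sub>M lborel))"
    by (subst nn_integral_distr, measurable) (simp add: nn_integral_density)
  also have "\<dots> = (\<integral>\<^sup>+x. (\<integral>\<^sup>+r. ennreal (polar_weight x r) * indicator A ((r / norm x) *\<^sub>R x) \<partial>lborel) \<partial>lborel)"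
    by (subst lborel.nn_integral_fst[symmetric]) auto
  also have "\<dots> = (\<integral>\<^sup>+x. indicator A x \<partial>lborel)"
    by (rule polar_nn_integral) simp
  finally show "emeasure lborel A = emeasure ?D A" by simp
qed simp

lemma polar_integrable:
  fixes f :: "'a::euclidean_space \<Rightarrow> real"
  assumes [measurable]: "f \<in> borel_measurable borel"
  shows "integrable lborel f \<longleftrightarrow>
    integrable (lborel \<Otimes>\<^sub>M lborel) (\<lambda>(x, r). polar_weight x r * f ((r / norm x) *\<^sub>R x))"
  by (subst polar_lborel)
    (simp add: integrable_distr_eq integrable_density polar_weight_nonneg split_beta')

lemma polar_integral:
  fixes f :: "'a::euclidean_space \<Rightarrow> real"
  assumes "integrable lborel f"
  shows "(\<integral>x. f x \<partial>lborel) = sphere_integral (\<lambda>x. \<integral>r. indicator {0<..} r * r ^ (DIM('a) - 1) * f (r *\<^sub>R x) \<partial>lborel)"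
proof -
  have [measurable]: "f \<in> borel_measurable borel"
    using borel_measurable_integrable[OF assms] by simp
  have "(\<integral>x. f x \<partial>lborel) = (\<integral>p. polar_weight (fst p) (snd p) * f ((snd p / norm (fst p)) *\<^sub>R fst p) \<partial>(lborel \<Otimes>\<^sub>M lborel))"
    by (subst polar_lborel)
      (simp add: integral_distr integral_density polar_weight_nonneg)
  also have "\<dots> = (\<integral>x. (\<integral>r. polar_weight x r * f ((r / norm x) *\<^sub>R x) \<partial>lborel) \<partial>lborel)"
    using assms lborel_pair.integral_fst'[of "\<lambda>(x, r). polar_weight x r * f ((r / norm x) *\<^sub>R x)"]
    by (subst (asm) polar_integrable) (auto simp: split_beta')
  also have "\<dots> = sphere_integral (\<lambda>x. \<integral>r. indicator {0<..} r * r ^ (DIM('a) - 1) * f (r *\<^sub>R x) \<partial>lborel)"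
  proof -
    have "(\<integral>r. polar_weight x r * f ((r / norm x) *\<^sub>R x) \<partial>lborel) = real DIM('a) * (indicator (ball 0 1 - {0}) x *
      (\<integral>r. indicator {0<..} r * r ^ (DIM('a) - 1) * f (r *\<^sub>R (x /\<^sub>R norm x)) \<partial>lborel))" for x :: 'a
    proof (cases "x \<in> ball 0 1 - {0}")
      case True
      then show ?thesis
        by (auto simp: polar_weight_def indicator_def divide_inverse simp flip: integral_mult_right_zero
          intro!: Bochner_Integration.integral_cong)
    qed (auto simp: polar_weight_def)
    then show ?thesis by (simp add: sphere_integral_def)
  qed
  finally show ?thesis .
qed

text \<open>In polar coordinates the radial integrand is at most 1/(1+r)^2, because r^(n-1) \<le>
  (1+r)^(n-1); hence the exponent n + 1.\<close>

lemma integrable_inverse_power_norm: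
  "integrable lborel (\<lambda>x::'a::euclidean_space. inverse ((1 + norm x) ^ (DIM('a) + 1)))"
proof (rule integrableI_bounded)
  let ?n = "DIM('a)"
  have m: "polar_weight x r * inverse ((1 + norm ((r / norm x) *\<^sub>R x)) ^ (?n + 1)) \<le>
      real ?n * indicator (ball 0 1) x * (indicator {0..} r * inverse ((1 + r)\<^sup>2))" for x :: 'a and r
  proof (cases "x \<in> ball 0 1 - {0} \<and> r > 0")
    case True
    have "r ^ (?n - 1) * inverse ((1 + r) ^ (?n + 1)) \<le> (1 + r) ^ (?n - 1) * inverse ((1 + r) ^ (?n + 1))"
      using True by (intro mult_right_mono power_mono) auto
    also have "\<dots> = inverse ((1 + r)\<^sup>2)"
    proof -
      have "(1 + r) ^ (?n + 1) = (1 + r) ^ (?n - 1) * (1 + r)\<^sup>2"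
        by (simp flip: power_add)
      then show ?thesis using True by (simp add: field_simps)
    qed
    finally have "r ^ (?n - 1) * inverse ((1 + r) ^ (?n + 1)) \<le> inverse ((1 + r)\<^sup>2)" .
    from mult_left_mono[OF this, of "real ?n"] show ?thesis using True
      by (simp add: polar_weight_def mult.assoc del: power_Suc)
  next
    case False
    then have "polar_weight x r = 0" by (auto simp: polar_weight_def)
    then show ?thesis by simp
  qed
  have "(\<integral>\<^sup>+x. ennreal (norm (inverse ((1 + norm (x::'a)) ^ (?n + 1)))) \<partial>lborel)
    = (\<integral>\<^sup>+(x::'a). (\<integral>\<^sup>+r. ennreal (polar_weight x r) *
        ennreal (norm (inverse ((1 + norm ((r / norm x) *\<^sub>R x)) ^ (?n + 1)))) \<partial>lborel) \<partial>lborel)"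
    by (rule polar_nn_integral[symmetric]) simp
  also have "\<dots> \<le> (\<integral>\<^sup>+(x::'a). (\<integral>\<^sup>+r. ennreal (real ?n * indicator (ball 0 1) x) *
       (ennreal (inverse ((1 + r)\<^sup>2)) * indicator {0..} r) \<partial>lborel) \<partial>lborel)"
  proof (intro nn_integral_mono)
    fix x :: 'a and r :: real
    have "ennreal (polar_weight x r) * ennreal (norm (inverse ((1 + norm ((r / norm x) *\<^sub>R x)) ^ (?n + 1))))
       = ennreal (polar_weight x r * inverse ((1 + norm ((r / norm x) *\<^sub>R x)) ^ (?n + 1)))"
      by (simp add: ennreal_mult' polar_weight_nonneg)
    also have "\<dots> \<le> ennreal (real ?n * indicator (ball 0 1) x * (indicator {0..} r * inverse ((1 + r)\<^sup>2)))"
      by (rule ennreal_leI[OF m])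
    also have "\<dots> = ennreal (real ?n * indicator (ball 0 1) x) * (ennreal (inverse ((1 + r)\<^sup>2)) * indicator {0..} r)"
      by (auto simp: ennreal_mult' indicator_def)
    finally show "ennreal (polar_weight x r) * ennreal (norm (inverse ((1 + norm ((r / norm x) *\<^sub>R x)) ^ (?n + 1))))
       \<le> ennreal (real ?n * indicator (ball 0 1) x) * (ennreal (inverse ((1 + r)\<^sup>2)) * indicator {0..} r)" .
  qed
  also have "\<dots> = (\<integral>\<^sup>+(x::'a). ennreal (real ?n * indicator (ball 0 1) x) * ennreal (0 - (- inverse (1 + 0))) \<partial>lborel)"
  proof (intro nn_integral_cong, subst nn_integral_cmult)
    fix x :: 'a
    have "(\<integral>\<^sup>+r. ennreal (inverse ((1 + r)\<^sup>2)) * indicator {0..} r \<partial>lborel) = ennreal (0 - (- inverse (1 + 0)))"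
    proof (rule nn_integral_FTC_atLeast[where F="\<lambda>r. - inverse (1 + r)"])
      show "((\<lambda>r. - inverse (1 + r)) has_real_derivative inverse ((1 + r)\<^sup>2)) (at r)" if "0 \<le> r" for r :: real
        using that by (auto intro!: derivative_eq_intros simp: power2_eq_square)
      have "((\<lambda>r::real. inverse (1 + r)) \<longlongrightarrow> 0) at_top"
        by (intro tendsto_inverse_0_at_top filterlim_tendsto_add_at_top[OF tendsto_const] filterlim_ident)
      then show "((\<lambda>r::real. - inverse (1 + r)) \<longlongrightarrow> 0) at_top"
        using tendsto_minus by fastforce
    qed auto
    then show "ennreal (real ?n * indicator (ball 0 1) x) * (\<integral>\<^sup>+r. ennreal (inverse ((1 + r)\<^sup>2)) * indicator {0..} r \<partial>lborel)
      = ennreal (real ?n * indicator (ball 0 1) x) * ennreal (0 - (- inverse (1 + 0)))" by simp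
  qed simp
  also have "\<dots> = (\<integral>\<^sup>+(x::'a). ennreal (real ?n) * indicator (ball 0 1) x \<partial>lborel)"
    by (intro nn_integral_cong) (auto simp: indicator_def)
  also have "\<dots> = ennreal (real ?n) * emeasure lborel (ball (0::'a) 1)"
    by (rule nn_integral_cmult_indicator) simp
  also have "\<dots> < \<infinity>"
    using emeasure_bounded_finite[of "ball (0::'a) 1"] by (simp add: ennreal_mult_less_top)
  finally show "(\<integral>\<^sup>+x. ennreal (norm (inverse ((1 + norm (x::'a)) ^ (?n + 1)))) \<partial>lborel) < \<infinity>" .
qed simp

section \<open>Differentiation under the integral sign\<close>

text \<open>Dominated convergence along sequences tending to \<open>x0\<close>; the mean value
  inequality on the ball turns the bound on the derivative into a bound on difference
  quotients.\<close>

lemma has_derivative_integral: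
  fixes f :: "'a::euclidean_space \<Rightarrow> 'b \<Rightarrow> real"
  assumes e: "e > 0"
    and int: "\<And>x. x \<in> ball x0 e \<Longrightarrow> integrable M (f x)"
    and der: "\<And>x r. x \<in> ball x0 e \<Longrightarrow> ((\<lambda>x. f x r) has_derivative D x r) (at x)"
    and bnd: "\<And>x r h. x \<in> ball x0 e \<Longrightarrow> \<bar>D x r h\<bar> \<le> w r * norm h"
    and w: "integrable M w"
    and meas: "\<And>h. (\<lambda>r. D x0 r h) \<in> borel_measurable M"
  shows "((\<lambda>x. \<integral>r. f x r \<partial>M) has_derivative (\<lambda>h. \<integral>r. D x0 r h \<partial>M)) (at x0)"
proof -
  have x0: "x0 \<in> ball x0 e" using e by simp
  have lin: "bounded_linear (D x0 r)" for r
    using der[OF x0] has_derivative_bounded_linear by blast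
  have Dint: "integrable M (\<lambda>r. D x0 r h)" for h
    by (rule Bochner_Integration.integrable_bound[OF integrable_mult_left[OF w, of "norm h"] meas])
      (use bnd[OF x0] abs_ge_self order_trans in \<open>fastforce intro!: AE_I2\<close>)
  have bl: "bounded_linear (\<lambda>h. \<integral>r. D x0 r h \<partial>M)"
  proof (rule bounded_linear_intro)
    show "(\<integral>r. D x0 r (x + y) \<partial>M) = (\<integral>r. D x0 r x \<partial>M) + (\<integral>r. D x0 r y \<partial>M)" for x y
      using Dint by (simp add: bounded_linear.linear[OF lin] linear_add)
    show "(\<integral>r. D x0 r (c *\<^sub>R x) \<partial>M) = c *\<^sub>R (\<integral>r. D x0 r x \<partial>M)" for c x
      by (simp add: bounded_linear.linear[OF lin] linear_scale)
    show "norm (\<integral>r. D x0 r x \<partial>M) \<le> norm x * (\<integral>r. w r \<partial>M)" for x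
    proof -
      have "norm (\<integral>r. D x0 r x \<partial>M) \<le> (\<integral>r. w r * norm x \<partial>M)"
        by (rule order_trans[OF integral_norm_bound integral_mono])
          (use w Dint bnd[OF x0] in auto)
      then show ?thesis by (simp add: mult.commute)
    qed
  qed
  have "((\<lambda>x. \<integral>r. f x r \<partial>M) has_derivative (\<lambda>h. \<integral>r. D x0 r h \<partial>M)) (at x0 within ball x0 e)"
    unfolding has_derivative_iff_norm tendsto_at_iff_sequentially
  proof (intro conjI bl allI impI)
    fix X assume "\<forall>i. X i \<in> ball x0 e - {x0}" and X: "X \<longlonglongrightarrow> x0"
    then have Xi: "\<And>i. X i \<in> ball x0 e" "\<And>i. X i \<noteq> x0" by auto
    \<comment> \<open>The error quotient. The difference quotient and \<open>D x0\<close> each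
      contribute at most \<open>w r\<close>, hence the majorant \<open>2 * w r\<close>.\<close>
    define Q where "Q i r = (f (X i) r - f x0 r - D x0 r (X i - x0)) / norm (X i - x0)" for i r
    have "(\<lambda>i. \<integral>r. Q i r \<partial>M) \<longlonglongrightarrow> (\<integral>r. 0 \<partial>M)"
    proof (rule integral_dominated_convergence)
      show "integrable M (\<lambda>r. 2 * w r)" using w by simp
      show "Q i \<in> borel_measurable M" for i
        unfolding Q_def using int[OF Xi(1), of i] int[OF x0] Dint
        by (intro borel_measurable_divide borel_measurable_diff borel_measurable_integrable) auto
      show "AE r in M. (\<lambda>i. Q i r) \<longlonglongrightarrow> 0"
      proof (rule AE_I2)
        fix r
        have "((\<lambda>y. norm (f y r - f x0 r - D x0 r (y - x0)) / norm (y - x0)) \<longlongrightarrow> 0) (at x0)"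
          using der[OF x0, of r] unfolding has_derivative_iff_norm by blast
        then have "(\<lambda>i. norm (f (X i) r - f x0 r - D x0 r (X i - x0)) / norm (X i - x0)) \<longlonglongrightarrow> 0"
          unfolding tendsto_at_iff_sequentially using Xi X by (auto simp: o_def)
        then show "(\<lambda>i. Q i r) \<longlonglongrightarrow> 0"
          by (subst tendsto_norm_zero_iff[symmetric]) (simp add: Q_def)
      qed
      show "AE r in M. norm (Q i r) \<le> 2 * w r" for i
      proof (rule AE_I2)
        fix r
        have "norm (f (X i) r - f x0 r) \<le> w r * norm (X i - x0)"
        proof (rule differentiable_bound[where S="ball x0 e" and f'="\<lambda>x. D x r"])
          show "((\<lambda>x. f x r) has_derivative D x r) (at x within ball x0 e)" if "x \<in> ball x0 e" for x
            using der[OF that] has_derivative_at_withinI by blast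
          show "onorm (D x r) \<le> w r" if "x \<in> ball x0 e" for x
            by (rule onorm_le) (use bnd[OF that] in auto)
        qed (use Xi x0 in auto)
        moreover have "\<bar>D x0 r (X i - x0)\<bar> \<le> w r * norm (X i - x0)" by (rule bnd[OF x0])
        ultimately have "\<bar>f (X i) r - f x0 r - D x0 r (X i - x0)\<bar> \<le> 2 * w r * norm (X i - x0)"
          by simp
        then show "norm (Q i r) \<le> 2 * w r" using Xi(2)[of i]
          by (simp add: Q_def field_simps)
      qed
    qed auto
    moreover have "(\<integral>r. Q i r \<partial>M) =
        ((\<integral>r. f (X i) r \<partial>M) - (\<integral>r. f x0 r \<partial>M) - (\<integral>r. D x0 r (X i - x0) \<partial>M)) / norm (X i - x0)" for i
      unfolding Q_def using int[OF Xi(1), of i] int[OF x0] Dint by simp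
    ultimately have "(\<lambda>i. ((\<integral>r. f (X i) r \<partial>M) - (\<integral>r. f x0 r \<partial>M) - (\<integral>r. D x0 r (X i - x0) \<partial>M)) / norm (X i - x0)) \<longlonglongrightarrow> 0"
      by simp
    from tendsto_norm_zero[OF this]
    show "((\<lambda>y. norm ((\<integral>r. f y r \<partial>M) - (\<integral>r. f x0 r \<partial>M) - (\<integral>r. D x0 r (y - x0) \<partial>M)) / norm (y - x0)) \<circ> X) \<longlonglongrightarrow> 0"
      by (simp add: o_def)
  qed
  then show ?thesis using at_within_open[OF x0] by simp
qed

lemma integral_lborel_translate:
  fixes f :: "'a::euclidean_space \<Rightarrow> real"
  assumes [measurable]: "f \<in> borel_measurable borel"
  shows "(\<integral>x. f (x + c) \<partial>lborel) = (\<integral>x. f x \<partial>lborel)"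
  by (subst lborel_distr_plus[of c, symmetric]) (simp add: integral_distr add.commute)

lemma integrable_lborel_translate:
  fixes f :: "'a::euclidean_space \<Rightarrow> real"
  assumes "integrable lborel f"
  shows "integrable lborel (\<lambda>x. f (x + c))"
proof -
  have [measurable]: "f \<in> borel_measurable borel" using assms by auto
  have "integrable (distr lborel borel ((+) c)) f" using assms by (simp add: lborel_distr_plus)
  then show ?thesis by (subst (asm) integrable_distr_eq) (simp_all add: add.commute)
qed

text \<open>The integral of \<open>u (x + t *\<^sub>R b)\<close> does not depend on t by translation
  invariance; differentiate under the integral at t = 0. This serves as integration by parts
  below.\<close>

lemma integral_directional_derivative_eq_0:
  fixes u :: "'a::euclidean_space \<Rightarrow> real"
  assumes der: "\<And>x. (u has_derivative U x) (at x)"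
    and int: "integrable lborel u"
    and bnd: "\<And>x. \<bar>U x b\<bar> \<le> C * inverse ((1 + norm x) ^ (DIM('a) + 1))"
    and [measurable]: "(\<lambda>x. U x b) \<in> borel_measurable borel"
  shows "(\<integral>x. U x b \<partial>lborel) = 0"
proof -
  have [measurable]: "u \<in> borel_measurable borel" using int by auto
  \<comment> \<open>Makes the decay bound uniform over shifts with |t| < 1, by 1 + |x| \<le> (1 + |x
    + t b|)(1 + |b|).\<close>
  define B where "B = (1 + norm b) ^ (DIM('a) + 1)"
  have C: "C \<ge> 0" using bnd[of 0] by simp
  have "((\<lambda>t. \<integral>x. u (x + t *\<^sub>R b) \<partial>lborel) has_derivative (\<lambda>h. \<integral>x. h * U (x + 0 *\<^sub>R b) b \<partial>lborel)) (at (0::real))"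
  proof (rule has_derivative_integral[where e=1 and w="\<lambda>x. C * (B * inverse ((1 + norm x) ^ (DIM('a) + 1)))"])
    show "integrable lborel (\<lambda>x. u (x + t *\<^sub>R b))" for t
      by (rule integrable_lborel_translate[OF int])
    show "((\<lambda>t. u (x + t *\<^sub>R b)) has_derivative (\<lambda>h. h * U (x + t *\<^sub>R b) b)) (at t)" for x t
    proof -
      have "((\<lambda>t. x + t *\<^sub>R b) has_derivative (\<lambda>h. h *\<^sub>R b)) (at t)"
        by (auto intro!: derivative_eq_intros)
      from has_derivative_compose[OF this der]
      show ?thesis
        using linear_scale[OF has_derivative_linear[OF der[of "x + t *\<^sub>R b"]]] by simp
    qed
    show "\<bar>h * U (x + t *\<^sub>R b) b\<bar> \<le> C * (B * inverse ((1 + norm x) ^ (DIM('a) + 1))) * norm h"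
      if t: "t \<in> ball (0::real) 1" for t x h
    proof -
      let ?y = "x + t *\<^sub>R b"
      have "norm x \<le> norm ?y + norm (t *\<^sub>R b)"
        by (metis add_diff_cancel_right' norm_triangle_ineq4)
      also have "norm (t *\<^sub>R b) \<le> norm b" using t by (simp add: mult_left_le_one_le)
      finally have nx: "norm x \<le> norm ?y + norm b" by simp
      have "1 + norm x \<le> (1 + norm ?y) * (1 + norm b)"
      proof -
        have "0 \<le> norm b * norm ?y" by simp
        moreover have "(1 + norm ?y) * (1 + norm b) = 1 + norm ?y + norm b + norm b * norm ?y"
          by (simp add: algebra_simps)
        ultimately show ?thesis using nx by linarith
      qed
      then have "(1 + norm x) ^ (DIM('a) + 1) \<le> ((1 + norm ?y) * (1 + norm b)) ^ (DIM('a) + 1)"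
        by (intro power_mono) auto
      then have "(1 + norm x) ^ (DIM('a) + 1) \<le> (1 + norm ?y) ^ (DIM('a) + 1) * B"
        by (simp only: B_def power_mult_distrib)
      then have "inverse ((1 + norm ?y) ^ (DIM('a) + 1)) \<le> B * inverse ((1 + norm x) ^ (DIM('a) + 1))"
      proof -
        have p: "0 < (1 + norm z) ^ (DIM('a) + 1)" for z :: 'a
          by (intro zero_less_power) (simp add: add_pos_nonneg)
        have "inverse c \<le> B * inverse a" if "a \<le> c * B" "0 < a" "0 < c" for a c :: real
          using that by (simp add: field_simps)
        from this[OF \<open>_ \<le> (1 + norm ?y) ^ _ * B\<close> p p] show ?thesis .
      qed
      then have "\<bar>U ?y b\<bar> \<le> C * (B * inverse ((1 + norm x) ^ (DIM('a) + 1)))"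
        using bnd[of ?y] C by (meson mult_left_mono order_trans)
      then show ?thesis
        by (simp add: abs_mult mult.commute[of "\<bar>h\<bar>"] mult_right_mono)
    qed
    show "integrable lborel (\<lambda>x::'a. C * (B * inverse ((1 + norm x) ^ (DIM('a) + 1))))"
      by (intro integrable_mult_right integrable_inverse_power_norm)
  qed auto
  moreover have "(\<lambda>t. \<integral>x. u (x + t *\<^sub>R b) \<partial>lborel) = (\<lambda>t. \<integral>x. u x \<partial>lborel)"
    by (simp add: integral_lborel_translate)
  ultimately have "((\<lambda>t::real. \<integral>x. u x \<partial>lborel) has_derivative (\<lambda>h. h * (\<integral>x. U x b \<partial>lborel))) (at 0)"
    by simp
  from has_derivative_unique[OF this has_derivative_const]
  show ?thesis by (metis mult_1)
qed

section \<open>Fourier transforms of test functions\<close>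

text \<open>Stands in for \<open>test_function\<close>, with a radius in place of a closed support:
  this form passes directly to products and derivatives.\<close>

definition compact_smooth :: "('a::euclidean_space \<Rightarrow> real) \<Rightarrow> bool" where
  "compact_smooth \<phi> \<longleftrightarrow> smooth_on UNIV \<phi> \<and> (\<exists>R. \<forall>x. R < norm x \<longrightarrow> \<phi> x = 0)"

lemma compact_smooth_continuous: "compact_smooth \<phi> \<Longrightarrow> continuous_on S \<phi>"
  unfolding compact_smooth_def using smooth_on_imp_continuous_on continuous_on_subset by blast

lemma compact_smooth_measurable: "compact_smooth \<phi> \<Longrightarrow> \<phi> \<in> borel_measurable borel"
  by (intro borel_measurable_continuous_onI compact_smooth_continuous)

lemma compact_smooth_mult:
  assumes "compact_smooth \<phi>" "\<And>k. Ck k UNIV g"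
  shows "compact_smooth (\<lambda>x. \<phi> x * g x)"
  using assms unfolding compact_smooth_def
  by (auto intro!: smooth_on_mult) (auto simp: smooth_on_iff_Ck)

lemma compact_smooth_integrable_mult:
  fixes \<phi> :: "'a::euclidean_space \<Rightarrow> real"
  assumes "compact_smooth \<phi>" "continuous_on UNIV g"
  shows "integrable lborel (\<lambda>x. \<phi> x * g x)"
proof -
  obtain R where R: "\<And>x. R < norm x \<Longrightarrow> \<phi> x = 0" using assms(1) compact_smooth_def by blast
  have "continuous_on (cball 0 R) (\<lambda>x. \<phi> x * g x)"
    by (intro continuous_on_mult compact_smooth_continuous assms(1) continuous_on_subset[OF assms(2)]) auto
  from borel_integrable_compact[OF compact_cball this]
  show ?thesis
    by (rule Bochner_Integration.integrable_cong[THEN iffD1, rotated 2]) (auto simp: indicator_def R)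
qed

lemma compact_smooth_bounded:
  fixes \<phi> :: "'a::euclidean_space \<Rightarrow> real"
  assumes "compact_smooth \<phi>"
  shows "\<exists>C. \<forall>x. \<bar>\<phi> x\<bar> \<le> C * inverse ((1 + norm x) ^ N)"
proof -
  obtain R where R: "\<And>x. R < norm x \<Longrightarrow> \<phi> x = 0" using assms(1) compact_smooth_def by blast
  let ?g = "\<lambda>x. \<phi> x * (1 + norm x) ^ N"
  have "compact (?g ` cball 0 R)"
    by (intro compact_continuous_image continuous_intros compact_smooth_continuous assms) auto
  from compact_imp_bounded[OF this, unfolded bounded_iff]
  obtain B where "\<forall>z\<in>?g ` cball 0 R. norm z \<le> B" ..
  then have B: "\<bar>?g x\<bar> \<le> B" if "x \<in> cball 0 R" for x using that by simp
  have "\<bar>\<phi> x\<bar> \<le> max B 0 * inverse ((1 + norm x) ^ N)" for x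
  proof -
    have p: "0 < (1 + norm x) ^ N"
      by (intro zero_less_power) (simp add: add_pos_nonneg)
    have "\<bar>?g x\<bar> \<le> max B 0" using B[of x] R[of x] by (cases "norm x \<le> R") auto
    then show ?thesis using p by (simp add: field_simps abs_mult)
  qed
  then show ?thesis by blast
qed

lemma compact_smooth_derivative:
  fixes \<phi> :: "'a::euclidean_space \<Rightarrow> real"
  assumes "compact_smooth \<phi>" "b \<in> Basis"
  shows "compact_smooth (\<lambda>x. frechet_derivative \<phi> (at x) b)"
proof -
  obtain R where R: "\<And>x. R < norm x \<Longrightarrow> \<phi> x = 0" using assms(1) compact_smooth_def by blast
  have "frechet_derivative \<phi> (at x) b = 0" if "R < norm x" for x
  proof -
    have "((\<lambda>x. 0::real) has_derivative (\<lambda>h. 0)) (at x)" by simp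
    then have "(\<phi> has_derivative (\<lambda>h. 0)) (at x)"
      by (rule has_derivative_transform_within_open[where s="- cball 0 R"])
        (use that R in auto)
    then show ?thesis using frechet_derivative_at by metis
  qed
  then show ?thesis using assms smooth_onD(2) unfolding compact_smooth_def by blast
qed

lemma compact_smooth_has_derivative:
  "compact_smooth \<phi> \<Longrightarrow> (\<phi> has_derivative frechet_derivative \<phi> (at x)) (at x)"
  using smooth_onD(1) unfolding compact_smooth_def by blast

text \<open>The phase \<alpha> = 0 gives the real part of \<open>fourier \<phi>\<close>, and
  \<alpha> = pi/2 its imaginary part. Differentiation shifts the phase by pi/2, so both parts are
  treated at once.\<close>

definition trig_transform :: "('a::euclidean_space \<Rightarrow> real) \<Rightarrow> real \<Rightarrow> 'a \<Rightarrow> real" where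
  "trig_transform \<phi> \<alpha> y = (\<integral>\<xi>. \<phi> \<xi> * cos (y \<bullet> \<xi> + \<alpha>) \<partial>lborel)"

lemma trig_transform_integrable:
  "compact_smooth \<phi> \<Longrightarrow> integrable lborel (\<lambda>\<xi>. \<phi> \<xi> * cos (y \<bullet> \<xi> + \<alpha>))"
  by (intro compact_smooth_integrable_mult continuous_intros)

lemma trig_transform_has_derivative:
  fixes \<phi> :: "'a::euclidean_space \<Rightarrow> real"
  assumes "compact_smooth \<phi>"
  shows "(trig_transform \<phi> \<alpha> has_derivative
    (\<lambda>h. \<Sum>b\<in>Basis. (h \<bullet> b) * trig_transform (\<lambda>\<xi>. \<phi> \<xi> * (\<xi> \<bullet> b)) (\<alpha> + pi/2) y)) (at y)"
proof -
  have [measurable]: "\<phi> \<in> borel_measurable borel"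
    using assms by (rule compact_smooth_measurable)
  have "((\<lambda>y. \<integral>\<xi>. \<phi> \<xi> * cos (y \<bullet> \<xi> + \<alpha>) \<partial>lborel) has_derivative
     (\<lambda>h. \<integral>\<xi>. \<phi> \<xi> * (- sin (y \<bullet> \<xi> + \<alpha>) * (h \<bullet> \<xi>)) \<partial>lborel)) (at y)"
  proof (rule has_derivative_integral[where e=1 and w="\<lambda>\<xi>. \<bar>\<phi> \<xi> * norm \<xi>\<bar>"])
    show "integrable lborel (\<lambda>\<xi>. \<phi> \<xi> * cos (y \<bullet> \<xi> + \<alpha>))" for y
      by (rule trig_transform_integrable[OF assms])
    show "((\<lambda>y. \<phi> \<xi> * cos (y \<bullet> \<xi> + \<alpha>)) has_derivative (\<lambda>h. \<phi> \<xi> * (- sin (y \<bullet> \<xi> + \<alpha>) * (h \<bullet> \<xi>)))) (at y)" for y \<xi>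
      by (auto intro!: derivative_eq_intros)
    show "integrable lborel (\<lambda>\<xi>. \<bar>\<phi> \<xi> * norm \<xi>\<bar>)"
      by (intro integrable_abs compact_smooth_integrable_mult assms continuous_intros)
    show "\<bar>\<phi> \<xi> * (- sin (y \<bullet> \<xi> + \<alpha>) * (h \<bullet> \<xi>))\<bar> \<le> \<bar>\<phi> \<xi> * norm \<xi>\<bar> * norm h" for y \<xi> h
    proof -
      have "\<bar>sin (y \<bullet> \<xi> + \<alpha>)\<bar> * \<bar>h \<bullet> \<xi>\<bar> \<le> 1 * (norm h * norm \<xi>)"
        by (intro mult_mono Cauchy_Schwarz_ineq2) auto
      then have "\<bar>\<phi> \<xi>\<bar> * (\<bar>sin (y \<bullet> \<xi> + \<alpha>)\<bar> * \<bar>h \<bullet> \<xi>\<bar>) \<le> \<bar>\<phi> \<xi>\<bar> * (norm h * norm \<xi>)"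
        by (intro mult_left_mono) auto
      then show ?thesis by (simp add: abs_mult mult.assoc mult.commute[of "norm h"])
    qed
    show "(\<lambda>\<xi>. \<phi> \<xi> * (- sin (y \<bullet> \<xi> + \<alpha>) * (h \<bullet> \<xi>))) \<in> borel_measurable lborel" for h
      by measurable
  qed simp
  moreover have "(\<integral>\<xi>. \<phi> \<xi> * (- sin (y \<bullet> \<xi> + \<alpha>) * (h \<bullet> \<xi>)) \<partial>lborel)
     = (\<Sum>b\<in>Basis. (h \<bullet> b) * trig_transform (\<lambda>\<xi>. \<phi> \<xi> * (\<xi> \<bullet> b)) (\<alpha> + pi/2) y)" for h
  proof -
    have "\<phi> \<xi> * (- sin (y \<bullet> \<xi> + \<alpha>) * (h \<bullet> \<xi>)) =
        (\<Sum>b\<in>Basis. (h \<bullet> b) * (\<phi> \<xi> * (\<xi> \<bullet> b) * cos (y \<bullet> \<xi> + (\<alpha> + pi/2))))" for \<xi>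
    proof -
      have "cos (y \<bullet> \<xi> + (\<alpha> + pi/2)) = - sin (y \<bullet> \<xi> + \<alpha>)"
        by (simp add: cos_add sin_add algebra_simps)
      then show ?thesis
        by (subst euclidean_inner[of h \<xi>]) (simp add: sum_distrib_left mult_ac)
    qed
    moreover have "integrable lborel (\<lambda>\<xi>. (h \<bullet> b) * (\<phi> \<xi> * (\<xi> \<bullet> b) * cos (y \<bullet> \<xi> + (\<alpha> + pi/2))))" for b
      unfolding mult.assoc
      by (intro integrable_mult_right compact_smooth_integrable_mult assms continuous_intros)
    ultimately show ?thesis unfolding trig_transform_def by simp
  qed
  ultimately show ?thesis by (simp add: trig_transform_def[abs_def])
qed

lemma trig_transform_continuous: "compact_smooth \<phi> \<Longrightarrow> continuous_on S (trig_transform \<phi> \<alpha>)"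
  by (intro continuous_at_imp_continuous_on ballI has_derivative_continuous[OF trig_transform_has_derivative])

lemma trig_transform_measurable: "compact_smooth \<phi> \<Longrightarrow> trig_transform \<phi> \<alpha> \<in> borel_measurable borel"
  by (intro borel_measurable_continuous_onI trig_transform_continuous)

text \<open>Integration by parts for \<phi>(\<xi>) cos(y \<bullet> \<xi> + \<alpha> + pi/2): the
  derivative of this cosine in the direction b is - (y \<bullet> b) cos(y \<bullet> \<xi> +
  \<alpha>).\<close>

lemma trig_transform_derivative:
  fixes \<phi> :: "'a::euclidean_space \<Rightarrow> real"
  assumes "compact_smooth \<phi>" "b \<in> Basis"
  shows "(y \<bullet> b) * trig_transform \<phi> \<alpha> y = trig_transform (\<lambda>x. frechet_derivative \<phi> (at x) b) (\<alpha> + pi/2) y"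
proof -
  let ?d = "\<lambda>x. frechet_derivative \<phi> (at x) b" and ?\<beta> = "\<alpha> + pi/2"
  have d: "compact_smooth ?d" by (rule compact_smooth_derivative[OF assms])
  have [measurable]: "\<phi> \<in> borel_measurable borel" "?d \<in> borel_measurable borel"
    using assms(1) d by (auto intro: compact_smooth_measurable)
  obtain C1 where C1: "\<And>x. \<bar>\<phi> x\<bar> \<le> C1 * inverse ((1 + norm x) ^ (DIM('a) + 1))"
    using compact_smooth_bounded[OF assms(1)] by blast
  obtain C2 where C2: "\<And>x. \<bar>?d x\<bar> \<le> C2 * inverse ((1 + norm x) ^ (DIM('a) + 1))"
    using compact_smooth_bounded[OF d] by blast
  have "(\<integral>\<xi>. \<phi> \<xi> * (- sin (y \<bullet> \<xi> + ?\<beta>) * (y \<bullet> b)) + ?d \<xi> * cos (y \<bullet> \<xi> + ?\<beta>) \<partial>lborel) = 0"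
  proof (rule integral_directional_derivative_eq_0[where
        u="\<lambda>\<xi>. \<phi> \<xi> * cos (y \<bullet> \<xi> + ?\<beta>)" and C="C1 * \<bar>y \<bullet> b\<bar> + C2" and b=b and
        U="\<lambda>\<xi> h. \<phi> \<xi> * (- sin (y \<bullet> \<xi> + ?\<beta>) * (y \<bullet> h)) + frechet_derivative \<phi> (at \<xi>) h * cos (y \<bullet> \<xi> + ?\<beta>)"])
    show "((\<lambda>\<xi>. \<phi> \<xi> * cos (y \<bullet> \<xi> + ?\<beta>)) has_derivative
        (\<lambda>h. \<phi> \<xi> * (- sin (y \<bullet> \<xi> + ?\<beta>) * (y \<bullet> h)) + frechet_derivative \<phi> (at \<xi>) h * cos (y \<bullet> \<xi> + ?\<beta>))) (at \<xi>)" for \<xi>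
      by (rule has_derivative_mult[OF compact_smooth_has_derivative[OF assms(1)]])
         (auto intro!: derivative_eq_intros)
    show "integrable lborel (\<lambda>\<xi>. \<phi> \<xi> * cos (y \<bullet> \<xi> + ?\<beta>))"
      by (rule trig_transform_integrable[OF assms(1)])
    show "\<bar>\<phi> \<xi> * (- sin (y \<bullet> \<xi> + ?\<beta>) * (y \<bullet> b)) + ?d \<xi> * cos (y \<bullet> \<xi> + ?\<beta>)\<bar>
       \<le> (C1 * \<bar>y \<bullet> b\<bar> + C2) * inverse ((1 + norm \<xi>) ^ (DIM('a) + 1))" for \<xi>
    proof -
      let ?i = "inverse ((1 + norm \<xi>) ^ (DIM('a) + 1))"
      have "\<bar>?d \<xi> * cos (y \<bullet> \<xi> + ?\<beta>)\<bar> \<le> \<bar>?d \<xi>\<bar> * 1"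
        unfolding abs_mult by (intro mult_left_mono) auto
      also have "\<dots> \<le> C2 * ?i" using C2 by simp
      finally have 2: "\<bar>?d \<xi> * cos (y \<bullet> \<xi> + ?\<beta>)\<bar> \<le> C2 * ?i" .
      have "\<bar>\<phi> \<xi> * (- sin (y \<bullet> \<xi> + ?\<beta>) * (y \<bullet> b))\<bar> \<le> \<bar>\<phi> \<xi>\<bar> * (1 * \<bar>y \<bullet> b\<bar>)"
        unfolding abs_mult by (intro mult_left_mono mult_right_mono) auto
      also have "\<dots> \<le> (C1 * ?i) * (1 * \<bar>y \<bullet> b\<bar>)"
        by (intro mult_right_mono C1) auto
      finally show ?thesis using 2 by (simp add: algebra_simps del: power_Suc)
    qed
    show "(\<lambda>\<xi>. \<phi> \<xi> * (- sin (y \<bullet> \<xi> + ?\<beta>) * (y \<bullet> b)) + ?d \<xi> * cos (y \<bullet> \<xi> + ?\<beta>)) \<in> borel_measurable borel"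
      by measurable
  qed
  also have "(\<lambda>\<xi>. \<phi> \<xi> * (- sin (y \<bullet> \<xi> + ?\<beta>) * (y \<bullet> b)) + ?d \<xi> * cos (y \<bullet> \<xi> + ?\<beta>))
     = (\<lambda>\<xi>. ?d \<xi> * cos (y \<bullet> \<xi> + ?\<beta>) - (y \<bullet> b) * (\<phi> \<xi> * cos (y \<bullet> \<xi> + \<alpha>)))"
    by (rule ext) (simp add: sin_add cos_add algebra_simps)
  finally show ?thesis
    using trig_transform_integrable[OF assms(1)] trig_transform_integrable[OF d]
    by (simp add: trig_transform_def)
qed

text \<open>Each integration by parts trades one factor \<open>y \<bullet> b\<close> for a
  derivative of \<phi> and shifts the phase, which is why the bound is uniform in \<alpha>.\<close>

lemma trig_transform_decay_coordinate:
  fixes \<phi> :: "'a::euclidean_space \<Rightarrow> real"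
  assumes "b \<in> Basis"
  shows "compact_smooth \<phi> \<Longrightarrow> \<exists>C\<ge>0. \<forall>\<alpha> y. \<bar>y \<bullet> b\<bar> ^ N * \<bar>trig_transform \<phi> \<alpha> y\<bar> \<le> C"
proof (induction N arbitrary: \<phi>)
  case 0
  have i: "integrable lborel (\<lambda>\<xi>. \<bar>\<phi> \<xi>\<bar>)"
    using compact_smooth_integrable_mult[OF 0, of "\<lambda>_. 1"] by simp
  have "\<bar>trig_transform \<phi> \<alpha> y\<bar> \<le> (\<integral>\<xi>. \<bar>\<phi> \<xi>\<bar> \<partial>lborel)" for \<alpha> y
    unfolding trig_transform_def real_norm_def[symmetric]
    by (rule Bochner_Integration.integral_norm_bound_integral[OF trig_transform_integrable[OF 0] i[folded real_norm_def]])
      (auto simp: abs_mult mult_left_le)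
  then show ?case by (intro exI[of _ "\<integral>\<xi>. \<bar>\<phi> \<xi>\<bar> \<partial>lborel"]) auto
next
  case (Suc N)
  from Suc.IH[OF compact_smooth_derivative[OF Suc.prems assms]]
  obtain C where C: "C \<ge> 0" "\<And>\<alpha> y. \<bar>y \<bullet> b\<bar> ^ N * \<bar>trig_transform (\<lambda>x. frechet_derivative \<phi> (at x) b) \<alpha> y\<bar> \<le> C"
    by blast
  have "\<bar>y \<bullet> b\<bar> ^ Suc N * \<bar>trig_transform \<phi> \<alpha> y\<bar> \<le> C" for \<alpha> y
    using C(2)[of y "\<alpha> + pi/2"]
    by (simp add: trig_transform_derivative[OF Suc.prems assms, symmetric] abs_mult ac_simps)
  then show ?case using C(1) by blast
qed

lemma trig_transform_decay:
  fixes \<phi> :: "'a::euclidean_space \<Rightarrow> real"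
  assumes "compact_smooth \<phi>"
  shows "\<exists>C\<ge>0. \<forall>\<alpha> y. \<bar>trig_transform \<phi> \<alpha> y\<bar> \<le> C * inverse ((1 + norm y) ^ N)"
proof -
  let ?n = "DIM('a)"
  have "\<forall>b\<in>Basis. \<exists>C\<ge>0. \<forall>\<alpha> y. \<bar>y \<bullet> b\<bar> ^ N * \<bar>trig_transform \<phi> \<alpha> y\<bar> \<le> C"
    using trig_transform_decay_coordinate[OF _ assms] by blast
  then obtain C where C: "\<And>b. b \<in> Basis \<Longrightarrow> C b \<ge> 0"
      "\<And>b \<alpha> y. b \<in> Basis \<Longrightarrow> \<bar>y \<bullet> b\<bar> ^ N * \<bar>trig_transform \<phi> \<alpha> y\<bar> \<le> C b"
    unfolding bchoice_iff by metis
  obtain b0 :: 'a where b0: "b0 \<in> Basis" using nonempty_Basis by blast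
  obtain C0 where C0: "C0 \<ge> 0" "\<And>\<alpha> y. \<bar>trig_transform \<phi> \<alpha> y\<bar> \<le> C0"
    using trig_transform_decay_coordinate[OF b0 assms, of 0] by auto
  let ?K = "C0 + sum C Basis"
  have K: "?K \<ge> 0" using C0 C(1) by (simp add: sum_nonneg)
  have "\<bar>trig_transform \<phi> \<alpha> y\<bar> \<le> (1 + ?n) ^ N * ?K * inverse ((1 + norm y) ^ N)" for \<alpha> y
  proof -
    let ?t = "\<bar>trig_transform \<phi> \<alpha> y\<bar>"
    \<comment> \<open>The witness is the larger of 1 and the largest coordinate of y in absolute
      value: it dominates 1 + |y| up to the factor 1 + n, and its N-th power is controlled by
      \<open>C0\<close> or by the bound for a single coordinate.\<close>
    have "\<exists>c::real\<ge>0. 1 + norm y \<le> (1 + ?n) * c \<and> c ^ N * ?t \<le> ?K"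
    proof (cases "\<forall>b\<in>Basis. \<bar>y \<bullet> b\<bar> \<le> 1")
      case True
      have "norm y \<le> (\<Sum>b\<in>Basis. \<bar>y \<bullet> b\<bar>)" by (rule norm_le_l1)
      also have "\<dots> \<le> of_nat ?n * 1" by (rule sum_bounded_above) (use True in auto)
      finally have "1 + norm y \<le> (1 + ?n) * 1" by simp
      moreover have "?t \<le> ?K" using C0(2)[of \<alpha> y] sum_nonneg[of Basis C] C(1) by fastforce
      ultimately show ?thesis by (intro exI[of _ 1]) simp
    next
      case False
      define M where "M = Max ((\<lambda>b. \<bar>y \<bullet> b\<bar>) ` (Basis :: 'a set))"
      have le: "\<bar>y \<bullet> b\<bar> \<le> M" if "b \<in> Basis" for b unfolding M_def using that by auto
      have "M \<in> (\<lambda>b. \<bar>y \<bullet> b\<bar>) ` (Basis :: 'a set)" unfolding M_def by (rule Max_in) auto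
      then obtain b where b: "b \<in> Basis" "M = \<bar>y \<bullet> b\<bar>" by blast
      have M1: "1 \<le> M" using False le by force
      have "norm y \<le> (\<Sum>b\<in>Basis. \<bar>y \<bullet> b\<bar>)" by (rule norm_le_l1)
      also have "\<dots> \<le> of_nat ?n * M" by (rule sum_bounded_above) (use le in auto)
      finally have "1 + norm y \<le> (1 + ?n) * M" using M1 by (simp add: algebra_simps)
      moreover have "M ^ N * ?t \<le> C b" using C(2)[OF b(1)] b(2) by simp
      moreover have "C b \<le> sum C Basis" by (rule member_le_sum) (use b C in auto)
      ultimately show ?thesis using M1 C0(1) by (intro exI[of _ M]) auto
    qed
    then obtain c :: real where c: "c \<ge> 0" "1 + norm y \<le> (1 + ?n) * c" "c ^ N * ?t \<le> ?K" by auto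
    have "(1 + norm y) ^ N * ?t \<le> ((1 + ?n) * c) ^ N * ?t"
      by (intro mult_right_mono power_mono c) auto
    also have "\<dots> \<le> (1 + ?n) ^ N * ?K"
      using mult_left_mono[OF c(3), of "(1 + real ?n) ^ N"] by (simp add: power_mult_distrib mult.assoc)
    finally have "(1 + norm y) ^ N * ?t \<le> (1 + ?n) ^ N * ?K" .
    moreover have "0 < (1 + norm y) ^ N"
      by (intro zero_less_power) (simp add: add_pos_nonneg)
    ultimately show ?thesis by (simp add: field_simps)
  qed
  moreover have "(1 + ?n) ^ N * ?K \<ge> 0" using K by simp
  ultimately show ?thesis by blast
qed

section \<open>Radial moments\<close>

text \<open>Decay by two orders more than s leaves 1/(1+r)^2 at infinity, and s \<ge> 0 keeps the
  integrand bounded at 0.\<close>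

lemma integrable_powr_decay:
  fixes s \<rho> :: real
  assumes s: "s \<ge> 0" and \<rho>: "\<rho> > 0" and N: "real N \<ge> s + 2"
  shows "integrable lborel (\<lambda>r. indicator {0<..} r * r powr s * inverse ((1 + r * \<rho>) ^ N))"
proof -
  \<comment> \<open>Chosen so that m (1 + r) \<le> 1 + r \<rho>, which reduces the estimate to
    \<rho> = 1.\<close>
  define m where "m = min 1 \<rho>"
  have m: "m > 0" "m \<le> 1" "m \<le> \<rho>" using \<rho> by (auto simp: m_def)
  have "integrable lborel (\<lambda>r::real. inverse ((1 + norm r) ^ (DIM(real) + 1)))"
    by (rule integrable_inverse_power_norm)
  then have I: "integrable lborel (\<lambda>r::real. inverse (m ^ N) * inverse ((1 + \<bar>r\<bar>)\<^sup>2))"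
    by (simp add: numeral_2_eq_2)
  show ?thesis
  proof (rule Bochner_Integration.integrable_bound[OF I])
    have "norm (indicator {0<..} r * r powr s * inverse ((1 + r * \<rho>) ^ N))
      \<le> norm (inverse (m ^ N) * inverse ((1 + \<bar>r\<bar>)\<^sup>2))" for r :: real
    proof (cases "r > 0")
      case True
      have "m * (1 + r) \<le> 1 + r * \<rho>"
      proof -
        have "m * r \<le> \<rho> * r" using m(3) True by (intro mult_right_mono) auto
        then show ?thesis using m(2) by (simp add: distrib_left mult.commute)
      qed
      then have "(m * (1 + r)) ^ N \<le> (1 + r * \<rho>) ^ N"
        using m True by (intro power_mono) auto
      then have "inverse ((1 + r * \<rho>) ^ N) \<le> inverse ((m * (1 + r)) ^ N)"
        using m True by (intro le_imp_inverse_le) auto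
      moreover have "r powr s \<le> (1 + r) powr s" using True s by (intro powr_mono2) auto
      ultimately have "r powr s * inverse ((1 + r * \<rho>) ^ N) \<le> (1 + r) powr s * inverse ((m * (1 + r)) ^ N)"
        using True \<rho> by (intro mult_mono) auto
      also have "\<dots> = inverse (m ^ N) * ((1 + r) powr (s - real N))"
      proof -
        have "(1 + r) powr (s - real N) = (1 + r) powr s * inverse ((1 + r) ^ N)"
          using True by (simp add: powr_diff powr_realpow divide_inverse)
        then show ?thesis by (simp only: power_mult_distrib inverse_mult_distrib mult_ac)
      qed
      also have "\<dots> \<le> inverse (m ^ N) * ((1 + r) powr (-2))"
        using True m N by (intro mult_left_mono powr_mono) auto
      also have "(1 + r) powr (-2) = inverse ((1 + r)\<^sup>2)"
        using True by (simp add: powr_minus)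
      finally show ?thesis using True \<rho> m by (simp add: abs_mult)
    qed auto
    then show "AE r in lborel. norm (indicator {0<..} r * r powr s * inverse ((1 + r * \<rho>) ^ N))
      \<le> norm (inverse (m ^ N) * inverse ((1 + \<bar>r\<bar>)\<^sup>2))" by (intro AE_I2)
  qed simp
qed

text \<open>The radial integral of polar coordinates, taken on the whole punctured space rather than
  on the sphere so that it can be differentiated in every direction.\<close>

definition radial_moment :: "real \<Rightarrow> ('a::euclidean_space \<Rightarrow> real) \<Rightarrow> real \<Rightarrow> 'a \<Rightarrow> real" where
  "radial_moment s \<phi> \<alpha> x = (\<integral>r. indicator {0<..} r * r powr s * trig_transform \<phi> \<alpha> (r *\<^sub>R x) \<partial>lborel)"

text \<open>The majorant is the same for all x with |x| \<ge> \<rho>, as differentiation under the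
  integral near a nonzero point requires.\<close>

lemma radial_moment_bound:
  fixes \<phi> :: "'a::euclidean_space \<Rightarrow> real"
  assumes \<phi>: "compact_smooth \<phi>" and "s \<ge> 0" "\<rho> > 0"
  shows "\<exists>w. integrable lborel w \<and> (\<forall>r. w r \<ge> 0) \<and> (\<forall>\<alpha> x r. \<rho> \<le> norm x \<longrightarrow>
     \<bar>indicator {0<..} r * r powr s * trig_transform \<phi> \<alpha> (r *\<^sub>R x)\<bar> \<le> w r)"
proof -
  obtain N :: nat where N: "real N \<ge> s + 2" using real_arch_simple by blast
  obtain C where C: "C \<ge> 0" "\<And>\<alpha> y. \<bar>trig_transform \<phi> \<alpha> y\<bar> \<le> C * inverse ((1 + norm y) ^ N)"
    using trig_transform_decay[OF \<phi>, of N] by blast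
  let ?w = "\<lambda>r. C * (indicator {0<..} r * r powr s * inverse ((1 + r * \<rho>) ^ N))"
  have "integrable lborel ?w"
    by (intro integrable_mult_right integrable_powr_decay assms N)
  moreover have "?w r \<ge> 0" for r using C(1) \<open>\<rho> > 0\<close> by (auto simp: indicator_def)
  moreover have "\<bar>indicator {0<..} r * r powr s * trig_transform \<phi> \<alpha> (r *\<^sub>R x)\<bar> \<le> ?w r"
    if "\<rho> \<le> norm x" for \<alpha> x r
  proof (cases "r > 0")
    case True
    have "inverse ((1 + norm (r *\<^sub>R x)) ^ N) \<le> inverse ((1 + r * \<rho>) ^ N)"
    proof (intro le_imp_inverse_le power_mono zero_less_power)
      show "1 + r * \<rho> \<le> 1 + norm (r *\<^sub>R x)" using mult_left_mono[OF that, of r] True by simp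
      show "0 < 1 + r * \<rho>" "0 \<le> 1 + r * \<rho>" using True \<open>\<rho> > 0\<close> by (simp_all add: add_pos_pos)
    qed
    then have "\<bar>trig_transform \<phi> \<alpha> (r *\<^sub>R x)\<bar> \<le> C * inverse ((1 + r * \<rho>) ^ N)"
      using C by (meson mult_left_mono order_trans)
    then have "r powr s * \<bar>trig_transform \<phi> \<alpha> (r *\<^sub>R x)\<bar> \<le> r powr s * (C * inverse ((1 + r * \<rho>) ^ N))"
      by (intro mult_left_mono) auto
    then show ?thesis using True by (simp add: abs_mult mult_ac)
  qed auto
  ultimately show ?thesis by blast
qed

lemma radial_moment_measurable:
  assumes "compact_smooth \<phi>"
  shows "(\<lambda>r. indicator {0<..} r * r powr s * trig_transform \<phi> \<alpha> (r *\<^sub>R x)) \<in> borel_measurable borel"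
proof -
  note [measurable] = trig_transform_measurable[OF assms]
  show ?thesis by measurable
qed

lemma radial_moment_integrable:
  assumes "compact_smooth \<phi>" "s \<ge> 0" "x \<noteq> 0"
  shows "integrable lborel (\<lambda>r. indicator {0<..} r * r powr s * trig_transform \<phi> \<alpha> (r *\<^sub>R x))"
proof -
  obtain w where w: "integrable lborel w" "\<And>r. w r \<ge> 0"
     "\<And>\<alpha> y r. norm x \<le> norm y \<Longrightarrow> \<bar>indicator {0<..} r * r powr s * trig_transform \<phi> \<alpha> (r *\<^sub>R y)\<bar> \<le> w r"
    using radial_moment_bound[OF assms(1,2), of "norm x"] assms(3) by auto
  show ?thesis
    by (rule Bochner_Integration.integrable_bound[OF w(1)])
      (use radial_moment_measurable[OF assms(1)] w in auto)
qed

lemma radial_moment_has_derivative: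
  fixes \<phi> :: "'a::euclidean_space \<Rightarrow> real"
  assumes \<phi>: "compact_smooth \<phi>" and s: "s \<ge> 0" and x: "x \<noteq> 0"
  shows "(radial_moment s \<phi> \<alpha> has_derivative
    (\<lambda>h. \<Sum>b\<in>Basis. (h \<bullet> b) * radial_moment (s + 1) (\<lambda>\<xi>. \<phi> \<xi> * (\<xi> \<bullet> b)) (\<alpha> + pi/2) x)) (at x)"
proof -
  \<comment> \<open>Points within |x|/2 of x have norm at least |x|/2, so one majorant serves the
    whole ball.\<close>
  define \<rho> where "\<rho> = norm x / 2"
  have \<rho>: "\<rho> > 0" using x by (simp add: \<rho>_def)
  have ball: "\<rho> \<le> norm y" if "y \<in> ball x \<rho>" for y
    using that norm_triangle_ineq2[of x y] by (simp add: \<rho>_def dist_norm)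
  have \<phi>b: "compact_smooth (\<lambda>\<xi>. \<phi> \<xi> * (\<xi> \<bullet> b))" for b
    by (intro compact_smooth_mult \<phi> Ck_inner) simp
  define g where "g b y r = indicator {0<..} r * r powr (s + 1) *
      trig_transform (\<lambda>\<xi>. \<phi> \<xi> * (\<xi> \<bullet> b)) (\<alpha> + pi/2) (r *\<^sub>R y)" for b y :: 'a and r
  have "\<exists>w. integrable lborel w \<and> (\<forall>r. w r \<ge> 0) \<and> (\<forall>y r. \<rho> \<le> norm y \<longrightarrow> \<bar>g b y r\<bar> \<le> w r)" for b
  proof -
    have "0 \<le> s + 1" using s by simp
    from radial_moment_bound[OF \<phi>b this \<rho>, of b] show ?thesis unfolding g_def by (elim exE) blast
  qed
  then obtain w where w: "\<And>b. integrable lborel (w b)" "\<And>b r. w b r \<ge> 0"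
      "\<And>b y r. \<rho> \<le> norm y \<Longrightarrow> \<bar>g b y r\<bar> \<le> w b r"
    by metis
  have "((\<lambda>x. \<integral>r. indicator {0<..} r * r powr s * trig_transform \<phi> \<alpha> (r *\<^sub>R x) \<partial>lborel) has_derivative
    (\<lambda>h. \<integral>r. (\<Sum>b\<in>Basis. (h \<bullet> b) * g b x r) \<partial>lborel)) (at x)"
  proof (rule has_derivative_integral[where e=\<rho> and w="\<lambda>r. \<Sum>b\<in>Basis. w b r", OF \<rho>])
    show "integrable lborel (\<lambda>r. indicator {0<..} r * r powr s * trig_transform \<phi> \<alpha> (r *\<^sub>R y))"
      if "y \<in> ball x \<rho>" for y
      using ball[OF that] \<rho> by (intro radial_moment_integrable \<phi> s) auto
    show "((\<lambda>y. indicator {0<..} r * r powr s * trig_transform \<phi> \<alpha> (r *\<^sub>R y)) has_derivative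
        (\<lambda>h. \<Sum>b\<in>Basis. (h \<bullet> b) * g b y r)) (at y)" for y r
    proof (cases "r > 0")
      case True
      have "((\<lambda>y. r *\<^sub>R y) has_derivative (\<lambda>h. r *\<^sub>R h)) (at y)"
        by (auto intro!: derivative_eq_intros)
      from has_derivative_compose[OF this trig_transform_has_derivative[OF \<phi>, of \<alpha>]]
      have "((\<lambda>y. r powr s * trig_transform \<phi> \<alpha> (r *\<^sub>R y)) has_derivative
        (\<lambda>h. r powr s * (\<Sum>b\<in>Basis. (r *\<^sub>R h \<bullet> b) * trig_transform (\<lambda>\<xi>. \<phi> \<xi> * (\<xi> \<bullet> b)) (\<alpha> + pi/2) (r *\<^sub>R y)))) (at y)"
        by (rule has_derivative_mult_right)
      then show ?thesis using True
        by (simp add: g_def sum_distrib_left powr_add mult_ac)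
    qed (simp add: g_def)
    show "\<bar>\<Sum>b\<in>Basis. (h \<bullet> b) * g b y r\<bar> \<le> (\<Sum>b\<in>Basis. w b r) * norm h" if "y \<in> ball x \<rho>" for y r h
    proof -
      have "\<bar>\<Sum>b\<in>Basis. (h \<bullet> b) * g b y r\<bar> \<le> (\<Sum>b\<in>Basis. \<bar>(h \<bullet> b) * g b y r\<bar>)" by (rule sum_abs)
      also have "\<dots> \<le> (\<Sum>b\<in>Basis. norm h * w b r)"
        unfolding abs_mult
        by (intro sum_mono mult_mono w(3) ball[OF that] Basis_le_norm) auto
      finally show ?thesis by (simp add: sum_distrib_left mult.commute)
    qed
    show "integrable lborel (\<lambda>r. \<Sum>b\<in>Basis. w b r)" using w(1) by auto
    show "(\<lambda>r. \<Sum>b\<in>Basis. (h \<bullet> b) * g b x r) \<in> borel_measurable lborel" for h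
    proof -
      have [measurable]: "g b x \<in> borel_measurable borel" for b
        unfolding g_def by (rule radial_moment_measurable[OF \<phi>b])
      show ?thesis by measurable
    qed
  qed
  moreover have "(\<integral>r. (\<Sum>b\<in>Basis. (h \<bullet> b) * g b x r) \<partial>lborel) =
      (\<Sum>b\<in>Basis. (h \<bullet> b) * radial_moment (s + 1) (\<lambda>\<xi>. \<phi> \<xi> * (\<xi> \<bullet> b)) (\<alpha> + pi/2) x)" for h
  proof -
    have "integrable lborel (g b x)" for b
      unfolding g_def by (intro radial_moment_integrable \<phi>b x) (use s in auto)
    moreover have "radial_moment (s + 1) (\<lambda>\<xi>. \<phi> \<xi> * (\<xi> \<bullet> b)) (\<alpha> + pi/2) x = (\<integral>r. g b x r \<partial>lborel)" for b
      unfolding radial_moment_def g_def ..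
    ultimately show ?thesis by simp
  qed
  ultimately show ?thesis by (simp only: radial_moment_def[abs_def])
qed

text \<open>A derivative raises s by 1, shifts the phase and multiplies \<phi> by a coordinate,
  hence the induction over all \<phi>, s and \<alpha> at once.\<close>

lemma Ck_radial_moment: "compact_smooth \<phi> \<Longrightarrow> s \<ge> 0 \<Longrightarrow> Ck k (-{0}) (radial_moment s \<phi> \<alpha>)"
proof (induction k arbitrary: \<phi> s \<alpha>)
  case (Suc k)
  have Cb: "Ck k (-{0}) (radial_moment (s + 1) (\<lambda>\<xi>. \<phi> \<xi> * (\<xi> \<bullet> b)) (\<alpha> + pi/2))" for b
    by (intro Suc.IH compact_smooth_mult Suc.prems Ck_inner) (use Suc.prems in auto)
  show ?case
  proof (rule Ck_SucI[OF _ radial_moment_has_derivative[OF Suc.prems]])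
    show "Ck k (-{0}) (\<lambda>x. \<Sum>b\<in>Basis. (c \<bullet> b) * radial_moment (s + 1) (\<lambda>\<xi>. \<phi> \<xi> * (\<xi> \<bullet> b)) (\<alpha> + pi/2) x)" for c
      by (intro Ck_sum Ck_mult Ck_const Cb) auto
  qed auto
qed simp

text \<open>Homogeneity of degree -(s+1), by rescaling r with |x|. It exhibits the 0-homogeneous
  extension required by \<open>Ce_inf\<close> as a product of smooth functions.\<close>

lemma radial_moment_normalize:
  assumes "x \<noteq> 0"
  shows "radial_moment s \<phi> \<alpha> (x /\<^sub>R norm x) = norm x powr (s + 1) * radial_moment s \<phi> \<alpha> x"
proof -
  have "radial_moment s \<phi> \<alpha> (x /\<^sub>R norm x) = norm x * (\<integral>r. indicator {0<..} (norm x * r) * (norm x * r) powr s *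
      trig_transform \<phi> \<alpha> ((norm x * r) *\<^sub>R (x /\<^sub>R norm x)) \<partial>lborel)"
    unfolding radial_moment_def
    using assms by (subst lborel_integral_real_affine[where c="norm x" and t=0]) auto
  also have "(\<lambda>r. indicator {0<..} (norm x * r) * (norm x * r) powr s *
      trig_transform \<phi> \<alpha> ((norm x * r) *\<^sub>R (x /\<^sub>R norm x)))
     = (\<lambda>r. norm x powr s * (indicator {0<..} r * r powr s * trig_transform \<phi> \<alpha> (r *\<^sub>R x)))"
  proof
    fix r
    show "indicator {0<..} (norm x * r) * (norm x * r) powr s *
        trig_transform \<phi> \<alpha> ((norm x * r) *\<^sub>R (x /\<^sub>R norm x))
       = norm x powr s * (indicator {0<..} r * r powr s * trig_transform \<phi> \<alpha> (r *\<^sub>R x))"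
    proof (cases "r > 0")
      case True
      then have "indicator {0<..} (norm x * r) = (1::real)" "indicator {0<..} r = (1::real)"
        "(norm x * r) *\<^sub>R (x /\<^sub>R norm x) = r *\<^sub>R x"
        using assms by (auto simp: indicator_def)
      moreover have "(norm x * r) powr s = norm x powr s * r powr s"
        by (rule powr_mult)
      ultimately show ?thesis by (simp only: mult_1_left mult.assoc)
    next
      case False
      then have "indicator {0<..} (norm x * r) = (0::real)" "indicator {0<..} r = (0::real)"
        by (auto simp: indicator_def zero_less_mult_iff)
      then show ?thesis by (simp only: mult_zero_left mult_zero_right)
    qed
  qed
  finally show ?thesis
    using assms by (simp add: radial_moment_def powr_add)
qed

lemma radial_moment_in_Ce_inf:
  assumes "compact_smooth \<phi>" "s \<ge> 0"
  shows "(\<lambda>x. c * radial_moment s \<phi> 0 x) \<in> Ce_inf"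
proof -
  have "Ck k (-{0}) (\<lambda>x. c * radial_moment s \<phi> 0 (x /\<^sub>R norm x))" for k
  proof (rule Ck_cong_open)
    show "Ck k (-{0}) (\<lambda>x. c * (norm x powr (s + 1) * radial_moment s \<phi> 0 x))"
      by (intro Ck_mult Ck_const Ck_norm_powr Ck_radial_moment assms) auto
  qed (auto simp: radial_moment_normalize)
  moreover have "radial_moment s \<phi> 0 (- x) = radial_moment s \<phi> 0 x" for x
    by (simp add: radial_moment_def trig_transform_def)
  ultimately show ?thesis by (simp add: Ce_inf_def smooth_on_iff_Ck)
qed

section \<open>Fourier inversion\<close>

lemma integral_pos_open:
  fixes f :: "'a::euclidean_space \<Rightarrow> real"
  assumes int: "integrable lborel f" and nn: "\<And>x. 0 \<le> f x" and U: "open U" "U \<noteq> {}" "\<And>x. x \<in> U \<Longrightarrow> 0 < f x"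
  shows "0 < (\<integral>x. f x \<partial>lborel)"
proof -
  have "(\<integral>x. f x \<partial>lborel) \<noteq> 0"
  proof
    assume "(\<integral>x. f x \<partial>lborel) = 0"
    then have "AE x in lborel. f x = 0"
      using integral_nonneg_eq_0_iff_AE[OF int] nn by simp
    then have "AE x in lborel. x \<notin> U"
      by eventually_elim (use U(3) in force)
    then have "U \<in> null_sets lborel"
      using U(1) by (subst (asm) AE_iff_null_sets[symmetric]) auto
    then have "negligible U"
      by (simp add: negligible_iff_null_sets null_sets_completionI)
    then show False using open_not_negligible[OF U(1,2)] by simp
  qed
  moreover have "0 \<le> (\<integral>x. f x \<partial>lborel)" by (simp add: nn)
  ultimately show ?thesis by simp
qed

lemma integrable_bounded_decay:
  fixes f :: "'a::euclidean_space \<Rightarrow> real"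
  assumes "f \<in> borel_measurable borel"
    and "\<And>x. \<bar>f x\<bar> \<le> C * inverse ((1 + norm x) ^ (DIM('a) + 1))"
  shows "integrable lborel f"
proof (rule Bochner_Integration.integrable_bound)
  show "integrable lborel (\<lambda>x::'a. C * inverse ((1 + norm x) ^ (DIM('a) + 1)))"
    by (intro integrable_mult_right integrable_inverse_power_norm)
  show "AE x in lborel. norm (f x) \<le> norm (C * inverse ((1 + norm x) ^ (DIM('a) + 1)))"
  proof (rule AE_I2)
    fix x
    show "norm (f x) \<le> norm (C * inverse ((1 + norm x) ^ (DIM('a) + 1)))"
      using assms(2)[of x] abs_ge_self[of "C * inverse ((1 + norm x) ^ (DIM('a) + 1))"]
      unfolding real_norm_def by linarith
  qed
qed (use assms(1) in simp)

lemma integral_lborel_affine: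
  fixes f :: "'a::euclidean_space \<Rightarrow> real"
  assumes [measurable]: "f \<in> borel_measurable borel" and "c > 0"
  shows "(\<integral>x. f x \<partial>lborel) = c ^ DIM('a) * (\<integral>x. f (t + c *\<^sub>R x) \<partial>lborel)"
  by (subst lborel_affine[where c=c and t=t])
    (use assms(2) in \<open>simp_all add: integral_density integral_distr\<close>)

lemma integrable_lborel_scale:
  fixes f :: "'a::euclidean_space \<Rightarrow> real"
  assumes "integrable lborel f" and "c > 0"
  shows "integrable lborel (\<lambda>x. f (c *\<^sub>R x))"
proof -
  have [measurable]: "f \<in> borel_measurable borel" using assms(1) by auto
  have "integrable (density (distr lborel borel (\<lambda>x. 0 + c *\<^sub>R x)) (\<lambda>_. \<bar>c\<bar>^DIM('a))) f"
    using assms lborel_affine[of c "0::'a"] by simp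
  then show ?thesis using assms(2) by (simp add: integrable_density integrable_distr_eq)
qed

lemma integrable_lborel_product:
  fixes f :: "'a::euclidean_space \<Rightarrow> real" and g :: "'b::euclidean_space \<Rightarrow> real"
  assumes f: "integrable lborel f" and g: "integrable lborel g"
  shows "integrable (lborel \<Otimes>\<^sub>M lborel) (\<lambda>(x, y). f x * g y)"
proof (rule lborel_pair.Fubini_integrable)
  have [measurable]: "f \<in> borel_measurable borel" "g \<in> borel_measurable borel" using f g by auto
  show "(\<lambda>(x, y). f x * g y) \<in> borel_measurable (lborel \<Otimes>\<^sub>M lborel)" by measurable
  show "integrable lborel (\<lambda>x. \<integral>y. norm (case (x, y) of (x, y) \<Rightarrow> f x * g y) \<partial>lborel)"
    using f by (simp add: abs_mult)
  show "AE x in lborel. integrable lborel (\<lambda>y. case (x, y) of (x, y) \<Rightarrow> f x * g y)"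
    using g by simp
qed

section \<open>The Gaussian and its Fourier transform\<close>

definition gauss :: "'a::euclidean_space \<Rightarrow> real" where
  "gauss x = exp (- (x \<bullet> x) / 2)"

lemma gauss_pos: "0 < gauss x" and gauss_le_1: "gauss x \<le> 1"
  by (simp_all add: gauss_def)

lemma gauss_continuous: "continuous_on S gauss"
  unfolding gauss_def by (intro continuous_intros) auto

lemma gauss_measurable [measurable]: "gauss \<in> borel_measurable borel"
  by (intro borel_measurable_continuous_onI gauss_continuous)

lemma gauss_has_derivative: "(gauss has_derivative (\<lambda>h. - (x \<bullet> h) * gauss x)) (at x)"
  unfolding gauss_def by (auto intro!: derivative_eq_intros simp: inner_commute fun_eq_iff)

text \<open>With t = |x|: (1+t)^M \<le> exp(M t) and, by completing the square, M t - t^2/2 \<le>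
  M^2/2.\<close>

lemma gauss_decay: "gauss x \<le> exp ((real M)\<^sup>2 / 2) * inverse ((1 + norm x) ^ M)"
proof -
  let ?t = "norm x"
  have "(1 + ?t) ^ M \<le> exp ?t ^ M" by (intro power_mono exp_ge_add_one_self) auto
  also have "\<dots> = exp (real M * ?t)" by (simp add: exp_of_nat_mult)
  finally have "gauss x * (1 + ?t) ^ M \<le> gauss x * exp (real M * ?t)"
    by (intro mult_left_mono) (auto simp: gauss_def)
  also have "\<dots> = exp (real M * ?t - ?t\<^sup>2 / 2)"
    by (simp add: gauss_def power2_norm_eq_inner flip: exp_add)
  also have "\<dots> \<le> exp ((real M)\<^sup>2 / 2)"
    using zero_le_power2[of "real M - ?t"] by (simp add: power2_diff)
  finally have "gauss x * (1 + ?t) ^ M \<le> exp ((real M)\<^sup>2 / 2)" .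
  moreover have "0 < (1 + ?t) ^ M"
    by (intro zero_less_power) (simp add: add_pos_nonneg)
  ultimately show ?thesis by (simp add: field_simps)
qed

lemma gauss_norm_decay:
  "(1 + norm x) * gauss x \<le> exp ((real (Suc M))\<^sup>2 / 2) * inverse ((1 + norm x) ^ M)"
proof -
  have "(1 + norm x) * gauss x \<le> (1 + norm x) * (exp ((real (Suc M))\<^sup>2 / 2) * inverse ((1 + norm x) ^ Suc M))"
    by (intro mult_left_mono gauss_decay) simp
  also have "\<dots> = ((1 + norm x) * inverse (1 + norm x)) * (exp ((real (Suc M))\<^sup>2 / 2) * inverse ((1 + norm x) ^ M))"
    by (simp only: power_Suc inverse_mult_distrib mult_ac)
  also have "(1 + norm x) * inverse (1 + norm x) = 1"
    by (rule right_inverse) (use norm_ge_zero[of x] in linarith)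
  finally show ?thesis by simp
qed

lemma gauss_integrable: "integrable lborel gauss"
  by (rule integrable_bounded_decay[OF gauss_measurable], unfold abs_of_pos[OF gauss_pos], rule gauss_decay)

text \<open>The number (2 pi)^(n/2), left as an integral; it is attached to the type because it
  depends only on the dimension.\<close>

definition gauss_mass :: "'a::euclidean_space itself \<Rightarrow> real" where
  "gauss_mass _ = (\<integral>x. gauss (x::'a) \<partial>lborel)"

lemma gauss_mass_pos: "0 < gauss_mass TYPE('a::euclidean_space)"
  unfolding gauss_mass_def
  by (rule integral_pos_open[OF gauss_integrable less_imp_le[OF gauss_pos] open_UNIV UNIV_not_empty gauss_pos])

text \<open>Let \<open>H t\<close> be the value at t z. Integration by parts gives H' = - t (z
  \<bullet> z) H, so H(t) exp(t^2 (z \<bullet> z) / 2) is constant; compare t = 0 with t =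
  1.\<close>

lemma gauss_fourier:
  fixes z :: "'a::euclidean_space"
  shows "(\<integral>x. gauss x * cos (x \<bullet> z) \<partial>lborel) = gauss_mass TYPE('a) * gauss z"
proof -
  define H where "H t = (\<integral>x. gauss x * cos (t * (x \<bullet> z)) \<partial>lborel)" for t
  define K where "K = exp ((real (Suc (DIM('a) + 1)))\<^sup>2 / 2)"
  have bnd: "norm x * gauss x \<le> K * inverse ((1 + norm x) ^ (DIM('a) + 1))" for x :: 'a
    using gauss_norm_decay[of x "DIM('a) + 1"] gauss_pos[of x] unfolding K_def distrib_right mult_1_left by linarith
  have bnd0: "gauss x \<le> K * inverse ((1 + norm x) ^ (DIM('a) + 1))" for x :: 'a
  proof -
    have "0 \<le> norm x * gauss x" using gauss_pos[of x] by simp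
    then show ?thesis
      using gauss_norm_decay[of x "DIM('a) + 1"] unfolding K_def distrib_right mult_1_left by linarith
  qed
  have ci: "integrable lborel (\<lambda>x. gauss x * cos (t * (x \<bullet> z)))" for t
    by (rule Bochner_Integration.integrable_bound[OF gauss_integrable])
      (auto simp: abs_mult mult_left_le)
  have si: "integrable lborel (\<lambda>x. gauss x * sin (t * (x \<bullet> z)))" for t
    by (rule Bochner_Integration.integrable_bound[OF gauss_integrable])
      (auto simp: abs_mult mult_left_le)
  have zb: "\<bar>gauss x * (s * (x \<bullet> z))\<bar> \<le> norm z * K * inverse ((1 + norm x) ^ (DIM('a) + 1))" if "\<bar>s\<bar> \<le> 1" for x s
  proof -
    have "\<bar>s\<bar> * \<bar>x \<bullet> z\<bar> \<le> 1 * (norm x * norm z)"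
      using that by (intro mult_mono Cauchy_Schwarz_ineq2) auto
    then have "gauss x * (\<bar>s\<bar> * \<bar>x \<bullet> z\<bar>) \<le> gauss x * (1 * (norm x * norm z))"
      using gauss_pos[of x] by (intro mult_left_mono) auto
    also have "\<dots> = norm z * (norm x * gauss x)" by simp
    also have "\<dots> \<le> norm z * (K * inverse ((1 + norm x) ^ (DIM('a) + 1)))"
      by (intro mult_left_mono bnd) auto
    finally show ?thesis using gauss_pos[of x] by (simp only: abs_mult abs_of_pos mult.assoc)
  qed
  have szi: "integrable lborel (\<lambda>x. gauss x * (- sin (t * (x \<bullet> z)) * (x \<bullet> z)))" for t
    by (rule integrable_bounded_decay[OF _ zb]) auto
  have Hd: "(H has_real_derivative (\<integral>x. gauss x * (- sin (t * (x \<bullet> z)) * (x \<bullet> z)) \<partial>lborel)) (at t)" for t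
  proof -
    have "((\<lambda>t. \<integral>x. gauss x * cos (t * (x \<bullet> z)) \<partial>lborel) has_derivative
      (\<lambda>h. \<integral>x. h * (gauss x * (- sin (t * (x \<bullet> z)) * (x \<bullet> z))) \<partial>lborel)) (at t)"
    proof (rule has_derivative_integral[where e=1 and
        w="\<lambda>x. norm z * K * inverse ((1 + norm x) ^ (DIM('a) + 1))"])
      show "((\<lambda>t. gauss x * cos (t * (x \<bullet> z))) has_derivative (\<lambda>h. h * (gauss x * (- sin (t * (x \<bullet> z)) * (x \<bullet> z))))) (at t)" for x t
        by (auto intro!: derivative_eq_intros)
      show "\<bar>h * (gauss x * (- sin (t * (x \<bullet> z)) * (x \<bullet> z)))\<bar>
         \<le> norm z * K * inverse ((1 + norm x) ^ (DIM('a) + 1)) * norm h" for x t h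
      proof -
        have "\<bar>- sin (t * (x \<bullet> z))\<bar> \<le> 1" by simp
        from mult_right_mono[OF zb[OF this], of "\<bar>h\<bar>"] show ?thesis
          by (simp add: abs_mult mult.commute[of "\<bar>h\<bar>"])
      qed
      show "integrable lborel (\<lambda>x::'a. norm z * K * inverse ((1 + norm x) ^ (DIM('a) + 1)))"
        by (intro integrable_mult_right integrable_inverse_power_norm)
    qed (use ci in auto)
    then show ?thesis
      unfolding H_def[abs_def] by (rule has_derivative_imp_has_field_derivative) simp
  qed
  have ode: "(\<integral>x. gauss x * (- sin (t * (x \<bullet> z)) * (x \<bullet> z)) \<partial>lborel) = - t * (z \<bullet> z) * H t" for t
  proof -
    \<comment> \<open>The derivative in the direction z of gauss(x) sin(t (x \<bullet> z))
      integrates to zero.\<close>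
    have "(\<integral>x. gauss x * (cos (t * (x \<bullet> z)) * (t * (z \<bullet> z))) + (- (x \<bullet> z) * gauss x) * sin (t * (x \<bullet> z)) \<partial>lborel) = 0"
    proof (rule integral_directional_derivative_eq_0[where b=z and
        u="\<lambda>x. gauss x * sin (t * (x \<bullet> z))" and C="K * \<bar>t * (z \<bullet> z)\<bar> + norm z * K" and
        U="\<lambda>x h. gauss x * (cos (t * (x \<bullet> z)) * (t * (h \<bullet> z))) + (- (x \<bullet> h) * gauss x) * sin (t * (x \<bullet> z))"])
      show "((\<lambda>x. gauss x * sin (t * (x \<bullet> z))) has_derivative
        (\<lambda>h. gauss x * (cos (t * (x \<bullet> z)) * (t * (h \<bullet> z))) + (- (x \<bullet> h) * gauss x) * sin (t * (x \<bullet> z)))) (at x)" for x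
        by (rule has_derivative_mult[OF gauss_has_derivative]) (auto intro!: derivative_eq_intros)
      show "\<bar>gauss x * (cos (t * (x \<bullet> z)) * (t * (z \<bullet> z))) + (- (x \<bullet> z) * gauss x) * sin (t * (x \<bullet> z))\<bar>
        \<le> (K * \<bar>t * (z \<bullet> z)\<bar> + norm z * K) * inverse ((1 + norm x) ^ (DIM('a) + 1))" for x
      proof -
        let ?i = "inverse ((1 + norm x) ^ (DIM('a) + 1))"
        have "\<bar>gauss x * (cos (t * (x \<bullet> z)) * (t * (z \<bullet> z)))\<bar> \<le> gauss x * (1 * \<bar>t * (z \<bullet> z)\<bar>)"
          using gauss_pos[of x] unfolding abs_mult by (intro mult_mono) auto
        also have "\<dots> \<le> (K * ?i) * (1 * \<bar>t * (z \<bullet> z)\<bar>)"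
          by (intro mult_right_mono bnd0) auto
        finally have 1: "\<bar>gauss x * (cos (t * (x \<bullet> z)) * (t * (z \<bullet> z)))\<bar> \<le> (K * ?i) * (1 * \<bar>t * (z \<bullet> z)\<bar>)" .
        have "\<bar>- sin (t * (x \<bullet> z))\<bar> \<le> 1" by simp
        from zb[OF this, of x]
        have 2: "\<bar>(- (x \<bullet> z) * gauss x) * sin (t * (x \<bullet> z))\<bar> \<le> norm z * K * ?i"
          by (simp add: mult_ac)
        have e: "(K * \<bar>t * (z \<bullet> z)\<bar> + norm z * K) * i = (K * i) * (1 * \<bar>t * (z \<bullet> z)\<bar>) + norm z * K * i" for i
          by (simp add: algebra_simps)
        show ?thesis unfolding e by (rule order_trans[OF abs_triangle_ineq add_mono[OF 1 2]])
      qed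
    qed (use si in auto)
    also have "(\<lambda>x. gauss x * (cos (t * (x \<bullet> z)) * (t * (z \<bullet> z))) + (- (x \<bullet> z) * gauss x) * sin (t * (x \<bullet> z)))
      = (\<lambda>x. (t * (z \<bullet> z)) * (gauss x * cos (t * (x \<bullet> z))) + gauss x * (- sin (t * (x \<bullet> z)) * (x \<bullet> z)))"
      by (rule ext) (simp add: mult_ac)
    finally show ?thesis
      using szi[of t] ci[of t] by (simp add: H_def del: mult_minus_left mult_minus_right)
  qed
  have "H 1 * exp (1\<^sup>2 * (z \<bullet> z) / 2) = H 0 * exp (0\<^sup>2 * (z \<bullet> z) / 2)"
  proof -
    have d: "((\<lambda>t. H t * exp (t\<^sup>2 * (z \<bullet> z) / 2)) has_real_derivative 0) (at t)" for t
      using Hd[of t] unfolding ode by (auto intro!: derivative_eq_intros simp: algebra_simps)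
    show ?thesis
      by (rule DERIV_isconst_all[of "\<lambda>t. H t * exp (t\<^sup>2 * (z \<bullet> z) / 2)"]) (intro allI d)
  qed
  moreover have "H 0 = gauss_mass TYPE('a)" by (simp add: H_def gauss_mass_def)
  ultimately have "H 1 * exp ((z \<bullet> z) / 2) = gauss_mass TYPE('a)" by simp
  then have "H 1 = gauss_mass TYPE('a) * gauss z"
    by (simp add: gauss_def exp_minus field_simps)
  then show ?thesis by (simp add: H_def)
qed

lemma gauss_fourier_scaled:
  fixes z :: "'a::euclidean_space"
  assumes "e > 0"
  shows "(\<integral>x. gauss (e *\<^sub>R x) * cos (x \<bullet> z) \<partial>lborel) = gauss_mass TYPE('a) * inverse e ^ DIM('a) * gauss (inverse e *\<^sub>R z)"
proof -
  have "(\<integral>x. gauss (e *\<^sub>R x) * cos (x \<bullet> z) \<partial>lborel) =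
     inverse e ^ DIM('a) * (\<integral>x. gauss (e *\<^sub>R (0 + inverse e *\<^sub>R x)) * cos ((0 + inverse e *\<^sub>R x) \<bullet> z) \<partial>lborel)"
    by (rule integral_lborel_affine) (use assms in auto)
  also have "\<dots> = inverse e ^ DIM('a) * (\<integral>x. gauss x * cos (x \<bullet> (inverse e *\<^sub>R z)) \<partial>lborel)"
    using assms by simp
  finally show ?thesis by (simp only: gauss_fourier mult_ac)
qed

section \<open>Inversion by Gaussian regularization\<close>

lemma trig_transform_integrable_self:
  fixes \<phi> :: "'a::euclidean_space \<Rightarrow> real"
  assumes "compact_smooth \<phi>"
  shows "integrable lborel (trig_transform \<phi> \<alpha>)"
proof -
  obtain C where C: "\<And>\<alpha> y. \<bar>trig_transform \<phi> \<alpha> y\<bar> \<le> C * inverse ((1 + norm y) ^ (DIM('a) + 1))"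
    using trig_transform_decay[OF assms, of "DIM('a) + 1"] by blast
  show ?thesis by (rule integrable_bounded_decay[OF trig_transform_measurable[OF assms] C])
qed

lemma gauss_approximate_identity:
  fixes \<phi> :: "'a::euclidean_space \<Rightarrow> real"
  assumes "compact_smooth \<phi>"
  shows "(\<lambda>k. \<integral>w. \<phi> (y + inverse (real (Suc k)) *\<^sub>R w) * gauss w \<partial>lborel) \<longlonglongrightarrow> gauss_mass TYPE('a) * \<phi> y"
proof -
  obtain C where C: "\<And>x. \<bar>\<phi> x\<bar> \<le> C"
    using compact_smooth_bounded[OF assms, of 0] by auto
  note [measurable] = compact_smooth_measurable[OF assms]
  have "(\<lambda>k. \<integral>w. \<phi> (y + inverse (real (Suc k)) *\<^sub>R w) * gauss w \<partial>lborel) \<longlonglongrightarrow> (\<integral>w. \<phi> (y + 0 *\<^sub>R w) * gauss w \<partial>lborel)"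
  proof (rule integral_dominated_convergence[where w="\<lambda>w. C * gauss w"])
    show "AE w in lborel. (\<lambda>k. \<phi> (y + inverse (real (Suc k)) *\<^sub>R w) * gauss w) \<longlonglongrightarrow> \<phi> (y + 0 *\<^sub>R w) * gauss w"
    proof (intro AE_I2 tendsto_mult tendsto_const)
      fix w
      have "isCont \<phi> (y + 0 *\<^sub>R w)"
        using compact_smooth_continuous[OF assms, of UNIV] by (simp add: continuous_on_eq_continuous_at)
      moreover have "(\<lambda>k. y + inverse (real (Suc k)) *\<^sub>R w) \<longlonglongrightarrow> y + 0 *\<^sub>R w"
        by (intro tendsto_intros LIMSEQ_inverse_real_of_nat)
      ultimately show "(\<lambda>k. \<phi> (y + inverse (real (Suc k)) *\<^sub>R w)) \<longlonglongrightarrow> \<phi> (y + 0 *\<^sub>R w)"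
        by (rule isCont_tendsto_compose)
    qed
    show "AE w in lborel. norm (\<phi> (y + inverse (real (Suc k)) *\<^sub>R w) * gauss w) \<le> C * gauss w" for k
      using mult_right_mono[OF C less_imp_le[OF gauss_pos]]
      by (intro AE_I2) (simp only: abs_mult real_norm_def abs_of_pos[OF gauss_pos])
    show "integrable lborel (\<lambda>w. C * gauss w)" by (intro integrable_mult_right gauss_integrable)
  qed measurable
  then show ?thesis by (simp add: gauss_mass_def mult.commute)
qed

text \<open>The Gaussian factor makes the double integral absolutely convergent. After the swap the
  product of cosines splits into the frequencies \<xi> - y and \<xi> + y, and each half becomes a
  Gaussian average of \<phi> around y or -y.\<close>

lemma regularized_inversion:
  fixes \<phi> :: "'a::euclidean_space \<Rightarrow> real"
  assumes \<phi>: "compact_smooth \<phi>" and e: "e > 0"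
  shows "(\<integral>x. gauss (e *\<^sub>R x) * (trig_transform \<phi> 0 x * cos (x \<bullet> y)) \<partial>lborel) =
    gauss_mass TYPE('a) / 2 * ((\<integral>w. \<phi> (y + e *\<^sub>R w) * gauss w \<partial>lborel) + (\<integral>w. \<phi> (- y + e *\<^sub>R w) * gauss w \<partial>lborel))"
proof -
  note [measurable] = compact_smooth_measurable[OF \<phi>]
  let ?G = "gauss_mass TYPE('a)"
  have ge: "integrable lborel (\<lambda>x::'a. gauss (e *\<^sub>R x))"
    by (rule integrable_lborel_scale[OF gauss_integrable e])
  have \<phi>i: "integrable lborel \<phi>"
    using compact_smooth_integrable_mult[OF \<phi>, of "\<lambda>_. 1"] by simp
  have "(\<integral>x. gauss (e *\<^sub>R x) * (trig_transform \<phi> 0 x * cos (x \<bullet> y)) \<partial>lborel) =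
    (\<integral>x. (\<integral>\<xi>. gauss (e *\<^sub>R x) * \<phi> \<xi> * (cos (x \<bullet> \<xi>) * cos (x \<bullet> y)) \<partial>lborel) \<partial>lborel)"
    unfolding trig_transform_def integral_mult_left_zero[symmetric] integral_mult_right_zero[symmetric]
    by (simp add: mult_ac)
  also have "\<dots> = (\<integral>\<xi>. (\<integral>x. gauss (e *\<^sub>R x) * \<phi> \<xi> * (cos (x \<bullet> \<xi>) * cos (x \<bullet> y)) \<partial>lborel) \<partial>lborel)"
  proof (rule lborel_pair.Fubini_integral[symmetric])
    show "integrable (lborel \<Otimes>\<^sub>M lborel) (\<lambda>(x, \<xi>). gauss (e *\<^sub>R x) * \<phi> \<xi> * (cos (x \<bullet> \<xi>) * cos (x \<bullet> y)))"
    proof (rule Bochner_Integration.integrable_bound[OF integrable_lborel_product[OF ge \<phi>i]])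
      show "AE p in lborel \<Otimes>\<^sub>M lborel. norm (case p of (x, \<xi>) \<Rightarrow> gauss (e *\<^sub>R x) * \<phi> \<xi> * (cos (x \<bullet> \<xi>) * cos (x \<bullet> y)))
        \<le> norm (case p of (x, \<xi>) \<Rightarrow> gauss (e *\<^sub>R x) * \<phi> \<xi>)"
      proof (intro AE_I2, clarify)
        fix x \<xi> :: 'a
        have "\<bar>cos (x \<bullet> \<xi>)\<bar> * \<bar>cos (x \<bullet> y)\<bar> \<le> 1 * 1" by (intro mult_mono) auto
        then show "norm (gauss (e *\<^sub>R x) * \<phi> \<xi> * (cos (x \<bullet> \<xi>) * cos (x \<bullet> y))) \<le> norm (gauss (e *\<^sub>R x) * \<phi> \<xi>)"
          using mult_left_le[of "\<bar>cos (x \<bullet> \<xi>)\<bar> * \<bar>cos (x \<bullet> y)\<bar>" "\<bar>gauss (e *\<^sub>R x) * \<phi> \<xi>\<bar>"]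
          by (simp add: abs_mult mult.assoc)
      qed
    qed measurable
  qed
  also have "\<dots> = (\<integral>\<xi>. ?G / 2 * (inverse e ^ DIM('a) * (\<phi> \<xi> * gauss (inverse e *\<^sub>R (\<xi> - y))) +
      inverse e ^ DIM('a) * (\<phi> \<xi> * gauss (inverse e *\<^sub>R (\<xi> + y)))) \<partial>lborel)"
  proof (intro Bochner_Integration.integral_cong refl)
    fix \<xi> :: 'a
    have i: "integrable lborel (\<lambda>x. gauss (e *\<^sub>R x) * cos (x \<bullet> z))" for z :: 'a
      by (rule Bochner_Integration.integrable_bound[OF ge])
        (use gauss_pos in \<open>auto simp: abs_mult mult_left_le\<close>)
    have "(\<lambda>x. gauss (e *\<^sub>R x) * \<phi> \<xi> * (cos (x \<bullet> \<xi>) * cos (x \<bullet> y))) =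
       (\<lambda>x. \<phi> \<xi> / 2 * (gauss (e *\<^sub>R x) * cos (x \<bullet> (\<xi> - y)) + gauss (e *\<^sub>R x) * cos (x \<bullet> (\<xi> + y))))"
      by (rule ext) (simp add: inner_diff_right inner_add_right cos_add cos_diff algebra_simps)
    then have "(\<integral>x. gauss (e *\<^sub>R x) * \<phi> \<xi> * (cos (x \<bullet> \<xi>) * cos (x \<bullet> y)) \<partial>lborel) =
        \<phi> \<xi> / 2 * ((\<integral>x. gauss (e *\<^sub>R x) * cos (x \<bullet> (\<xi> - y)) \<partial>lborel) + (\<integral>x. gauss (e *\<^sub>R x) * cos (x \<bullet> (\<xi> + y)) \<partial>lborel))"
      using i by simp
    also have "\<dots> = ?G / 2 * (inverse e ^ DIM('a) * (\<phi> \<xi> * gauss (inverse e *\<^sub>R (\<xi> - y))) +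
      inverse e ^ DIM('a) * (\<phi> \<xi> * gauss (inverse e *\<^sub>R (\<xi> + y))))"
      unfolding gauss_fourier_scaled[OF e] by (simp only: distrib_left times_divide_eq_left mult_ac) (simp add: mult_ac)
    finally show "(\<integral>x. gauss (e *\<^sub>R x) * \<phi> \<xi> * (cos (x \<bullet> \<xi>) * cos (x \<bullet> y)) \<partial>lborel) =
       ?G / 2 * (inverse e ^ DIM('a) * (\<phi> \<xi> * gauss (inverse e *\<^sub>R (\<xi> - y))) +
      inverse e ^ DIM('a) * (\<phi> \<xi> * gauss (inverse e *\<^sub>R (\<xi> + y))))" .
  qed
  also have "\<dots> = ?G / 2 * (inverse e ^ DIM('a) * (\<integral>\<xi>. \<phi> \<xi> * gauss (inverse e *\<^sub>R (\<xi> - y)) \<partial>lborel) +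
      inverse e ^ DIM('a) * (\<integral>\<xi>. \<phi> \<xi> * gauss (inverse e *\<^sub>R (\<xi> + y)) \<partial>lborel))"
  proof -
    have "continuous_on UNIV (\<lambda>\<xi>. gauss (inverse e *\<^sub>R (\<xi> - y)))" "continuous_on UNIV (\<lambda>\<xi>. gauss (inverse e *\<^sub>R (\<xi> + y)))"
      by (auto intro!: continuous_on_compose2[OF gauss_continuous[of UNIV]] continuous_intros)
    from this[THEN compact_smooth_integrable_mult[OF \<phi>]] show ?thesis by simp
  qed
  also have "inverse e ^ DIM('a) * (\<integral>\<xi>. \<phi> \<xi> * gauss (inverse e *\<^sub>R (\<xi> - y)) \<partial>lborel) = (\<integral>w. \<phi> (y + e *\<^sub>R w) * gauss w \<partial>lborel)"
    using e by (subst integral_lborel_affine[where c=e and t=y]) (auto simp: power_inverse)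
  also have "inverse e ^ DIM('a) * (\<integral>\<xi>. \<phi> \<xi> * gauss (inverse e *\<^sub>R (\<xi> + y)) \<partial>lborel) = (\<integral>w. \<phi> (- y + e *\<^sub>R w) * gauss w \<partial>lborel)"
    using e by (subst integral_lborel_affine[where c=e and t="-y"]) (auto simp: power_inverse)
  finally show ?thesis .
qed

text \<open>The regularized integral at scale 1/(k+1) is passed to the limit in two ways: by the
  approximate identity and by dominated convergence. The cosine transform sees only the even part of
  \<phi>, hence the sum of two values. The factor is (2 pi)^n / 2.\<close>

theorem fourier_inversion:
  fixes \<phi> :: "'a::euclidean_space \<Rightarrow> real"
  assumes \<phi>: "compact_smooth \<phi>"
  shows "(\<integral>x. trig_transform \<phi> 0 x * cos (x \<bullet> y) \<partial>lborel) = (gauss_mass TYPE('a))\<^sup>2 / 2 * (\<phi> y + \<phi> (- y))"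
proof -
  let ?G = "gauss_mass TYPE('a)" and ?e = "\<lambda>k. inverse (real (Suc k))"
  note [measurable] = trig_transform_measurable[OF \<phi>]
  let ?J = "\<lambda>k. \<integral>x. gauss (?e k *\<^sub>R x) * (trig_transform \<phi> 0 x * cos (x \<bullet> y)) \<partial>lborel"
  have 1: "?J \<longlonglongrightarrow> ?G / 2 * (?G * \<phi> y + ?G * \<phi> (- y))"
  proof -
    have "?J = (\<lambda>k. ?G / 2 * ((\<integral>w. \<phi> (y + ?e k *\<^sub>R w) * gauss w \<partial>lborel) + (\<integral>w. \<phi> (- y + ?e k *\<^sub>R w) * gauss w \<partial>lborel)))"
      by (rule ext, rule regularized_inversion[OF \<phi>]) simp
    then show ?thesis
      by (simp only:) (intro tendsto_intros gauss_approximate_identity[OF \<phi>])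
  qed
  have 2: "?J \<longlonglongrightarrow> (\<integral>x. gauss (0 *\<^sub>R x) * (trig_transform \<phi> 0 x * cos (x \<bullet> y)) \<partial>lborel)"
  proof (rule integral_dominated_convergence[where w="\<lambda>x. \<bar>trig_transform \<phi> 0 x\<bar>"])
    show "integrable lborel (\<lambda>x. \<bar>trig_transform \<phi> 0 x\<bar>)"
      by (intro integrable_abs trig_transform_integrable_self \<phi>)
    show "AE x in lborel. (\<lambda>k. gauss (?e k *\<^sub>R x) * (trig_transform \<phi> 0 x * cos (x \<bullet> y))) \<longlonglongrightarrow>
       gauss (0 *\<^sub>R x) * (trig_transform \<phi> 0 x * cos (x \<bullet> y))"
    proof (intro AE_I2 tendsto_mult tendsto_const)
      fix x :: 'a
      have "isCont gauss (0 *\<^sub>R x)"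
        using gauss_continuous[of "UNIV :: 'a set"] by (simp add: continuous_on_eq_continuous_at)
      moreover have "(\<lambda>k. ?e k *\<^sub>R x) \<longlonglongrightarrow> 0 *\<^sub>R x"
        by (intro tendsto_intros LIMSEQ_inverse_real_of_nat)
      ultimately show "(\<lambda>k. gauss (?e k *\<^sub>R x)) \<longlonglongrightarrow> gauss (0 *\<^sub>R x)"
        by (rule isCont_tendsto_compose)
    qed
    show "AE x in lborel. norm (gauss (?e k *\<^sub>R x) * (trig_transform \<phi> 0 x * cos (x \<bullet> y))) \<le> \<bar>trig_transform \<phi> 0 x\<bar>" for k
    proof (rule AE_I2)
      fix x :: 'a
      have "gauss (?e k *\<^sub>R x) * (\<bar>trig_transform \<phi> 0 x\<bar> * \<bar>cos (x \<bullet> y)\<bar>) \<le> 1 * (\<bar>trig_transform \<phi> 0 x\<bar> * 1)"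
        by (intro mult_mono gauss_le_1) auto
      then show "norm (gauss (?e k *\<^sub>R x) * (trig_transform \<phi> 0 x * cos (x \<bullet> y))) \<le> \<bar>trig_transform \<phi> 0 x\<bar>"
        by (simp only: abs_mult real_norm_def abs_of_pos[OF gauss_pos] mult_1_left mult_1_right)
    qed
  qed measurable
  from LIMSEQ_unique[OF 1 2] show ?thesis
    by (simp add: gauss_def power2_eq_square algebra_simps)
qed

section \<open>Absolute powers as superpositions of cosines\<close>

text \<open>The Taylor remainder of the cosine of order \<open>2m + 2\<close> has constant sign and size
  \<open>O(z\<^sup>2\<^sup>m\<^sup>+\<^sup>2)\<close> at 0 and \<open>O(z\<^sup>2\<^sup>m)\<close> at infinity. Hence it can be integrated against
  \<open>s powr (- q - 1)\<close> exactly when \<open>2m < q < 2m + 2\<close>, and by homogeneity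
  the integral over \<open>s\<close> of its value at \<open>s * t\<close> is a multiple of \<open>\<bar>t\<bar> powr q\<close>.\<close>

definition cos_rem :: "nat \<Rightarrow> real \<Rightarrow> real" where
  "cos_rem m z = cos z - (\<Sum>k\<le>m. (-1) ^ k * z ^ (2 * k) / fact (2 * k))"

text \<open>An intermediate remainder: \<open>cos_rem (Suc m)\<close> has derivative
  \<open>- sin_rem m\<close>, and \<open>sin_rem m\<close> has derivative \<open>cos_rem m\<close>,
  which carries sign information from m to m + 1.\<close>

definition sin_rem :: "nat \<Rightarrow> real \<Rightarrow> real" where
  "sin_rem m z = sin z - (\<Sum>k\<le>m. (-1) ^ k * z ^ (2 * k + 1) / fact (2 * k + 1))"

lemma sin_rem_deriv: "(sin_rem m has_real_derivative cos_rem m z) (at z)"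
proof -
  have "((\<lambda>z. (-1) ^ k * z ^ (2 * k + 1) / fact (2 * k + 1)) has_real_derivative
      (-1) ^ k * z ^ (2 * k) / fact (2 * k)) (at z)" for k :: nat
  proof -
    have "((\<lambda>z. (-1) ^ k * z ^ Suc (2 * k) / fact (Suc (2 * k))) has_real_derivative
      (-1) ^ k * (real (Suc (2 * k)) * z ^ (2 * k)) / fact (Suc (2 * k))) (at z)"
      by (auto intro!: derivative_eq_intros simp del: power_Suc fact_Suc of_nat_Suc)
    moreover have "fact (Suc (2 * k)) = real (Suc (2 * k)) * fact (2 * k)" by (simp only: fact_Suc of_nat_mult)
    moreover have "2 * k + 1 = Suc (2 * k)" by simp
    ultimately show ?thesis by (simp del: fact_Suc of_nat_add of_nat_Suc)
  qed
  then show ?thesis unfolding sin_rem_def[abs_def] cos_rem_def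
    by (intro DERIV_diff DERIV_sum) (auto intro: DERIV_sin)
qed

lemma cos_rem_deriv: "(cos_rem (Suc m) has_real_derivative - sin_rem m z) (at z)"
proof -
  have "((\<lambda>z. (-1) ^ Suc k * z ^ (2 * Suc k) / fact (2 * Suc k)) has_real_derivative
      - ((-1) ^ k * z ^ (2 * k + 1) / fact (2 * k + 1))) (at z)" for k :: nat
  proof -
    have "((\<lambda>z. (-1) ^ Suc k * z ^ (Suc (2 * k + 1)) / fact (Suc (2 * k + 1))) has_real_derivative
      (-1) ^ Suc k * (real (Suc (2 * k + 1)) * z ^ (2 * k + 1)) / fact (Suc (2 * k + 1))) (at z)"
      by (auto intro!: derivative_eq_intros simp del: power_Suc fact_Suc of_nat_Suc)
    moreover have "fact (Suc (2 * k + 1)) = real (Suc (2 * k + 1)) * fact (2 * k + 1)" by (simp only: fact_Suc of_nat_mult)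
    moreover have "2 * Suc k = Suc (2 * k + 1)" by simp
    ultimately show ?thesis by (simp del: fact_Suc of_nat_add of_nat_Suc)
  qed
  then have "((\<lambda>z. cos z - (1 + (\<Sum>k\<le>m. (-1) ^ Suc k * z ^ (2 * Suc k) / fact (2 * Suc k)))) has_real_derivative
     - sin z - (0 + (\<Sum>k\<le>m. - ((-1) ^ k * z ^ (2 * k + 1) / fact (2 * k + 1))))) (at z)"
    by (intro DERIV_diff DERIV_add DERIV_const DERIV_sum DERIV_cos)
  moreover have "cos_rem (Suc m) = (\<lambda>z. cos z - (1 + (\<Sum>k\<le>m. (-1) ^ Suc k * z ^ (2 * Suc k) / fact (2 * Suc k))))"
    unfolding cos_rem_def[abs_def] by (subst sum.atMost_Suc_shift) simp
  moreover have "- sin_rem m z = - sin z - (0 + (\<Sum>k\<le>m. - ((-1) ^ k * z ^ (2 * k + 1) / fact (2 * k + 1))))"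
    unfolding sin_rem_def sum_negf by simp
  ultimately show ?thesis by (simp only:)
qed

lemma cos_rem_at_0: "cos_rem m 0 = 0"
proof -
  have "(\<Sum>k\<le>m. (-1) ^ k * (0::real) ^ (2 * k) / fact (2 * k)) = (\<Sum>k\<le>m. if k = 0 then 1 else 0)"
    by (rule sum.cong) auto
  then show ?thesis by (simp add: cos_rem_def)
qed

lemma sin_rem_at_0: "sin_rem m 0 = 0" by (simp add: sin_rem_def)

lemma cos_rem_minus: "cos_rem m (- z) = cos_rem m z"
  by (simp add: cos_rem_def)

lemma cos_rem_abs: "cos_rem m \<bar>z\<bar> = cos_rem m z"
  by (cases "z \<ge> 0") (simp_all add: cos_rem_minus)

lemma cos_rem_continuous: "continuous_on S (cos_rem m)"
  unfolding cos_rem_def by (intro continuous_intros) auto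

lemma cos_rem_measurable [measurable]: "cos_rem m \<in> borel_measurable borel"
  by (intro borel_measurable_continuous_onI cos_rem_continuous)

text \<open>Strict positivity is kept on (0,1) only: that is enough for a positive integral, while
  on the whole half-line it already fails for 1 - cos, which vanishes at 2 pi.\<close>

lemma nonneg_from_derivative:
  fixes f g :: "real \<Rightarrow> real"
  assumes der: "\<And>x. (f has_real_derivative g x) (at x)" and 0: "f 0 = 0"
    and g: "\<And>x. 0 \<le> x \<Longrightarrow> 0 \<le> g x" "\<And>x. 0 < x \<Longrightarrow> x < 1 \<Longrightarrow> 0 < g x"
  shows "0 \<le> x \<Longrightarrow> 0 \<le> f x" "0 < x \<Longrightarrow> x < 1 \<Longrightarrow> 0 < f x"
proof -
  assume "0 \<le> x"
  have "f 0 \<le> f x"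
  proof (rule DERIV_nonneg_imp_nondecreasing[OF \<open>0 \<le> x\<close>])
    show "\<exists>D. (f has_real_derivative D) (at y) \<and> 0 \<le> D" if "0 \<le> y" for y
      using der[of y] g(1)[OF that] by blast
  qed
  then show "0 \<le> f x" using 0 by simp
next
  assume x: "0 < x" "x < 1"
  have "f 0 < f x"
  proof (rule DERIV_pos_imp_increasing_open[OF x(1)])
    show "continuous_on {0..x} f"
      by (intro continuous_at_imp_continuous_on ballI DERIV_isCont[OF der])
    show "\<exists>D. (f has_real_derivative D) (at y) \<and> D > 0" if "0 < y" "y < x" for y
      using der[of y] g(2)[of y] that x by auto
  qed
  then show "0 < f x" using 0 by simp
qed

text \<open>Two integrations from 0, where both remainders vanish, lead from m to m + 1; the start
  is cos z \<le> 1.\<close>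

lemma cos_rem_sign:
  "(\<forall>z\<ge>0. 0 \<le> (-1) ^ Suc m * cos_rem m z) \<and> (\<forall>z. 0 < z \<longrightarrow> z < 1 \<longrightarrow> 0 < (-1) ^ Suc m * cos_rem m z)"
proof (induction m)
  case 0
  have "cos z < 1" if "0 < z" "z < 1" for z :: real
    using cos_monotone_0_pi[of 0 z] that pi_gt3 by simp
  then show ?case by (simp add: cos_rem_def)
next
  case (Suc m)
  have s: "((\<lambda>z. (-1) ^ Suc m * sin_rem m z) has_real_derivative (-1) ^ Suc m * cos_rem m z) (at z)" for z
    by (intro DERIV_cmult sin_rem_deriv)
  have c: "((\<lambda>z. (-1) ^ Suc (Suc m) * cos_rem (Suc m) z) has_real_derivative (-1) ^ Suc m * sin_rem m z) (at z)" for z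
    using DERIV_cmult[OF cos_rem_deriv[of m z], of "(-1) ^ Suc (Suc m)"] by simp
  note S = nonneg_from_derivative[OF s]
  have S0: "(-1) ^ Suc m * sin_rem m 0 = 0" by (simp add: sin_rem_at_0)
  have C0: "(-1) ^ Suc (Suc m) * cos_rem (Suc m) 0 = 0" by (simp add: cos_rem_at_0)
  have S1: "0 \<le> (-1) ^ Suc m * sin_rem m z" if "0 \<le> z" for z
    by (rule S(1)[OF S0 _ _ that]) (use Suc.IH in auto)
  have S2: "0 < (-1) ^ Suc m * sin_rem m z" if "0 < z" "z < 1" for z
    by (rule S(2)[OF S0 _ _ that]) (use Suc.IH in auto)
  show ?case
    using nonneg_from_derivative[OF c C0 S1 S2] by blast
qed

lemma cos_rem_nonneg: "0 \<le> (-1) ^ Suc m * cos_rem m z"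
proof -
  have "0 \<le> (-1) ^ Suc m * cos_rem m \<bar>z\<bar>" using cos_rem_sign[of m] by simp
  then show ?thesis by (simp only: cos_rem_abs)
qed

lemma cos_rem_abs_eq: "\<bar>cos_rem m z\<bar> = (-1) ^ Suc m * cos_rem m z"
proof -
  have "\<bar>(-1) ^ Suc m * cos_rem m z\<bar> = \<bar>cos_rem m z\<bar>" by (simp add: abs_mult)
  then show ?thesis using abs_of_nonneg[OF cos_rem_nonneg[of m z]] by linarith
qed

text \<open>Consecutive remainders have opposite signs and differ by one Taylor term, so each is
  bounded by that term.\<close>

lemma cos_rem_bound: "\<bar>cos_rem m z\<bar> \<le> z ^ (2 * Suc m) / fact (2 * Suc m)"
proof -
  have "cos_rem (Suc m) z = cos_rem m z - (-1) ^ Suc m * z ^ (2 * Suc m) / fact (2 * Suc m)"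
    by (simp add: cos_rem_def del: power_Suc fact_Suc mult_Suc_right)
  then have "(-1) ^ Suc (Suc m) * cos_rem (Suc m) z =
     (-1) ^ Suc (Suc m) * cos_rem m z - (-1) ^ Suc (Suc m) * ((-1) ^ Suc m * z ^ (2 * Suc m) / fact (2 * Suc m))"
    by (simp only: right_diff_distrib)
  also have "(-1) ^ Suc (Suc m) * cos_rem m z = - \<bar>cos_rem m z\<bar>" unfolding cos_rem_abs_eq by simp
  also have "(-1) ^ Suc (Suc m) * ((-1) ^ Suc m * z ^ (2 * Suc m) / fact (2 * Suc m)) = - (z ^ (2 * Suc m) / fact (2 * Suc m))"
  proof -
    have "((-1::real) ^ Suc (Suc m)) * (-1) ^ Suc m = -1"
      by (simp flip: power_add)
    then show ?thesis by (metis mult.assoc mult_minus1 times_divide_eq_right)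
  qed
  finally show ?thesis using cos_rem_nonneg[of "Suc m" z] by linarith
qed

text \<open>The m + 1 Taylor terms and the cosine are each at most z^(2m) in absolute value when z
  \<ge> 1.\<close>

lemma cos_rem_bound_large:
  assumes "1 \<le> z"
  shows "\<bar>cos_rem m z\<bar> \<le> real (m + 2) * z ^ (2 * m)"
proof -
  have "\<bar>\<Sum>k\<le>m. (-1) ^ k * z ^ (2 * k) / fact (2 * k)\<bar> \<le> (\<Sum>k\<le>m. \<bar>(-1) ^ k * z ^ (2 * k) / fact (2 * k)\<bar>)"
    by (rule sum_abs)
  also have "\<dots> \<le> (\<Sum>k\<le>m. z ^ (2 * m))"
  proof (rule sum_mono)
    fix k assume "k \<in> {..m}"
    have "\<bar>(-1) ^ k * z ^ (2 * k) / fact (2 * k)\<bar> = z ^ (2 * k) / fact (2 * k)"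
      using assms by (simp add: abs_mult power_abs)
    also have "\<dots> \<le> z ^ (2 * k) / 1" using assms by (intro divide_left_mono) auto
    also have "\<dots> \<le> z ^ (2 * m)" using assms \<open>k \<in> {..m}\<close> by (simp add: power_increasing)
    finally show "\<bar>(-1) ^ k * z ^ (2 * k) / fact (2 * k)\<bar> \<le> z ^ (2 * m)" .
  qed
  finally have "\<bar>\<Sum>k\<le>m. (-1) ^ k * z ^ (2 * k) / fact (2 * k)\<bar> \<le> real (m + 1) * z ^ (2 * m)" by simp
  moreover have "\<bar>cos z\<bar> \<le> z ^ (2 * m)" using assms by (meson abs_cos_le_one one_le_power order_trans)
  moreover have "real (m + 2) * z ^ (2 * m) = real (m + 1) * z ^ (2 * m) + z ^ (2 * m)" by (simp add: algebra_simps)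
  ultimately show ?thesis unfolding cos_rem_def by linarith
qed

lemma integrable_indicator_powr:
  fixes a :: real
  assumes "((\<lambda>x. x powr a) has_integral I) S" "S \<in> sets borel"
  shows "integrable lborel (\<lambda>x. indicator S x * x powr a)"
proof -
  have "((\<lambda>x. if x \<in> S then x powr a else 0) has_integral I) UNIV"
    using assms(1) by (simp only: has_integral_restrict_UNIV)
  moreover have "(\<lambda>x. if x \<in> S then x powr a else 0) = (\<lambda>x. indicator S x * x powr a)"
    by (auto simp: indicator_def)
  ultimately have I: "((\<lambda>x. indicator S x * x powr a) has_integral I) UNIV" by simp
  have "(\<integral>\<^sup>+x. ennreal (indicator S x * x powr a) \<partial>lborel) = ennreal I"
    by (rule nn_integral_has_integral_lborel[OF _ _ I]) (use assms(2) in auto)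
  then show ?thesis
    by (intro integrableI_nonneg) (use assms(2) in auto)
qed

text \<open>Taken with the absolute value so as to be positive; the sign (-1)^(m+1) of the remainder
  is kept apart and later meets that of Gamma(-q/2).\<close>

definition cos_rem_const :: "nat \<Rightarrow> real \<Rightarrow> real" where
  "cos_rem_const m q = (\<integral>s. indicator {0<..} s * s powr (- q - 1) * \<bar>cos_rem m s\<bar> \<partial>lborel)"

context
  fixes m :: nat and q :: real
  assumes qm: "2 * real m < q" "q < 2 * real m + 2"
begin

lemma cos_rem_integrable: "integrable lborel (\<lambda>s. indicator {0<..} s * s powr (- q - 1) * \<bar>cos_rem m s\<bar>)"
proof (rule Bochner_Integration.integrable_bound)
  \<comment> \<open>The exponents left by the two bounds on the remainder: q < 2m + 2 gives
    \<open>?a\<close> > -1, integrable at 0, and 2m < q gives \<open>?b\<close> < -1, integrable at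
    infinity.\<close>
  let ?a = "2 * real m + 1 - q" and ?b = "2 * real m - q - 1"
  have "integrable lborel (\<lambda>s. indicator {0..1} s * s powr ?a)"
    by (rule integrable_indicator_powr[OF has_integral_powr_from_0]) (use qm in auto)
  moreover have "integrable lborel (\<lambda>s. indicator {1..} s * s powr ?b)"
    by (rule integrable_indicator_powr[OF has_integral_powr_to_inf]) (use qm in auto)
  ultimately show "integrable lborel (\<lambda>s. indicator {0..1} s * s powr ?a + real (m + 2) * (indicator {1..} s * s powr ?b))"
    by (intro Bochner_Integration.integrable_add integrable_mult_right)
  show "AE s in lborel. norm (indicator {0<..} s * s powr (- q - 1) * \<bar>cos_rem m s\<bar>)
     \<le> norm (indicator {0..1} s * s powr ?a + real (m + 2) * (indicator {1..} s * s powr ?b))"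
  proof (rule AE_I2)
    fix s :: real
    consider "s \<le> 0" | "0 < s" "s < 1" | "1 \<le> s" by linarith
    then show "norm (indicator {0<..} s * s powr (- q - 1) * \<bar>cos_rem m s\<bar>)
       \<le> norm (indicator {0..1} s * s powr ?a + real (m + 2) * (indicator {1..} s * s powr ?b))"
    proof cases
      case 1
      then show ?thesis by simp
    next
      case 2
      have "\<bar>cos_rem m s\<bar> \<le> s ^ (2 * Suc m) / 1"
        by (rule order_trans[OF cos_rem_bound divide_left_mono]) (use 2 fact_ge_1[of "2 * Suc m"] in \<open>auto simp del: fact_Suc mult_Suc_right\<close>)
      then have "s powr (- q - 1) * \<bar>cos_rem m s\<bar> \<le> s powr (- q - 1) * s ^ (2 * Suc m)"
        by (intro mult_left_mono) auto
      also have "\<dots> = s powr (- q - 1) * s powr real (2 * Suc m)" using 2 by (simp only: powr_realpow)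
      also have "\<dots> = s powr ?a" unfolding powr_add[symmetric] by (simp add: algebra_simps)
      finally show ?thesis using 2 by simp
    next
      case 3
      have "s powr (- q - 1) * \<bar>cos_rem m s\<bar> \<le> s powr (- q - 1) * (real (m + 2) * s ^ (2 * m))"
        by (intro mult_left_mono cos_rem_bound_large 3) auto
      also have "\<dots> = real (m + 2) * (s powr (- q - 1) * s powr real (2 * m))"
        using 3 by (subst powr_realpow) auto
      also have "\<dots> = real (m + 2) * s powr ?b" unfolding powr_add[symmetric] by (simp add: algebra_simps)
      also have "\<dots> \<le> indicator {0..1} s * s powr ?a + real (m + 2) * (indicator {1..} s * s powr ?b)"
        using 3 by simp
      finally have "s powr (- q - 1) * \<bar>cos_rem m s\<bar> \<le> indicator {0..1} s * s powr ?a + real (m + 2) * (indicator {1..} s * s powr ?b)" .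
      moreover have "norm (indicator {0<..} s * s powr (- q - 1) * \<bar>cos_rem m s\<bar>) = s powr (- q - 1) * \<bar>cos_rem m s\<bar>"
        using 3 by (simp add: abs_mult)
      ultimately show ?thesis using abs_ge_self order_trans unfolding real_norm_def by metis
    qed
  qed
qed measurable

lemma cos_rem_const_pos: "0 < cos_rem_const m q"
  unfolding cos_rem_const_def
proof (rule integral_pos_open[OF cos_rem_integrable, where U="{0<..<1}"])
  fix s :: real assume s: "s \<in> {0<..<1}"
  then have "0 < (-1) ^ Suc m * cos_rem m s" using cos_rem_sign[of m] by simp
  then have "0 < \<bar>cos_rem m s\<bar>" unfolding cos_rem_abs_eq .
  then show "0 < indicator {0<..} s * s powr (- q - 1) * \<bar>cos_rem m s\<bar>" using s by simp
qed auto

text \<open>Rescaling s by |t|; the remainder is even, so |t| may replace t. Up to the positive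
  constant this writes |t|^q as a superposition of remainders.\<close>

lemma cos_rem_scaled:
  "integrable lborel (\<lambda>s. indicator {0<..} s * s powr (- q - 1) * \<bar>cos_rem m (s * t)\<bar>)"
  "(\<integral>s. indicator {0<..} s * s powr (- q - 1) * \<bar>cos_rem m (s * t)\<bar> \<partial>lborel) = cos_rem_const m q * \<bar>t\<bar> powr q"
proof -
  let ?f = "\<lambda>s. indicator {0<..} s * s powr (- q - 1) * \<bar>cos_rem m s\<bar>"
  let ?g = "\<lambda>s. indicator {0<..} s * s powr (- q - 1) * \<bar>cos_rem m (s * t)\<bar>"
  have "integrable lborel ?g \<and> integral\<^sup>L lborel ?g = cos_rem_const m q * \<bar>t\<bar> powr q"
  proof (cases "t = 0")
    case True
    then show ?thesis by (simp add: cos_rem_at_0)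
  next
    case False
    have eq: "?f (0 + \<bar>t\<bar> * s) = \<bar>t\<bar> powr (- q - 1) * ?g s" for s
    proof (cases "s > 0")
      case True
      have "cos_rem m (\<bar>t\<bar> * s) = cos_rem m (s * t)"
        using cos_rem_abs[of m "s * t"] True by (simp add: abs_mult mult.commute)
      moreover have "(\<bar>t\<bar> * s) powr (- q - 1) = \<bar>t\<bar> powr (- q - 1) * s powr (- q - 1)" by (rule powr_mult)
      ultimately show ?thesis using True False by simp
    next
      case F: False
      then have "\<not> \<bar>t\<bar> * s > 0" by (simp add: zero_less_mult_iff)
      then show ?thesis using F by simp
    qed
    have t0: "\<bar>t\<bar> \<noteq> 0" using False by simp
    have "integrable lborel (\<lambda>s. ?f (0 + \<bar>t\<bar> * s))"
      by (rule lborel_integrable_real_affine[OF cos_rem_integrable t0])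
    then have 1: "integrable lborel ?g" unfolding eq using False by simp
    have "cos_rem_const m q = \<bar>t\<bar> * (\<integral>s. ?f (0 + \<bar>t\<bar> * s) \<partial>lborel)"
      unfolding cos_rem_const_def using lborel_integral_real_affine[OF t0, of ?f 0] by simp
    also have "\<dots> = \<bar>t\<bar> * (\<bar>t\<bar> powr (- q - 1) * integral\<^sup>L lborel ?g)" unfolding eq by simp
    also have "\<dots> = \<bar>t\<bar> powr (- q) * integral\<^sup>L lborel ?g"
      using False by (simp add: powr_diff)
    finally have "cos_rem_const m q * \<bar>t\<bar> powr q = (\<bar>t\<bar> powr (- q) * \<bar>t\<bar> powr q) * integral\<^sup>L lborel ?g"
      by simp
    also have "\<bar>t\<bar> powr (- q) * \<bar>t\<bar> powr q = 1" using False by (simp flip: powr_add)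
    finally show ?thesis using 1 by simp
  qed
  then show "integrable lborel ?g" "integral\<^sup>L lborel ?g = cos_rem_const m q * \<bar>t\<bar> powr q" by auto
qed

end

section \<open>Moments of Fourier transforms of functions vanishing near the origin\<close>

lemma trig_transform_times_integrable:
  fixes \<phi> f :: "'a::euclidean_space \<Rightarrow> real"
  assumes \<phi>: "compact_smooth \<phi>" and [measurable]: "f \<in> borel_measurable borel"
    and f: "\<And>x. \<bar>f x\<bar> \<le> B * (1 + norm x) ^ N"
  shows "integrable lborel (\<lambda>x. trig_transform \<phi> \<alpha> x * f x)"
proof -
  note [measurable] = trig_transform_measurable[OF \<phi>]
  obtain C where C: "C \<ge> 0" "\<And>\<alpha> y. \<bar>trig_transform \<phi> \<alpha> y\<bar> \<le> C * inverse ((1 + norm y) ^ (N + (DIM('a) + 1)))"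
    using trig_transform_decay[OF \<phi>, of "N + (DIM('a) + 1)"] by blast
  show ?thesis
  proof (rule integrable_bounded_decay[where C="C * B"])
    fix x :: 'a
    have p: "0 < (1 + norm x) ^ N"
      by (intro zero_less_power) (simp add: add_pos_nonneg)
    have "\<bar>trig_transform \<phi> \<alpha> x * f x\<bar> \<le> (C * inverse ((1 + norm x) ^ (N + (DIM('a) + 1)))) * (B * (1 + norm x) ^ N)"
      unfolding abs_mult by (intro mult_mono C f) (use C in auto)
    also have "\<dots> = C * B * inverse ((1 + norm x) ^ (DIM('a) + 1)) * (inverse ((1 + norm x) ^ N) * (1 + norm x) ^ N)"
      unfolding power_add[of _ N] inverse_mult_distrib by (simp only: mult_ac)
    also have "inverse ((1 + norm x) ^ N) * (1 + norm x) ^ N = 1"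
      by (rule left_inverse[OF less_imp_neq[OF p, symmetric]])
    finally show "\<bar>trig_transform \<phi> \<alpha> x * f x\<bar> \<le> C * B * inverse ((1 + norm x) ^ (DIM('a) + 1))"
      by (simp only: mult_1_right)
  qed measurable
qed

lemma divide_fact_le: "0 \<le> a \<Longrightarrow> a / fact n \<le> (a::real)"
  using divide_left_mono[of 1 "fact n :: real" a] by (simp add: fact_ge_1)

lemma nonpos_if_le_square:
  fixes M c \<delta> :: real
  assumes "\<delta> > 0" "\<And>s. 0 < s \<Longrightarrow> s < \<delta> \<Longrightarrow> M \<le> c * s\<^sup>2"
  shows "M \<le> 0"
proof (rule tendsto_lowerbound)
  show "((\<lambda>s. c * s\<^sup>2) \<longlongrightarrow> 0) (at_right 0)"
    by (auto intro!: tendsto_eq_intros)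
  show "\<forall>\<^sub>F s in at_right 0. M \<le> c * s\<^sup>2"
    using eventually_at_right_less[of 0] eventually_at_rightI[of 0 \<delta> "\<lambda>s. M \<le> c * s\<^sup>2"] assms by auto
qed simp

context
  fixes \<phi> :: "'a::euclidean_space \<Rightarrow> real" and \<xi> :: 'a and \<delta> :: real
  assumes \<phi>: "compact_smooth \<phi>" and \<xi>: "norm \<xi> = 1"
    and \<delta>: "\<delta> > 0" "\<And>x. norm x < \<delta> \<Longrightarrow> \<phi> x = 0"
begin

lemma abs_inner_unit_le: "\<bar>x \<bullet> \<xi>\<bar> \<le> 1 + norm x"
  using Cauchy_Schwarz_ineq2[of x \<xi>] \<xi> by simp

lemma trig_transform_power_integrable: "integrable lborel (\<lambda>x. trig_transform \<phi> 0 x * (x \<bullet> \<xi>) ^ k)"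
proof (rule trig_transform_times_integrable[OF \<phi>, where B=1 and N=k])
  show "\<bar>(x \<bullet> \<xi>) ^ k\<bar> \<le> 1 * (1 + norm x) ^ k" for x
    unfolding power_abs using power_mono[OF abs_inner_unit_le] by simp
qed measurable

lemma trig_transform_powr_integrable:
  assumes "q \<ge> 0"
  shows "integrable lborel (\<lambda>x. trig_transform \<phi> 0 x * \<bar>x \<bullet> \<xi>\<bar> powr q)"
proof -
  obtain N :: nat where N: "q \<le> real N" using real_arch_simple by blast
  show ?thesis
  proof (rule trig_transform_times_integrable[OF \<phi>, where B=1 and N=N])
    fix x :: 'a
    have p: "1 \<le> 1 + norm x" by simp
    have "\<bar>x \<bullet> \<xi>\<bar> powr q \<le> (1 + norm x) powr q"
      by (rule powr_mono2[OF assms abs_ge_zero abs_inner_unit_le])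
    also have "\<dots> \<le> (1 + norm x) powr real N" by (rule powr_mono[OF N p])
    also have "\<dots> = (1 + norm x) ^ N"
      by (rule powr_realpow) (simp add: add_pos_nonneg)
    finally show "\<bar>\<bar>x \<bullet> \<xi>\<bar> powr q\<bar> \<le> 1 * (1 + norm x) ^ N" by simp
  qed measurable
qed

lemma fourier_inversion_on_line:
  "(\<integral>x. trig_transform \<phi> 0 x * cos (s * (x \<bullet> \<xi>)) \<partial>lborel) = (gauss_mass TYPE('a))\<^sup>2 / 2 * (\<phi> (s *\<^sub>R \<xi>) + \<phi> (- (s *\<^sub>R \<xi>)))"
  using fourier_inversion[OF \<phi>, of "s *\<^sub>R \<xi>"] by simp

lemma trig_transform_cos_rem_integrable: "integrable lborel (\<lambda>x. trig_transform \<phi> 0 x * cos_rem k (s * (x \<bullet> \<xi>)))"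
proof (rule trig_transform_times_integrable[OF \<phi>, where B="s ^ (2 * Suc k)" and N="2 * Suc k"])
  fix x :: 'a
  have "\<bar>cos_rem k (s * (x \<bullet> \<xi>))\<bar> \<le> (s * (x \<bullet> \<xi>)) ^ (2 * Suc k) / fact (2 * Suc k)" by (rule cos_rem_bound)
  also have "\<dots> \<le> (s * (x \<bullet> \<xi>)) ^ (2 * Suc k)"
    by (rule divide_fact_le, rule zero_le_even_power) simp
  also have "\<dots> = s ^ (2 * Suc k) * \<bar>x \<bullet> \<xi>\<bar> ^ (2 * Suc k)"
    by (simp only: power_mult_distrib power_even_abs dvd_triv_left)
  also have "\<dots> \<le> s ^ (2 * Suc k) * (1 + norm x) ^ (2 * Suc k)"
    by (intro mult_left_mono power_mono abs_inner_unit_le zero_le_even_power) auto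
  finally show "\<bar>cos_rem k (s * (x \<bullet> \<xi>))\<bar> \<le> s ^ (2 * Suc k) * (1 + norm x) ^ (2 * Suc k)" .
qed measurable

lemma integral_cos_expansion:
  "(\<integral>x. trig_transform \<phi> 0 x * cos (s * (x \<bullet> \<xi>)) \<partial>lborel) =
     (\<integral>x. trig_transform \<phi> 0 x * cos_rem k (s * (x \<bullet> \<xi>)) \<partial>lborel) +
     (\<Sum>j\<le>k. ((-1) ^ j * s ^ (2 * j) / fact (2 * j)) * (\<integral>x. trig_transform \<phi> 0 x * (x \<bullet> \<xi>) ^ (2 * j) \<partial>lborel))"
proof -
  have "trig_transform \<phi> 0 x * cos (s * (x \<bullet> \<xi>)) = trig_transform \<phi> 0 x * cos_rem k (s * (x \<bullet> \<xi>)) +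
      (\<Sum>j\<le>k. ((-1) ^ j * s ^ (2 * j) / fact (2 * j)) * (trig_transform \<phi> 0 x * (x \<bullet> \<xi>) ^ (2 * j)))" for x
  proof -
    have "(\<Sum>j\<le>k. ((-1) ^ j * s ^ (2 * j) / fact (2 * j)) * (trig_transform \<phi> 0 x * (x \<bullet> \<xi>) ^ (2 * j)))
      = trig_transform \<phi> 0 x * (\<Sum>j\<le>k. (-1) ^ j * (s * (x \<bullet> \<xi>)) ^ (2 * j) / fact (2 * j))"
      unfolding sum_distrib_left power_mult_distrib by (rule sum.cong) auto
    then show ?thesis by (simp add: cos_rem_def right_diff_distrib)
  qed
  then show ?thesis using trig_transform_cos_rem_integrable trig_transform_power_integrable by simp
qed

text \<open>Assume that the lower even moments vanish. For 0 < s < \<delta> inversion at s \<xi>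
  gives 0, so s^(2k) M / (2k)! is, up to sign, the integral of the remainder, which is O(s^(2k+2)).
  Divide by s^(2k) and let s tend to 0.\<close>

lemma even_moment_eq_0: "(\<integral>x. trig_transform \<phi> 0 x * (x \<bullet> \<xi>) ^ (2 * k) \<partial>lborel) = 0"
proof (induction k rule: less_induct)
  case (less k)
  define M where "M = (\<integral>x. trig_transform \<phi> 0 x * (x \<bullet> \<xi>) ^ (2 * k) \<partial>lborel)"
  define B where "B = (\<integral>x. \<bar>trig_transform \<phi> 0 x * (x \<bullet> \<xi>) ^ (2 * Suc k)\<bar> \<partial>lborel)"
  have "\<bar>M\<bar> \<le> fact (2 * k) * B * s\<^sup>2" if s: "0 < s" "s < \<delta>" for s
  proof -
    let ?c = "\<lambda>j. (-1) ^ j * s ^ (2 * j) / fact (2 * j)"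
    let ?R = "\<integral>x. trig_transform \<phi> 0 x * cos_rem k (s * (x \<bullet> \<xi>)) \<partial>lborel"
    have "(\<integral>x. trig_transform \<phi> 0 x * cos (s * (x \<bullet> \<xi>)) \<partial>lborel) = 0"
      unfolding fourier_inversion_on_line using s \<xi> by (simp add: \<delta>)
    moreover have "(\<Sum>j\<le>k. ?c j * (\<integral>x. trig_transform \<phi> 0 x * (x \<bullet> \<xi>) ^ (2 * j) \<partial>lborel)) = ?c k * M"
    proof -
      have "(\<Sum>j<k. ?c j * (\<integral>x. trig_transform \<phi> 0 x * (x \<bullet> \<xi>) ^ (2 * j) \<partial>lborel)) = 0"
        by (rule sum.neutral) (use less in auto)
      then show ?thesis unfolding lessThan_Suc_atMost[symmetric] sum.lessThan_Suc M_def by simp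
    qed
    ultimately have "?c k * M = - ?R" using integral_cos_expansion[of s k] by simp
    then have "\<bar>?c k\<bar> * \<bar>M\<bar> = \<bar>?R\<bar>" by (simp only: abs_mult[symmetric] abs_minus_cancel)
    moreover have "\<bar>?c k\<bar> = s ^ (2 * k) / fact (2 * k)" using s by (simp add: abs_mult)
    moreover have "\<bar>?R\<bar> \<le> s ^ (2 * Suc k) * B"
    proof -
      have "\<bar>?R\<bar> \<le> (\<integral>x. norm (trig_transform \<phi> 0 x * cos_rem k (s * (x \<bullet> \<xi>))) \<partial>lborel)"
        unfolding real_norm_def[symmetric] by (rule integral_norm_bound)
      also have "\<dots> \<le> (\<integral>x. s ^ (2 * Suc k) * \<bar>trig_transform \<phi> 0 x * (x \<bullet> \<xi>) ^ (2 * Suc k)\<bar> \<partial>lborel)"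
      proof (rule integral_mono)
        show "integrable lborel (\<lambda>x. norm (trig_transform \<phi> 0 x * cos_rem k (s * (x \<bullet> \<xi>))))"
          by (rule integrable_norm[OF trig_transform_cos_rem_integrable])
        show "integrable lborel (\<lambda>x. s ^ (2 * Suc k) * \<bar>trig_transform \<phi> 0 x * (x \<bullet> \<xi>) ^ (2 * Suc k)\<bar>)"
          by (rule integrable_mult_right[OF integrable_abs[OF trig_transform_power_integrable]])
        fix x :: 'a
        have e: "0 \<le> (x \<bullet> \<xi>) ^ (2 * Suc k)" "0 \<le> (s * (x \<bullet> \<xi>)) ^ (2 * Suc k)" by (rule zero_le_even_power, simp)+
        have "\<bar>cos_rem k (s * (x \<bullet> \<xi>))\<bar> \<le> (s * (x \<bullet> \<xi>)) ^ (2 * Suc k) / fact (2 * Suc k)" by (rule cos_rem_bound)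
        also have "\<dots> \<le> (s * (x \<bullet> \<xi>)) ^ (2 * Suc k)"
          by (rule divide_fact_le[OF e(2)])
        also have "\<dots> = s ^ (2 * Suc k) * \<bar>(x \<bullet> \<xi>) ^ (2 * Suc k)\<bar>"
          unfolding power_mult_distrib abs_of_nonneg[OF e(1)] ..
        finally have "\<bar>trig_transform \<phi> 0 x\<bar> * \<bar>cos_rem k (s * (x \<bullet> \<xi>))\<bar> \<le>
          \<bar>trig_transform \<phi> 0 x\<bar> * (s ^ (2 * Suc k) * \<bar>(x \<bullet> \<xi>) ^ (2 * Suc k)\<bar>)"
          by (rule mult_left_mono) simp
        then show "norm (trig_transform \<phi> 0 x * cos_rem k (s * (x \<bullet> \<xi>))) \<le>
           s ^ (2 * Suc k) * \<bar>trig_transform \<phi> 0 x * (x \<bullet> \<xi>) ^ (2 * Suc k)\<bar>"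
          unfolding abs_mult real_norm_def by (simp only: mult.left_commute)
      qed
      also have "\<dots> = s ^ (2 * Suc k) * B" by (simp add: B_def)
      finally show ?thesis .
    qed
    ultimately have "s ^ (2 * k) / fact (2 * k) * \<bar>M\<bar> \<le> s ^ (2 * k) * (s\<^sup>2 * B)"
      by (simp add: power2_eq_square mult_ac)
    then have "s ^ (2 * k) * (\<bar>M\<bar> / fact (2 * k)) \<le> s ^ (2 * k) * (s\<^sup>2 * B)" by simp
    then have "\<bar>M\<bar> / fact (2 * k) \<le> s\<^sup>2 * B" using s by (simp only: mult_le_cancel_left_pos zero_less_power)
    then show ?thesis by (simp add: pos_divide_le_eq mult_ac)
  qed
  from nonpos_if_le_square[OF \<delta>(1) this] show ?case by (simp add: M_def)
qed

text \<open>The subtracted polynomial contributes only even moments, which vanish, so the remainder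
  inverts exactly as the cosine does.\<close>

lemma cos_rem_inversion:
  "(\<integral>x. trig_transform \<phi> 0 x * cos_rem k (s * (x \<bullet> \<xi>)) \<partial>lborel) =
    (gauss_mass TYPE('a))\<^sup>2 / 2 * (\<phi> (s *\<^sub>R \<xi>) + \<phi> (- (s *\<^sub>R \<xi>)))"
  using integral_cos_expansion[of s k] unfolding fourier_inversion_on_line even_moment_eq_0 by simp

text \<open>A double integral of the transform against s^(-q-1)
  \<open>cos_rem m (s * (x \<bullet> \<xi>))\<close> in two orders: over s first it yields |x
  \<bullet> \<xi>|^q, over x first it yields the values of \<phi> on the line through \<xi>.\<close>

lemma homogeneous_moment:
  assumes qm: "2 * real m < q" "q < 2 * real m + 2"
  shows "(-1) ^ Suc m * cos_rem_const m q * (\<integral>x. trig_transform \<phi> 0 x * \<bar>x \<bullet> \<xi>\<bar> powr q \<partial>lborel) =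
    (gauss_mass TYPE('a))\<^sup>2 / 2 *
      (\<integral>s. indicator {0<..} s * s powr (- q - 1) * (\<phi> (s *\<^sub>R \<xi>) + \<phi> (- (s *\<^sub>R \<xi>))) \<partial>lborel)"
proof -
  note [measurable] = trig_transform_measurable[OF \<phi>]
  let ?\<kappa> = "cos_rem_const m q"
  let ?g = "\<lambda>t s. indicator {0<..} s * s powr (- q - 1) * \<bar>cos_rem m (s * t)\<bar>"
  let ?h = "\<lambda>t s. indicator {0<..} s * s powr (- q - 1) * cos_rem m (s * t)"
  note g = cos_rem_scaled[OF qm]
  have q: "q \<ge> 0" using qm(1) by (rule order_trans[OF _ less_imp_le, rotated]) simp
  have hg: "?h t s = (-1) ^ Suc m * ?g t s" for t s
  proof -
    have "e * e = 1 \<Longrightarrow> A * c = e * (A * (e * c))" for e A c :: real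
      by (metis mult.assoc mult.left_commute mult_1_right)
    moreover have "(-1::real) ^ Suc m * (-1) ^ Suc m = 1"
      unfolding power_mult_distrib[symmetric] by simp
    ultimately show ?thesis unfolding cos_rem_abs_eq by blast
  qed

  have hn: "norm (?h t s) = ?g t s" for t s
    by (simp add: abs_mult)
  have hi: "integrable lborel (?h t)" for t
    unfolding hg by (intro integrable_mult_right g(1))
  have hI: "(\<integral>s. ?h t s \<partial>lborel) = (-1) ^ Suc m * (?\<kappa> * \<bar>t\<bar> powr q)" for t
    unfolding hg integral_mult_right_zero g(2) ..
  have "(\<integral>s. (\<integral>x. trig_transform \<phi> 0 x * ?h (x \<bullet> \<xi>) s \<partial>lborel) \<partial>lborel) =
     (\<integral>x. (\<integral>s. trig_transform \<phi> 0 x * ?h (x \<bullet> \<xi>) s \<partial>lborel) \<partial>lborel)"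
  proof (rule lborel_pair.Fubini_integral, rule lborel_pair.Fubini_integrable)
    show "(\<lambda>(x, s). trig_transform \<phi> 0 x * ?h (x \<bullet> \<xi>) s) \<in> borel_measurable (lborel \<Otimes>\<^sub>M lborel)"
      by measurable
    \<comment> \<open>The absolute integral over s is known exactly from
      \<open>cos_rem_scaled\<close>, and the decay of the transform absorbs its growth |x \<bullet>
      \<xi>|^q; this justifies Fubini.\<close>
    have "(\<integral>s. norm (trig_transform \<phi> 0 x * ?h (x \<bullet> \<xi>) s) \<partial>lborel) = ?\<kappa> * \<bar>trig_transform \<phi> 0 x * \<bar>x \<bullet> \<xi>\<bar> powr q\<bar>" for x
      unfolding norm_mult[of "trig_transform \<phi> 0 x"] hn integral_mult_right_zero g(2)
      by (simp add: abs_mult)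
    moreover have "integrable lborel (\<lambda>x. ?\<kappa> * \<bar>trig_transform \<phi> 0 x * \<bar>x \<bullet> \<xi>\<bar> powr q\<bar>)"
      by (intro integrable_mult_right integrable_abs trig_transform_powr_integrable q)
    ultimately show "integrable lborel (\<lambda>x. \<integral>s. norm (case (x, s) of (x, s) \<Rightarrow> trig_transform \<phi> 0 x * ?h (x \<bullet> \<xi>) s) \<partial>lborel)"
      unfolding prod.case by (simp only:)
    show "AE x in lborel. integrable lborel (\<lambda>s. case (x, s) of (x, s) \<Rightarrow> trig_transform \<phi> 0 x * ?h (x \<bullet> \<xi>) s)"
      unfolding prod.case by (intro AE_I2 integrable_mult_right hi)
  qed
  also have "(\<lambda>x. \<integral>s. trig_transform \<phi> 0 x * ?h (x \<bullet> \<xi>) s \<partial>lborel) =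
     (\<lambda>x. ((-1) ^ Suc m * ?\<kappa>) * (trig_transform \<phi> 0 x * \<bar>x \<bullet> \<xi>\<bar> powr q))"
    unfolding integral_mult_right_zero hI by (rule ext) (simp only: mult_ac)
  also have "(\<lambda>s. \<integral>x. trig_transform \<phi> 0 x * ?h (x \<bullet> \<xi>) s \<partial>lborel) =
     (\<lambda>s. (gauss_mass TYPE('a))\<^sup>2 / 2 * (indicator {0<..} s * s powr (- q - 1) * (\<phi> (s *\<^sub>R \<xi>) + \<phi> (- (s *\<^sub>R \<xi>)))))"
  proof
    fix s
    have eq: "(\<lambda>x. trig_transform \<phi> 0 x * ?h (x \<bullet> \<xi>) s) =
        (\<lambda>x. (indicator {0<..} s * s powr (- q - 1)) * (trig_transform \<phi> 0 x * cos_rem m (s * (x \<bullet> \<xi>))))"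
      by (rule ext) (simp only: mult_ac)
    show "(\<integral>x. trig_transform \<phi> 0 x * ?h (x \<bullet> \<xi>) s \<partial>lborel) =
      (gauss_mass TYPE('a))\<^sup>2 / 2 * (indicator {0<..} s * s powr (- q - 1) * (\<phi> (s *\<^sub>R \<xi>) + \<phi> (- (s *\<^sub>R \<xi>))))"
      unfolding eq integral_mult_right_zero cos_rem_inversion by (simp only: mult_ac)
  qed
  finally show ?thesis by (simp only: integral_mult_right_zero)
qed

end

section \<open>Integrals over the sphere\<close>

lemma normalize_in_sphere: "x \<noteq> 0 \<Longrightarrow> x /\<^sub>R norm x \<in> sphere (0::'a::euclidean_space) 1"
  by simp

lemma sphere_integral_cong:
  fixes f g :: "'a::euclidean_space \<Rightarrow> real"
  assumes "\<And>x. x \<in> sphere 0 1 \<Longrightarrow> f x = g x"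
  shows "sphere_integral f = sphere_integral g"
proof -
  have "indicator (ball 0 1 - {0}) x * f (x /\<^sub>R norm x) = indicator (ball 0 1 - {0}) x * g (x /\<^sub>R norm x)" for x :: 'a
    using assms[OF normalize_in_sphere[of x]] by (cases "x = 0") auto
  then show ?thesis unfolding sphere_integral_def by (simp only:)
qed

lemma sphere_integral_cmult: "sphere_integral (\<lambda>x. c * f x) = c * sphere_integral f"
proof -
  have "indicator (ball 0 1 - {0}) x * (c * f (x /\<^sub>R norm x)) = c * (indicator (ball 0 1 - {0}) x * f (x /\<^sub>R norm x))" for x
    by (simp only: mult_ac)
  then show ?thesis unfolding sphere_integral_def by (simp only: integral_mult_right_zero mult.left_commute)
qed

lemma sphere_integral_nonneg:
  fixes f :: "'a::euclidean_space \<Rightarrow> real"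
  assumes "\<And>x. x \<in> sphere 0 1 \<Longrightarrow> 0 \<le> f x"
  shows "0 \<le> sphere_integral f"
proof -
  have "0 \<le> indicator (ball 0 1 - {0}) x * f (x /\<^sub>R norm x)" for x :: 'a
    using assms[OF normalize_in_sphere[of x]] by (cases "x = 0") auto
  then show ?thesis unfolding sphere_integral_def by simp
qed

text \<open>A common class for the smooth functions on the sphere and the kernel |x \<bullet>
  \<xi>|^q, which need not be smooth. The indicator discards the origin, where
  \<open>x /\<^sub>R norm x\<close> leaves the sphere.\<close>

definition bounded_cone :: "('a::euclidean_space \<Rightarrow> real) \<Rightarrow> bool" where
  "bounded_cone k \<longleftrightarrow> (\<lambda>x. indicator (-{0}) x * k (x /\<^sub>R norm x)) \<in> borel_measurable borel \<and>
     (\<exists>C. \<forall>x\<in>sphere 0 1. \<bar>k x\<bar> \<le> C)"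

lemma Ce_inf_continuous: "h \<in> Ce_inf \<Longrightarrow> continuous_on (-{0}) (\<lambda>x. h (x /\<^sub>R norm x))"
  by (simp add: Ce_inf_def smooth_on_imp_continuous_on)

lemma Ce_inf_bounded_cone:
  fixes h :: "'a::euclidean_space \<Rightarrow> real"
  assumes "h \<in> Ce_inf"
  shows "bounded_cone h"
proof -
  note c = Ce_inf_continuous[OF assms]
  have "(\<lambda>x. indicator (-{0}) x *\<^sub>R h (x /\<^sub>R norm x)) \<in> borel_measurable borel"
    by (rule borel_measurable_continuous_on_indicator[OF _ c]) simp
  moreover have "\<exists>C. \<forall>x\<in>sphere 0 1. \<bar>h x\<bar> \<le> C"
  proof -
    have "continuous_on (sphere 0 1) (\<lambda>x. h (x /\<^sub>R norm x))"
      by (rule continuous_on_subset[OF c]) auto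
    then have "continuous_on (sphere 0 1) h"
      by (rule continuous_on_cong[THEN iffD1, rotated 2]) auto
    then have "compact (h ` sphere 0 1)" by (intro compact_continuous_image) auto
    from compact_imp_bounded[OF this, unfolded bounded_iff]
    obtain C where "\<forall>z\<in>h ` sphere 0 1. norm z \<le> C" ..
    then show ?thesis by (intro exI[of _ C]) auto
  qed
  ultimately show ?thesis by (simp add: bounded_cone_def)
qed

lemma bounded_cone_ball_integrable:
  fixes k :: "'a::euclidean_space \<Rightarrow> real"
  assumes "bounded_cone k"
  shows "integrable lborel (\<lambda>x. indicator (ball 0 1 - {0}) x * k (x /\<^sub>R norm x))"
proof -
  obtain C where C: "\<And>x. x \<in> sphere 0 1 \<Longrightarrow> \<bar>k x\<bar> \<le> C"
    and [measurable]: "(\<lambda>x. indicator (-{0}) x * k (x /\<^sub>R norm x)) \<in> borel_measurable borel"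
    using assms unfolding bounded_cone_def by blast
  have eq: "indicator (ball 0 1 - {0}) x * k (x /\<^sub>R norm x) = (if norm x < 1 then indicator (-{0}) x * k (x /\<^sub>R norm x) else 0)" for x
    by (auto simp: indicator_def)
  show ?thesis
  proof (rule Bochner_Integration.integrable_bound)
    show "integrable lborel (\<lambda>x::'a. C * indicator (ball 0 1) x)"
      using emeasure_bounded_finite[of "ball (0::'a) 1"]
      by (intro integrable_mult_right integrable_real_indicator) auto
    show "AE x in lborel. norm (indicator (ball 0 1 - {0}) x * k (x /\<^sub>R norm x)) \<le> norm (C * indicator (ball 0 1) x)"
    proof (rule AE_I2)
      fix x :: 'a
      show "norm (indicator (ball 0 1 - {0}) x * k (x /\<^sub>R norm x)) \<le> norm (C * indicator (ball 0 1) x)"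
        using C[OF normalize_in_sphere[of x]] by (cases "x = 0") (auto simp: indicator_def)
    qed
    show "(\<lambda>x. indicator (ball 0 1 - {0}) x * k (x /\<^sub>R norm x)) \<in> borel_measurable lborel"
      unfolding eq measurable_lborel1 by measurable
  qed
qed

lemma bounded_cone_inner_powr:
  fixes \<xi> :: "'a::euclidean_space"
  assumes "q \<ge> 0"
  shows "bounded_cone (\<lambda>x. \<bar>x \<bullet> \<xi>\<bar> powr q)"
  unfolding bounded_cone_def
proof
  show "(\<lambda>x::'a. indicator (-{0}) x * \<bar>(x /\<^sub>R norm x) \<bullet> \<xi>\<bar> powr q) \<in> borel_measurable borel"
    by measurable
  have "\<bar>\<bar>x \<bullet> \<xi>\<bar> powr q\<bar> \<le> norm \<xi> powr q" if "x \<in> sphere 0 1" for x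
  proof -
    have "\<bar>x \<bullet> \<xi>\<bar> \<le> norm \<xi>" using Cauchy_Schwarz_ineq2[of x \<xi>] that by simp
    from powr_mono2[OF assms abs_ge_zero this] show ?thesis by simp
  qed
  then show "\<exists>C. \<forall>x\<in>sphere 0 1. \<bar>\<bar>x \<bullet> \<xi>\<bar> powr q\<bar> \<le> C" by blast
qed

lemma hom_ext_bound:
  fixes k :: "'a::euclidean_space \<Rightarrow> real"
  assumes k: "bounded_cone k" and q: "q > 0"
  shows "hom_ext k q \<in> borel_measurable borel" "\<exists>B N. \<forall>x. \<bar>hom_ext k q x\<bar> \<le> B * (1 + norm x) ^ N"
proof -
  obtain C where C: "\<And>x. x \<in> sphere 0 1 \<Longrightarrow> \<bar>k x\<bar> \<le> C"
    and [measurable]: "(\<lambda>x. indicator (-{0}) x * k (x /\<^sub>R norm x)) \<in> borel_measurable borel"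
    using k unfolding bounded_cone_def by blast
  have "hom_ext k q = (\<lambda>x. norm x powr q * (indicator (-{0}) x * k (x /\<^sub>R norm x)))"
    by (auto simp: hom_ext_def indicator_def fun_eq_iff)
  then show "hom_ext k q \<in> borel_measurable borel" by simp
  obtain N :: nat where N: "q \<le> real N" using real_arch_simple by blast
  have "\<bar>hom_ext k q x\<bar> \<le> max C 0 * (1 + norm x) ^ N" for x
  proof (cases "x = 0")
    case False
    have "norm x powr q \<le> (1 + norm x) powr q"
      using q by (intro powr_mono2) auto
    also have "\<dots> \<le> (1 + norm x) powr real N"
      by (rule powr_mono[OF N]) simp
    also have "\<dots> = (1 + norm x) ^ N"
      by (rule powr_realpow) (simp add: add_pos_nonneg)
    finally have "norm x powr q \<le> (1 + norm x) ^ N" .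
    moreover have "\<bar>k (x /\<^sub>R norm x)\<bar> \<le> max C 0" using C[OF normalize_in_sphere[OF False]] by linarith
    ultimately have "norm x powr q * \<bar>k (x /\<^sub>R norm x)\<bar> \<le> (1 + norm x) ^ N * max C 0"
      by (intro mult_mono) auto
    then show ?thesis by (simp add: hom_ext_def abs_mult mult.commute)
  qed (simp add: hom_ext_def)
  then show "\<exists>B N. \<forall>x. \<bar>hom_ext k q x\<bar> \<le> B * (1 + norm x) ^ N" by blast
qed

lemma hom_ext_trig_integrable:
  assumes "bounded_cone k" "q > 0" "compact_smooth \<phi>"
  shows "integrable lborel (\<lambda>x. trig_transform \<phi> \<alpha> x * hom_ext k q x)"
proof -
  obtain B N where "\<And>x. \<bar>hom_ext k q x\<bar> \<le> B * (1 + norm x) ^ N"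
    using hom_ext_bound(2)[OF assms(1,2)] by blast
  from trig_transform_times_integrable[OF assms(3) hom_ext_bound(1)[OF assms(1,2)] this]
  show ?thesis .
qed

text \<open>The exponent of the radial moment collects r^q from the homogeneous extension and
  r^(n-1) from the Jacobian.\<close>

lemma polar_pairing:
  fixes k :: "'a::euclidean_space \<Rightarrow> real"
  assumes k: "bounded_cone k" and q: "q > 0" and \<phi>: "compact_smooth \<phi>"
  shows "(\<integral>x. trig_transform \<phi> 0 x * hom_ext k q x \<partial>lborel) =
    sphere_integral (\<lambda>x. k x * radial_moment (q + real (DIM('a) - 1)) \<phi> 0 x)"
  unfolding polar_integral[OF hom_ext_trig_integrable[OF assms]]
proof (rule sphere_integral_cong)
  fix x :: 'a assume x: "x \<in> sphere 0 1"
  have "indicator {0<..} r * r ^ (DIM('a) - 1) * (trig_transform \<phi> 0 (r *\<^sub>R x) * hom_ext k q (r *\<^sub>R x)) =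
    k x * (indicator {0<..} r * r powr (q + real (DIM('a) - 1)) * trig_transform \<phi> 0 (r *\<^sub>R x))" for r
  proof (cases "r > 0")
    case True
    have "hom_ext k q (r *\<^sub>R x) = r powr q * k x"
      using True x by (simp add: hom_ext_def)
    moreover have "r powr (q + real (DIM('a) - 1)) = r powr q * r ^ (DIM('a) - 1)"
      unfolding powr_add powr_realpow[OF True] ..
    ultimately show ?thesis by (simp only: mult_ac)
  qed simp
  then show "(\<integral>r. indicator {0<..} r * r ^ (DIM('a) - 1) * (trig_transform \<phi> 0 (r *\<^sub>R x) * hom_ext k q (r *\<^sub>R x)) \<partial>lborel) =
    k x * radial_moment (q + real (DIM('a) - 1)) \<phi> 0 x"
    unfolding radial_moment_def by (simp only: integral_mult_right_zero)
qed

text \<open>Fubini for a symmetric kernel that is bounded by 1 on the sphere.\<close>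

lemma cosine_transform_self_adjoint:
  fixes f g :: "'a::euclidean_space \<Rightarrow> real"
  assumes f: "bounded_cone f" and g: "bounded_cone g" and q: "q \<ge> 0"
  shows "sphere_integral (\<lambda>x. f x * cosine_transform q g x) = sphere_integral (\<lambda>x. g x * cosine_transform q f x)"
proof -
  let ?P = "\<lambda>f x::'a. indicator (ball 0 1 - {0}) x * f (x /\<^sub>R norm x) :: real"
  let ?k = "\<lambda>x y::'a. \<bar>(x /\<^sub>R norm x) \<bullet> (y /\<^sub>R norm y)\<bar> powr q"
  have I: "integrable lborel (?P f)" "integrable lborel (?P g)"
    by (rule bounded_cone_ball_integrable[OF f], rule bounded_cone_ball_integrable[OF g])
  have [measurable]: "?P f \<in> borel_measurable borel" "?P g \<in> borel_measurable borel" using I by auto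
  have SI: "sphere_integral (\<lambda>x. f x * cosine_transform q g x) =
      real DIM('a) * (real DIM('a) * (\<integral>x. (\<integral>y. ?P f x * ?P g y * ?k x y \<partial>lborel) \<partial>lborel))" for f g :: "'a \<Rightarrow> real"
  proof -
    have "?P (\<lambda>x. f x * cosine_transform q g x) x = real DIM('a) * (\<integral>y. ?P f x * ?P g y * ?k x y \<partial>lborel)" for x
    proof -
      have "(\<integral>y. ?P f x * ?P g y * ?k x y \<partial>lborel) = (\<integral>y. ?P f x * (indicator (ball 0 1 - {0}) y * (\<bar>(y /\<^sub>R norm y) \<bullet> (x /\<^sub>R norm x)\<bar> powr q * g (y /\<^sub>R norm y))) \<partial>lborel)"
        by (intro Bochner_Integration.integral_cong refl) (simp only: inner_commute mult_ac)
      also have "\<dots> = ?P f x * (\<integral>y. indicator (ball 0 1 - {0}) y * (\<bar>(y /\<^sub>R norm y) \<bullet> (x /\<^sub>R norm x)\<bar> powr q * g (y /\<^sub>R norm y)) \<partial>lborel)"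
        by (rule integral_mult_right_zero)
      finally show ?thesis unfolding cosine_transform_def sphere_integral_def by (simp only: mult_ac)
    qed
    then show ?thesis unfolding sphere_integral_def[of "\<lambda>x. f x * cosine_transform q g x"] by simp
  qed
  have "(\<integral>x. (\<integral>y. ?P f x * ?P g y * ?k x y \<partial>lborel) \<partial>lborel) = (\<integral>y. (\<integral>x. ?P f x * ?P g y * ?k x y \<partial>lborel) \<partial>lborel)"
  proof (rule lborel_pair.Fubini_integral[symmetric])
    show "integrable (lborel \<Otimes>\<^sub>M lborel) (\<lambda>(x, y). ?P f x * ?P g y * ?k x y)"
    proof (rule Bochner_Integration.integrable_bound[OF integrable_lborel_product[OF I]])
      show "AE p in lborel \<Otimes>\<^sub>M lborel. norm (case p of (x, y) \<Rightarrow> ?P f x * ?P g y * ?k x y) \<le> norm (case p of (x, y) \<Rightarrow> ?P f x * ?P g y)"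
      proof (intro AE_I2, clarify)
        fix x y :: 'a
        \<comment> \<open>At z = 0 the quotient is 0, since \<open>inverse 0 = 0\<close>, so the
          bound covers the origin too.\<close>
        have n1: "norm (z /\<^sub>R norm z) \<le> 1" for z :: 'a by (cases "z = 0") auto
        have "\<bar>(x /\<^sub>R norm x) \<bullet> (y /\<^sub>R norm y)\<bar> \<le> norm (x /\<^sub>R norm x) * norm (y /\<^sub>R norm y)"
          by (rule Cauchy_Schwarz_ineq2)
        also have "\<dots> \<le> 1 * 1" by (rule mult_mono[OF n1 n1]) auto
        finally have "?k x y \<le> 1 powr q" using q by (intro powr_mono2) auto
        then have "\<bar>?P f x * ?P g y\<bar> * ?k x y \<le> \<bar>?P f x * ?P g y\<bar> * 1"
          by (intro mult_left_mono) auto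
        then show "norm (?P f x * ?P g y * ?k x y) \<le> norm (?P f x * ?P g y)"
          unfolding norm_mult[of _ "?k x y"] by simp
      qed
    qed measurable
  qed
  also have "\<dots> = (\<integral>y. (\<integral>x. ?P g y * ?P f x * ?k y x \<partial>lborel) \<partial>lborel)"
    by (intro Bochner_Integration.integral_cong refl) (simp only: inner_commute mult_ac)
  finally show ?thesis unfolding SI by (simp only:)
qed

section \<open>The sign of the Gamma function on the negative axis\<close>

text \<open>The equation Gamma(1 - x) = - x Gamma(-x) flips the sign at each unit step, starting
  from Gamma > 0 on (0,1).\<close>

lemma Gamma_sign:
  fixes x :: real
  shows "real m - 1 < x \<Longrightarrow> x < real m \<Longrightarrow> 0 < (-1) ^ m * Gamma (- x)"
proof (induction m arbitrary: x)
  case 0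
  then show ?case by (simp add: Gamma_real_pos)
next
  case (Suc m)
  have "- x \<notin> \<int>\<^sub>\<le>\<^sub>0"
  proof
    assume "- x \<in> \<int>\<^sub>\<le>\<^sub>0"
    then obtain n where "- x = - real n" by (auto elim!: nonpos_Ints_cases')
    then show False using Suc.prems by simp
  qed
  then have "Gamma (- x + 1) = - x * Gamma (- x)" by (rule Gamma_plus1)
  moreover have "0 < (-1) ^ m * Gamma (- (x - 1))"
    by (rule Suc.IH) (use Suc.prems in auto)
  moreover have "- (x - 1) = - x + 1" by simp
  ultimately have "0 < x * ((-1) ^ Suc m * Gamma (- x))" by (simp add: mult_ac)
  moreover have "0 < x" using Suc.prems by simp
  ultimately show ?case by (simp only: zero_less_mult_pos)
qed

section \<open>The cosine transform of a radial moment\<close>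

text \<open>The function F_\<phi> of the overview; the exponent adds the n - 1 of the Jacobian to
  q.\<close>

definition spherical_transform :: "real \<Rightarrow> ('a::euclidean_space \<Rightarrow> real) \<Rightarrow> 'a \<Rightarrow> real" where
  "spherical_transform q \<phi> x = inverse (Gamma (- q / 2)) * radial_moment (q + real (DIM('a) - 1)) \<phi> 0 x"

lemma spherical_transform_in_Ce_inf:
  "compact_smooth \<phi> \<Longrightarrow> q > 0 \<Longrightarrow> spherical_transform q \<phi> \<in> Ce_inf"
  unfolding spherical_transform_def[abs_def] by (rule radial_moment_in_Ce_inf) auto

lemma spherical_transform_pairing:
  assumes "bounded_cone k" "q > 0" "compact_smooth \<phi>"
  shows "sphere_integral (\<lambda>x. spherical_transform q \<phi> x * k x) =
    inverse (Gamma (- q / 2)) * (\<integral>x. trig_transform \<phi> 0 x * hom_ext k q x \<partial>lborel)"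
  unfolding polar_pairing[OF assms] spherical_transform_def sphere_integral_cmult[symmetric]
  by (simp only: mult_ac)

text \<open>The kernel |x \<bullet> \<xi>|^q is its own homogeneous extension, so the polar pairing
  reduces the cosine transform to \<open>homogeneous_moment\<close>. The constant is chosen before
  \<phi> and \<xi>; it is positive because Gamma(-q/2) has the sign (-1)^(m+1) of the
  remainder.\<close>

lemma cosine_transform_spherical_transform:
  fixes q :: real
  assumes q: "q > 0" "\<forall>k::nat. k \<ge> 1 \<longrightarrow> q \<noteq> 2 * real k"
  shows "\<exists>c>0. \<forall>(\<phi> :: 'a::euclidean_space \<Rightarrow> real) \<xi> \<delta>. compact_smooth \<phi> \<longrightarrow> \<delta> > 0 \<longrightarrow> (\<forall>x. norm x < \<delta> \<longrightarrow> \<phi> x = 0) \<longrightarrow> norm \<xi> = 1 \<longrightarrow>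
     cosine_transform q (spherical_transform q \<phi>) \<xi> =
     c * (\<integral>s. indicator {0<..} s * s powr (- q - 1) * (\<phi> (s *\<^sub>R \<xi>) + \<phi> (- (s *\<^sub>R \<xi>))) \<partial>lborel)"
proof -
  \<comment> \<open>Gives 2m \<le> q < 2m + 2. Equality q = 2m is excluded by q > 0 when m = 0 and
    by the second hypothesis when m \<ge> 1.\<close>
  define m where "m = nat \<lfloor>q / 2\<rfloor>"
  have m0: "real m = of_int \<lfloor>q / 2\<rfloor>" using q by (simp add: m_def)
  have "2 * real m \<le> q" "q < 2 * real m + 2"
    unfolding m0 using floor_correct[of "q / 2"] by linarith+
  moreover have "2 * real m \<noteq> q"
  proof (cases "m = 0")
    case False
    then have "m \<ge> 1" by simp
    with q(2) show ?thesis by metis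
  qed (use q in simp)
  ultimately have qm: "2 * real m < q" "q < 2 * real m + 2" by auto
  let ?\<kappa> = "cos_rem_const m q" and ?G = "Gamma (- q / 2)" and ?g = "(gauss_mass TYPE('a))\<^sup>2 / 2"
  let ?d = "(-1) ^ Suc m * ?\<kappa>"
  have \<kappa>: "?\<kappa> > 0" by (rule cos_rem_const_pos[OF qm])
  have G: "0 < (-1) ^ Suc m * ?G"
    using Gamma_sign[of "Suc m" "q / 2"] qm by simp
  have g: "?g > 0" using gauss_mass_pos[where 'a='a] by simp
  have "0 < ?\<kappa> * ((-1) ^ Suc m * ?G)" using \<kappa> G by (rule mult_pos_pos)
  then have dG: "0 < ?d * ?G" by (simp only: mult_ac)
  show ?thesis
  proof (intro exI[of _ "?g / (?d * ?G)"] conjI allI impI)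
    show "0 < ?g / (?d * ?G)" by (rule divide_pos_pos[OF g dG])
    fix \<phi> :: "'a \<Rightarrow> real" and \<xi> :: 'a and \<delta> :: real
    assume \<phi>: "compact_smooth \<phi>" and \<delta>: "\<delta> > 0" "\<forall>x. norm x < \<delta> \<longrightarrow> \<phi> x = 0" and \<xi>: "norm \<xi> = 1"
    let ?S = "\<integral>s. indicator {0<..} s * s powr (- q - 1) * (\<phi> (s *\<^sub>R \<xi>) + \<phi> (- (s *\<^sub>R \<xi>))) \<partial>lborel"
    let ?I = "\<integral>x. trig_transform \<phi> 0 x * \<bar>x \<bullet> \<xi>\<bar> powr q \<partial>lborel"
    have h: "hom_ext (\<lambda>x. \<bar>x \<bullet> \<xi>\<bar> powr q) q x = \<bar>x \<bullet> \<xi>\<bar> powr q" for x :: 'a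
    proof (cases "x = 0")
      case False
      then show ?thesis
        unfolding hom_ext_def powr_mult[symmetric]
        by (simp add: abs_mult) (simp flip: mult.assoc)
    qed (simp add: hom_ext_def)
    have "cosine_transform q (spherical_transform q \<phi>) \<xi> = sphere_integral (\<lambda>x. spherical_transform q \<phi> x * \<bar>x \<bullet> \<xi>\<bar> powr q)"
      unfolding cosine_transform_def by (simp only: mult.commute)
    also have "\<dots> = inverse ?G * ?I"
      using spherical_transform_pairing[OF bounded_cone_inner_powr q(1) \<phi>, of q \<xi>] q by (simp add: h)
    finally have 1: "cosine_transform q (spherical_transform q \<phi>) \<xi> = inverse ?G * ?I" .
    have 2: "?d * ?I = ?g * ?S"
      by (rule homogeneous_moment[OF \<phi> \<xi> \<delta>(1) _ qm]) (use \<delta>(2) in auto)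
    have "a * b = c \<Longrightarrow> 0 < a * e \<Longrightarrow> inverse e * b = c / (a * e)" for a b c e :: real
      by (auto simp: field_simps)
    from this[OF 2 dG] 1
    show "cosine_transform q (spherical_transform q \<phi>) \<xi> = ?g / (?d * ?G) * ?S" by simp
  qed
qed

section \<open>The Fourier transform of the homogeneous extension\<close>

lemma fourier_eq_trig_transform:
  assumes "compact_smooth \<phi>"
  shows "fourier \<phi> x = complex_of_real (trig_transform \<phi> 0 x) + \<i> * complex_of_real (trig_transform \<phi> (pi/2) x)"
proof -
  have "complex_of_real (\<phi> \<xi>) * cis (- (x \<bullet> \<xi>)) =
     complex_of_real (\<phi> \<xi> * cos (x \<bullet> \<xi> + 0)) + \<i> * complex_of_real (\<phi> \<xi> * cos (x \<bullet> \<xi> + pi/2))" for \<xi>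
    by (simp add: complex_eq_iff cos_add)
  then have "fourier \<phi> x = (\<integral>\<xi>. complex_of_real (\<phi> \<xi> * cos (x \<bullet> \<xi> + 0)) + \<i> * complex_of_real (\<phi> \<xi> * cos (x \<bullet> \<xi> + pi/2)) \<partial>lborel)"
    unfolding fourier_def by (simp only:)
  also have "\<dots> = (\<integral>\<xi>. complex_of_real (\<phi> \<xi> * cos (x \<bullet> \<xi> + 0)) \<partial>lborel) + (\<integral>\<xi>. \<i> * complex_of_real (\<phi> \<xi> * cos (x \<bullet> \<xi> + pi/2)) \<partial>lborel)"
    by (rule Bochner_Integration.integral_add)
      (intro integrable_mult_right integrable_of_real trig_transform_integrable[OF assms])+
  finally show ?thesis
    by (simp only: integral_mult_right_zero integral_complex_of_real trig_transform_def)
qed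

lemma integral_odd_eq_0:
  fixes f :: "'a::euclidean_space \<Rightarrow> real"
  assumes [measurable]: "f \<in> borel_measurable borel" and odd: "\<And>x. f (- x) = - f x"
  shows "(\<integral>x. f x \<partial>lborel) = 0"
proof -
  have "(\<integral>x. f x \<partial>lborel) = (\<integral>x. f (- x) \<partial>lborel)"
    by (subst lborel_affine[where c="-1" and t=0]) (simp_all add: density_1 integral_distr)
  also have "\<dots> = - (\<integral>x. f x \<partial>lborel)" by (simp add: odd)
  finally show ?thesis by simp
qed

text \<open>The imaginary part pairs the odd sine transform with the even function
  \<open>hom_ext h q\<close> and vanishes; the real part is the polar pairing.\<close>

lemma fourier_dist_hom_ext:
  fixes h :: "'a::euclidean_space \<Rightarrow> real"
  assumes h: "h \<in> Ce_inf" and q: "q > 0" and \<phi>: "compact_smooth \<phi>"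
  shows "fourier_dist (\<lambda>x. complex_of_real (hom_ext h q x / Gamma (- q / 2))) \<phi> =
    complex_of_real (sphere_integral (\<lambda>x. spherical_transform q \<phi> x * h x))"
proof -
  let ?G = "Gamma (- q / 2)"
  note bc = Ce_inf_bounded_cone[OF h]
  let ?T = "\<lambda>\<alpha> x. trig_transform \<phi> \<alpha> x * hom_ext h q x"
  have I: "integrable lborel (?T \<alpha>)" for \<alpha> by (rule hom_ext_trig_integrable[OF bc q \<phi>])
  have odd: "?T (pi/2) (- x) = - ?T (pi/2) x" for x
  proof -
    have "trig_transform \<phi> (pi/2) (- x) = - trig_transform \<phi> (pi/2) x"
    proof -
      have "\<phi> \<xi> * cos (- x \<bullet> \<xi> + pi/2) = - (\<phi> \<xi> * cos (x \<bullet> \<xi> + pi/2))" for \<xi>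
        by (simp only: cos_add) simp
      then show ?thesis unfolding trig_transform_def by (simp only: integral_minus)
    qed
    moreover have "hom_ext h q (- x) = hom_ext h q x"
    proof (cases "x = 0")
      case False
      then have "h (- (x /\<^sub>R norm x)) = h (x /\<^sub>R norm x)"
        using h normalize_in_sphere[of x] unfolding Ce_inf_def by blast
      then show ?thesis by (simp add: hom_ext_def)
    qed simp
    ultimately show ?thesis by simp
  qed
  have 0: "(\<integral>x. ?T (pi/2) x \<partial>lborel) = 0"
    by (rule integral_odd_eq_0[where f="?T (pi/2)", OF _ odd]) (use I[of "pi/2"] in auto)
  have "complex_of_real (hom_ext h q x / ?G) * fourier \<phi> x =
     complex_of_real (inverse ?G * ?T 0 x) + \<i> * complex_of_real (inverse ?G * ?T (pi/2) x)" for x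
  proof -
    have "complex_of_real (a / g) * (complex_of_real t + \<i> * complex_of_real u) =
      complex_of_real (inverse g * (t * a)) + \<i> * complex_of_real (inverse g * (u * a))" for a g t u :: real
      unfolding complex_eq_iff by (simp add: divide_inverse mult_ac)
    then show ?thesis unfolding fourier_eq_trig_transform[OF \<phi>] .
  qed
  then have "fourier_dist (\<lambda>x. complex_of_real (hom_ext h q x / ?G)) \<phi> =
     (\<integral>x. complex_of_real (inverse ?G * ?T 0 x) + \<i> * complex_of_real (inverse ?G * ?T (pi/2) x) \<partial>lborel)"
    unfolding fourier_dist_def by (simp only:)
  also have "\<dots> = (\<integral>x. complex_of_real (inverse ?G * ?T 0 x) \<partial>lborel) + (\<integral>x. \<i> * complex_of_real (inverse ?G * ?T (pi/2) x) \<partial>lborel)"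
    by (rule Bochner_Integration.integral_add)
      (rule integrable_of_real[OF integrable_mult_right[OF I]], rule integrable_mult_right[OF integrable_of_real[OF integrable_mult_right[OF I]]])
  finally show ?thesis
    unfolding integral_mult_right_zero integral_complex_of_real 0 spherical_transform_pairing[OF bc q \<phi>] by simp
qed


section \<open>Surjectivity of the cosine transform\<close>

lemma test_functionD:
  fixes \<phi> :: "'a::euclidean_space \<Rightarrow> real"
  assumes "test_function \<phi>" "0 \<notin> tsupport \<phi>"
  shows "compact_smooth \<phi>" "\<exists>\<delta>>0. \<forall>x. norm x < \<delta> \<longrightarrow> \<phi> x = 0"
proof -
  have out: "\<phi> x = 0" if "x \<notin> tsupport \<phi>" for x
    using that closure_subset[of "{x. \<phi> x \<noteq> 0}"] unfolding tsupport_def by blast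
  have "bounded (tsupport \<phi>)" using assms(1) compact_imp_bounded unfolding test_function_def by blast
  then obtain R where R: "\<And>x. x \<in> tsupport \<phi> \<Longrightarrow> norm x \<le> R" unfolding bounded_iff by blast
  have "\<forall>x. R < norm x \<longrightarrow> \<phi> x = 0" using R out not_le by blast
  then show "compact_smooth \<phi>" using assms(1) unfolding compact_smooth_def test_function_def by blast
  have "open (- tsupport \<phi>)" unfolding tsupport_def by (simp add: open_Compl)
  then obtain \<delta> where "\<delta> > 0" "ball 0 \<delta> \<subseteq> - tsupport \<phi>"
    using assms(2) open_contains_ball by (metis ComplI)
  then show "\<exists>\<delta>>0. \<forall>x. norm x < \<delta> \<longrightarrow> \<phi> x = 0"
    using out by (intro exI[of _ \<delta>]) auto
qed

text \<open>A test function supported in the shell \<open>1 \<le> norm x \<le> 2\<close> whose weighted integral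
  along each ray is a fixed positive multiple of \<open>\<psi>\<close> at the direction of the ray.\<close>

definition annular :: "('a::euclidean_space \<Rightarrow> real) \<Rightarrow> 'a \<Rightarrow> real" where
  "annular \<psi> x = flat 0 (x \<bullet> x - 1) * flat 0 (4 - x \<bullet> x) * \<psi> (x /\<^sub>R norm x)"

lemma annular_eq_0: "norm x \<le> 1 \<Longrightarrow> annular \<psi> x = 0" "2 \<le> norm x \<Longrightarrow> annular \<psi> x = 0"
proof -
  assume "norm x \<le> 1"
  then have "x \<bullet> x - 1 \<le> 0"
    unfolding power2_norm_eq_inner[symmetric] by (simp add: power_le_one)
  then show "annular \<psi> x = 0" by (simp add: annular_def flat_def)
next
  assume "2 \<le> norm x"
  from power_mono[OF this, of 2] have "4 - x \<bullet> x \<le> 0"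
    unfolding power2_norm_eq_inner[symmetric] by simp
  then show "annular \<psi> x = 0" by (simp add: annular_def flat_def)
qed

lemma annular_smooth:
  fixes \<psi> :: "'a::euclidean_space \<Rightarrow> real"
  assumes "\<psi> \<in> Ce_inf"
  shows "smooth_on UNIV (annular \<psi>)"
  unfolding smooth_on_iff_Ck
proof
  fix k
  have i: "Ck k (-{0}) (\<lambda>x::'a. c + d * (x \<bullet> x))" for c d
    by (intro Ck_add Ck_mult Ck_const Ck_inner_self) auto
  have fl: "Ck k (-{0}) (\<lambda>x::'a. flat 0 (c + d * (x \<bullet> x)))" for c d
    by (rule Ck_compose[OF _ _ Ck_flat i]) auto
  have "Ck k (-{0}) (\<lambda>x. \<psi> (x /\<^sub>R norm x))" using assms by (simp add: Ce_inf_def smooth_on_iff_Ck)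
  then have "Ck k (-{0}) (\<lambda>x. flat 0 (-1 + 1 * (x \<bullet> x)) * flat 0 (4 + (-1) * (x \<bullet> x)) * \<psi> (x /\<^sub>R norm x))"
    by (intro Ck_mult fl) auto
  then have 1: "Ck k (-{0}) (annular \<psi>)"
    by (rule Ck_cong_open[rotated 2]) (auto simp: annular_def)
  \<comment> \<open>The direction x/|x| is not smooth at 0, but \<open>annular \<psi>\<close>
    vanishes on the unit ball; smoothness is glued from two open sets.\<close>
  have 2: "Ck k (ball 0 1) (annular \<psi>)"
    by (rule Ck_cong_open[OF _ _ Ck_const[of _ _ 0]]) (auto simp: annular_eq_0)
  have "- {0} \<union> ball 0 1 = (UNIV :: 'a set)" by auto
  with Ck_Un[OF 1 2] show "Ck k UNIV (annular \<psi>)" by simp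
qed

lemma annular_test_function:
  fixes \<psi> :: "'a::euclidean_space \<Rightarrow> real"
  assumes "\<psi> \<in> Ce_inf"
  shows "test_function (annular \<psi>)" "0 \<notin> tsupport (annular \<psi>)"
proof -
  let ?A = "cball 0 2 - ball (0::'a) 1"
  have A: "compact ?A" by (intro compact_diff) auto
  have "tsupport (annular \<psi>) \<subseteq> ?A"
    unfolding tsupport_def
  proof (rule closure_minimal[OF _ compact_imp_closed[OF A]])
    show "{x. annular \<psi> x \<noteq> 0} \<subseteq> ?A"
    proof clarify
      fix x :: 'a assume "annular \<psi> x \<noteq> 0"
      then have "\<not> norm x \<le> 1" "\<not> 2 \<le> norm x" using annular_eq_0 by metis+
      then show "x \<in> ?A" by simp
    qed
  qed
  moreover have "closed (tsupport (annular \<psi>))" unfolding tsupport_def by simp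
  ultimately have "compact (tsupport (annular \<psi>))"
    using A compact_Int_closed inf.absorb2 by metis
  then show "test_function (annular \<psi>)" unfolding test_function_def using annular_smooth[OF assms] by simp
  show "0 \<notin> tsupport (annular \<psi>)" using \<open>tsupport (annular \<psi>) \<subseteq> ?A\<close> by auto
qed

lemma annular_nonneg:
  assumes "\<And>x. x \<in> sphere 0 1 \<Longrightarrow> 0 \<le> \<psi> x"
  shows "0 \<le> annular \<psi> x"
proof (cases "x = 0")
  case False
  from assms[OF normalize_in_sphere[OF this]] show ?thesis
    unfolding annular_def by (intro mult_nonneg_nonneg flat_nonneg)
qed (simp add: annular_eq_0)

lemma annular_weight_pos:
  "0 < (\<integral>s. indicator {0<..} s * s powr a * (flat 0 (s\<^sup>2 - 1) * flat 0 (4 - s\<^sup>2)) \<partial>lborel)"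
proof (rule integral_pos_open[where U="{1<..<2}"])
  let ?f = "\<lambda>s::real. s powr a * (flat 0 (s\<^sup>2 - 1) * flat 0 (4 - s\<^sup>2))"
  have fl: "continuous_on UNIV (flat 0)"
    by (intro smooth_on_imp_continuous_on) (simp add: smooth_on_iff_Ck Ck_flat)
  have c: "continuous_on {1..2} ?f"
    by (intro continuous_on_mult continuous_on_compose2[OF fl] continuous_intros) auto
  \<comment> \<open>For s > 0 outside [1,2] a \<open>flat\<close> factor vanishes; so
    \<open>s powr a\<close>, which may blow up at 0, is only seen on a compact interval where it is
    continuous.\<close>
  have "indicator {0<..} s * s powr a * (flat 0 (s\<^sup>2 - 1) * flat 0 (4 - s\<^sup>2)) = indicator {1..2} s *\<^sub>R ?f s" for s :: real
  proof (cases "s \<in> {1..2}")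
    case False
    have "s \<le> 0 \<or> flat 0 (s\<^sup>2 - 1) * flat 0 (4 - s\<^sup>2) = 0"
    proof -
      consider "s \<le> 0" | "0 < s" "s < 1" | "2 < s" using False by force
      then show ?thesis
      proof cases
        case 2
        then have "s\<^sup>2 \<le> 1" by (simp add: power_le_one)
        then show ?thesis by (simp add: flat_def)
      next
        case 3
        from power_mono[of 2 s 2] 3 have "4 \<le> s\<^sup>2" by simp
        then show ?thesis by (simp add: flat_def)
      qed simp
    qed
    then show ?thesis using False by auto
  qed auto
  then show "integrable lborel (\<lambda>s. indicator {0<..} s * s powr a * (flat 0 (s\<^sup>2 - 1) * flat 0 (4 - s\<^sup>2)))"
    using borel_integrable_compact[OF compact_Icc c] by (simp only:)
  show "0 \<le> indicator {0<..} s * s powr a * (flat 0 (s\<^sup>2 - 1) * flat 0 (4 - s\<^sup>2))" for s :: real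
    by (intro mult_nonneg_nonneg flat_nonneg) auto
  show "0 < indicator {0<..} s * s powr a * (flat 0 (s\<^sup>2 - 1) * flat 0 (4 - s\<^sup>2))" if "s \<in> {1<..<2}" for s :: real
  proof -
    have "1 < s\<^sup>2" using that by (simp add: one_less_power)
    moreover have "s\<^sup>2 < 4" using power_strict_mono[of s 2 2] that by simp
    ultimately show ?thesis using that by (simp add: flat_pos_iff)
  qed
qed auto

text \<open>On a ray \<open>annular \<psi>\<close> is a fixed radial profile times the value of
  \<psi>; the factor 2 comes from the evenness of \<psi>.\<close>

lemma annular_radial_integral:
  fixes \<psi> :: "'a::euclidean_space \<Rightarrow> real"
  assumes \<psi>: "\<psi> \<in> Ce_inf" and \<xi>: "\<xi> \<in> sphere 0 1"
  shows "(\<integral>s. indicator {0<..} s * s powr a * (annular \<psi> (s *\<^sub>R \<xi>) + annular \<psi> (- (s *\<^sub>R \<xi>))) \<partial>lborel) =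
    2 * (\<integral>s. indicator {0<..} s * s powr a * (flat 0 (s\<^sup>2 - 1) * flat 0 (4 - s\<^sup>2)) \<partial>lborel) * \<psi> \<xi>"
proof -
  have "indicator {0<..} s * s powr a * (annular \<psi> (s *\<^sub>R \<xi>) + annular \<psi> (- (s *\<^sub>R \<xi>))) =
     (2 * \<psi> \<xi>) * (indicator {0<..} s * s powr a * (flat 0 (s\<^sup>2 - 1) * flat 0 (4 - s\<^sup>2)))" for s
  proof (cases "s > 0")
    case True
    have "\<psi> (- \<xi>) = \<psi> \<xi>" using \<psi> \<xi> unfolding Ce_inf_def by blast
    moreover have "\<xi> \<bullet> \<xi> = 1" using \<xi> power2_norm_eq_inner[of \<xi>] by simp
    ultimately have "annular \<psi> (s *\<^sub>R \<xi>) = flat 0 (s\<^sup>2 - 1) * flat 0 (4 - s\<^sup>2) * \<psi> \<xi>"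
      "annular \<psi> (- (s *\<^sub>R \<xi>)) = flat 0 (s\<^sup>2 - 1) * flat 0 (4 - s\<^sup>2) * \<psi> \<xi>"
      using True \<xi> by (simp_all add: annular_def power2_eq_square)
    then show ?thesis by simp
  qed simp
  then show ?thesis by (simp only: integral_mult_right_zero mult_ac)
qed

text \<open>An explicit right inverse up to a positive factor c that is the same for all
  \<psi>.\<close>

lemma cosine_transform_surjective:
  fixes q :: real
  assumes q: "q > 0" "\<forall>k::nat. k \<ge> 1 \<longrightarrow> q \<noteq> 2 * real k"
  shows "\<exists>c>0. \<forall>\<psi> \<in> (Ce_inf :: ('a::euclidean_space \<Rightarrow> real) set). \<forall>\<xi>\<in>sphere 0 1.
     cosine_transform q (spherical_transform q (annular \<psi>)) \<xi> = c * \<psi> \<xi>"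
proof -
  obtain c where c: "c > 0" "\<And>(\<phi> :: 'a \<Rightarrow> real) \<xi> \<delta>. compact_smooth \<phi> \<Longrightarrow> \<delta> > 0 \<Longrightarrow> (\<forall>x. norm x < \<delta> \<longrightarrow> \<phi> x = 0) \<Longrightarrow> norm \<xi> = 1 \<Longrightarrow>
     cosine_transform q (spherical_transform q \<phi>) \<xi> =
     c * (\<integral>s. indicator {0<..} s * s powr (- q - 1) * (\<phi> (s *\<^sub>R \<xi>) + \<phi> (- (s *\<^sub>R \<xi>))) \<partial>lborel)"
    using cosine_transform_spherical_transform[OF q, where 'a='a] by blast
  let ?w = "\<integral>s. indicator {0<..} s * s powr (- q - 1) * (flat 0 (s\<^sup>2 - 1) * flat 0 (4 - s\<^sup>2)) \<partial>lborel"
  have "cosine_transform q (spherical_transform q (annular \<psi>)) \<xi> = (c * (2 * ?w)) * \<psi> \<xi>"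
    if "\<psi> \<in> Ce_inf" "\<xi> \<in> sphere 0 1" for \<psi> and \<xi> :: 'a
  proof -
    note tf = annular_test_function[OF that(1)]
    have "cosine_transform q (spherical_transform q (annular \<psi>)) \<xi> =
     c * (\<integral>s. indicator {0<..} s * s powr (- q - 1) * (annular \<psi> (s *\<^sub>R \<xi>) + annular \<psi> (- (s *\<^sub>R \<xi>))) \<partial>lborel)"
      by (rule c(2)[OF test_functionD(1)[OF tf], where \<delta>=1])
        (use that in \<open>auto intro: annular_eq_0(1) less_imp_le\<close>)
    then show ?thesis unfolding annular_radial_integral[OF that] by (simp only: mult.assoc)
  qed
  moreover have "c * (2 * ?w) > 0" using c(1) annular_weight_pos[of "- q - 1"] by simp
  ultimately show ?thesis by blast
qed

text \<open>H is tested against a smooth even function that is positive exactly where H < 0; if that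
  set met the sphere, the integral would be negative.\<close>

lemma nonneg_on_sphere_if_weakly_nonneg:
  fixes H :: "'a::euclidean_space \<Rightarrow> real"
  assumes H: "H \<in> Ce_inf"
    and weak: "\<And>\<psi>. \<psi> \<in> Ce_inf \<Longrightarrow> (\<And>x. x \<in> sphere 0 1 \<Longrightarrow> 0 \<le> \<psi> x) \<Longrightarrow> 0 \<le> sphere_integral (\<lambda>x. H x * \<psi> x)"
    and \<xi>: "\<xi> \<in> sphere 0 1"
  shows "0 \<le> H \<xi>"
proof (rule ccontr)
  assume "\<not> 0 \<le> H \<xi>"
  define \<psi> where "\<psi> x = flat 0 (- H x)" for x
  have Ck_neg: "Ck k (-{0}) (\<lambda>x. (-1) * H (x /\<^sub>R norm x))" for k
    using H by (intro Ck_mult Ck_const) (auto simp: Ce_inf_def smooth_on_iff_Ck)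
  have "Ck k (-{0}) (\<lambda>x. flat 0 ((-1) * H (x /\<^sub>R norm x)))" for k
    by (rule Ck_compose[OF _ _ Ck_flat Ck_neg]) auto
  then have \<psi>: "\<psi> \<in> Ce_inf"
    using H by (simp add: Ce_inf_def smooth_on_iff_Ck \<psi>_def)
  have neg: "0 \<le> - (H x * \<psi> x)" "H x < 0 \<Longrightarrow> 0 < - (H x * \<psi> x)" for x
  proof -
    show "0 \<le> - (H x * \<psi> x)"
    proof (cases "H x < 0")
      case True
      then show ?thesis using flat_nonneg[of 0 "- H x"] by (simp add: \<psi>_def mult_nonpos_nonneg)
    qed (simp add: \<psi>_def flat_def)
    show "0 < - (H x * \<psi> x)" if "H x < 0"
      using that flat_pos_iff[of 0 "- H x"] by (simp add: \<psi>_def mult_neg_pos)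
  qed
  have "bounded_cone (\<lambda>x. - (H x * \<psi> x))"
  proof (rule Ce_inf_bounded_cone)
    have "Ck k (-{0}) (\<lambda>x. (-1) * H (x /\<^sub>R norm x) * \<psi> (x /\<^sub>R norm x))" for k
      using \<psi> by (intro Ck_mult Ck_neg) (auto simp: Ce_inf_def smooth_on_iff_Ck)
    then show "(\<lambda>x. - (H x * \<psi> x)) \<in> Ce_inf"
      using H \<psi> by (simp add: Ce_inf_def smooth_on_iff_Ck)
  qed
  from bounded_cone_ball_integrable[OF this]
  have I: "integrable lborel (\<lambda>x. indicator (ball 0 1 - {0}) x * - (H (x /\<^sub>R norm x) * \<psi> (x /\<^sub>R norm x)))" .
  \<comment> \<open>The cone over the negative set, cut to the unit ball: it is open in the whole
    space, hence of positive measure if nonempty. The ball is open and \<xi> is on its boundary, so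
    \<xi>/2 serves as the witness.\<close>
  let ?U = "(- {0} \<inter> (\<lambda>x. H (x /\<^sub>R norm x)) -` {..<0}) \<inter> ball 0 1"
  have "open ?U"
    by (rule open_Int[OF continuous_open_preimage[OF Ce_inf_continuous[OF H]]]) auto
  have "0 < (\<integral>x. indicator (ball 0 1 - {0}) x * - (H (x /\<^sub>R norm x) * \<psi> (x /\<^sub>R norm x)) \<partial>lborel)"
  proof (rule integral_pos_open[OF I _ \<open>open ?U\<close>])
    show "0 \<le> indicator (ball 0 1 - {0}) x * - (H (x /\<^sub>R norm x) * \<psi> (x /\<^sub>R norm x))" for x
      by (intro mult_nonneg_nonneg neg) auto
    show "0 < indicator (ball 0 1 - {0}) x * - (H (x /\<^sub>R norm x) * \<psi> (x /\<^sub>R norm x))" if "x \<in> ?U" for x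
      using that neg(2)[of "x /\<^sub>R norm x"] by simp
    have "(1/2) *\<^sub>R \<xi> \<in> ?U" using \<xi> \<open>\<not> 0 \<le> H \<xi>\<close> by auto
    then show "?U \<noteq> {}" by blast
  qed
  then have "0 < sphere_integral (\<lambda>x. - (H x * \<psi> x))"
    unfolding sphere_integral_def by (intro mult_pos_pos) auto
  also have "\<dots> = - sphere_integral (\<lambda>x. H x * \<psi> x)"
    using sphere_integral_cmult[of "-1" "\<lambda>x. H x * \<psi> x"] by simp
  finally show False using weak[OF \<psi>] flat_nonneg by (simp add: \<psi>_def)
qed

theorem theorem2:
  fixes q :: real
  assumes "q > 0" and "\<forall>k::nat. k \<ge> 1 \<longrightarrow> q \<noteq> 2 * real k"
  shows "Pos (cosine_transform q :: ('a::euclidean_space \<Rightarrow> real) \<Rightarrow> ('a \<Rightarrow> real)) =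
         {h \<in> Ce_inf. positive_off_origin
            (fourier_dist (\<lambda>x. complex_of_real (hom_ext h q x / Gamma (- q / 2))))}"
proof (intro set_eqI iffI)
  fix h :: "'a \<Rightarrow> real"
  assume "h \<in> Pos (cosine_transform q)"
  then have h: "h \<in> Ce_inf"
    and pos: "\<And>f. f \<in> Ce_inf \<Longrightarrow> \<forall>x\<in>sphere 0 1. 0 \<le> cosine_transform q f x \<Longrightarrow> 0 \<le> sphere_integral (\<lambda>x. f x * h x)"
    unfolding Pos_def by blast+
  obtain c where c: "c > 0" "\<And>(\<phi> :: 'a \<Rightarrow> real) \<xi> \<delta>. compact_smooth \<phi> \<Longrightarrow> \<delta> > 0 \<Longrightarrow> (\<forall>x. norm x < \<delta> \<longrightarrow> \<phi> x = 0) \<Longrightarrow> norm \<xi> = 1 \<Longrightarrow>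
     cosine_transform q (spherical_transform q \<phi>) \<xi> =
     c * (\<integral>s. indicator {0<..} s * s powr (- q - 1) * (\<phi> (s *\<^sub>R \<xi>) + \<phi> (- (s *\<^sub>R \<xi>))) \<partial>lborel)"
    using cosine_transform_spherical_transform[OF assms, where 'a='a] by blast
  have "positive_off_origin (fourier_dist (\<lambda>x. complex_of_real (hom_ext h q x / Gamma (- q / 2))))"
    unfolding positive_off_origin_def
  proof (intro allI impI, elim conjE)
    fix \<phi> :: "'a \<Rightarrow> real"
    assume "test_function \<phi>" "\<forall>x. 0 \<le> \<phi> x" "0 \<notin> tsupport \<phi>"
    note \<phi> = test_functionD[OF this(1,3)] and nn = \<open>\<forall>x. 0 \<le> \<phi> x\<close>
    obtain \<delta> where \<delta>: "\<delta> > 0" "\<forall>x. norm x < \<delta> \<longrightarrow> \<phi> x = 0" using \<phi>(2) by blast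
    have "0 \<le> sphere_integral (\<lambda>x. spherical_transform q \<phi> x * h x)"
    proof (rule pos[OF spherical_transform_in_Ce_inf[OF \<phi>(1) assms(1)]], rule ballI)
      fix \<xi> :: 'a assume "\<xi> \<in> sphere 0 1"
      then have "norm \<xi> = 1" by simp
      have "0 \<le> (\<integral>s. indicator {0<..} s * s powr (- q - 1) * (\<phi> (s *\<^sub>R \<xi>) + \<phi> (- (s *\<^sub>R \<xi>))) \<partial>lborel)"
        using nn by (intro integral_nonneg_AE AE_I2 mult_nonneg_nonneg add_nonneg_nonneg) auto
      then show "0 \<le> cosine_transform q (spherical_transform q \<phi>) \<xi>"
        unfolding c(2)[OF \<phi>(1) \<delta> \<open>norm \<xi> = 1\<close>] using c(1) by (intro mult_nonneg_nonneg) auto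
    qed
    then show "Im (fourier_dist (\<lambda>x. complex_of_real (hom_ext h q x / Gamma (- q / 2))) \<phi>) = 0 \<and>
      0 \<le> Re (fourier_dist (\<lambda>x. complex_of_real (hom_ext h q x / Gamma (- q / 2))) \<phi>)"
      unfolding fourier_dist_hom_ext[OF h assms(1) \<phi>(1)] by simp
  qed
  with h show "h \<in> {h \<in> Ce_inf. positive_off_origin
            (fourier_dist (\<lambda>x. complex_of_real (hom_ext h q x / Gamma (- q / 2))))}" by blast
next
  fix h :: "'a \<Rightarrow> real"
  assume "h \<in> {h \<in> Ce_inf. positive_off_origin
            (fourier_dist (\<lambda>x. complex_of_real (hom_ext h q x / Gamma (- q / 2))))}"
  then have h: "h \<in> Ce_inf"
    and pos: "positive_off_origin (fourier_dist (\<lambda>x. complex_of_real (hom_ext h q x / Gamma (- q / 2))))"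
    by blast+
  obtain c where c: "c > 0" "\<And>(\<psi> :: 'a \<Rightarrow> real) \<xi>. \<psi> \<in> Ce_inf \<Longrightarrow> \<xi> \<in> sphere 0 1 \<Longrightarrow>
     cosine_transform q (spherical_transform q (annular \<psi>)) \<xi> = c * \<psi> \<xi>"
    using cosine_transform_surjective[OF assms, where 'a='a] by blast
  \<comment> \<open>On the sphere its cosine transform is c times h, which accounts for the factor c
    in \<open>adj\<close>.\<close>
  define H where "H = spherical_transform q (annular h)"
  have Ce: "spherical_transform q (annular \<psi>) \<in> Ce_inf" if "\<psi> \<in> Ce_inf" for \<psi> :: "'a \<Rightarrow> real"
    by (rule spherical_transform_in_Ce_inf[OF test_functionD(1)[OF annular_test_function[OF that]] assms(1)])
  have H: "H \<in> Ce_inf" unfolding H_def by (rule Ce[OF h])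
  \<comment> \<open>Used twice: with f the preimage of a multiple of \<psi> it shows that H is
    nonnegative, and then with arbitrary f it gives membership in \<open>Pos\<close>.\<close>
  have adj: "c * sphere_integral (\<lambda>x. f x * h x) = sphere_integral (\<lambda>x. H x * cosine_transform q f x)"
    if f: "f \<in> Ce_inf" for f
  proof -
    have "c * sphere_integral (\<lambda>x. f x * h x) = sphere_integral (\<lambda>x. c * (f x * h x))"
      by (rule sphere_integral_cmult[symmetric])
    also have "\<dots> = sphere_integral (\<lambda>x. f x * cosine_transform q H x)"
      by (rule sphere_integral_cong) (simp add: H_def c(2)[OF h])
    also have "\<dots> = sphere_integral (\<lambda>x. H x * cosine_transform q f x)"
      using assms(1) by (intro cosine_transform_self_adjoint Ce_inf_bounded_cone f H) auto
    finally show ?thesis .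
  qed
  have H_nonneg: "0 \<le> H \<xi>" if "\<xi> \<in> sphere 0 1" for \<xi>
  proof (rule nonneg_on_sphere_if_weakly_nonneg[OF H _ that])
    fix \<psi> :: "'a \<Rightarrow> real"
    assume \<psi>: "\<psi> \<in> Ce_inf" "\<And>x. x \<in> sphere 0 1 \<Longrightarrow> 0 \<le> \<psi> x"
    note tf = annular_test_function[OF \<psi>(1)]
    let ?D = "fourier_dist (\<lambda>x. complex_of_real (hom_ext h q x / Gamma (- q / 2))) (annular \<psi>)"
    have "0 \<le> Re ?D"
      using pos tf annular_nonneg[of \<psi>] \<psi>(2) unfolding positive_off_origin_def by blast
    then have "0 \<le> sphere_integral (\<lambda>x. spherical_transform q (annular \<psi>) x * h x)"
      unfolding fourier_dist_hom_ext[OF h assms(1) test_functionD(1)[OF tf]] by simp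
    then have "0 \<le> c * sphere_integral (\<lambda>x. spherical_transform q (annular \<psi>) x * h x)"
      using c(1) by (intro mult_nonneg_nonneg) auto
    also have "\<dots> = sphere_integral (\<lambda>x. H x * cosine_transform q (spherical_transform q (annular \<psi>)) x)"
      by (rule adj[OF Ce[OF \<psi>(1)]])
    also have "\<dots> = sphere_integral (\<lambda>x. c * (H x * \<psi> x))"
      by (rule sphere_integral_cong) (simp add: c(2)[OF \<psi>(1)])
    finally show "0 \<le> sphere_integral (\<lambda>x. H x * \<psi> x)"
      unfolding sphere_integral_cmult using c(1) by (simp add: zero_le_mult_iff)
  qed
  have "0 \<le> sphere_integral (\<lambda>x. f x * h x)"
    if f: "f \<in> Ce_inf" and C: "\<forall>x\<in>sphere 0 1. 0 \<le> cosine_transform q f x" for f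
  proof -
    have "0 \<le> c * sphere_integral (\<lambda>x. f x * h x)"
      unfolding adj[OF f] by (rule sphere_integral_nonneg) (use C H_nonneg in auto)
    then show ?thesis using c(1) by (simp add: zero_le_mult_iff)
  qed
  with h show "h \<in> Pos (cosine_transform q)" unfolding Pos_def by blast
qed

end
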